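(* Let $n\in\{2l,2l+1\}$, let $P$ be a standard parabolic subgroup of $\mathrm{SO}_n=\mathrm{SO}_n(\mathbf{C})$, given as the stabilizer in $\mathrm{SO}_n$ of a totally isotropic flag $V_1\subset\dots\subset V_k$, and let $(b_1,\dots,b_k)$ be its block vector. Let $P$ act by conjugation on $\mathcal{N}(2)=\{x\in\mathfrak{g}\mid x^2=0\}$, where $\mathfrak{g}=\mathfrak{o}_n$ is the Lie algebra of $\mathrm{SO}_n$. Then there is a natural bijection between the set of $P$-orbits in $\mathcal{N}(2)$ and the set of enhanced orthogonal oriented link patterns of size $k$ and of type $(b_1,\dots,b_k)$.
   Context: The ground field is $K=\mathbf{C}$. Let $J_n$ be the $n\times n$ anti-diagonal matrix with all anti-diagonal entries equal to $1$. Then $\mathrm{O}_n=\{A\in\mathrm{GL}_n(K)\mid A^TJ_nA=J_n\}$, $\mathrm{SO}_n=\{A\in\mathrm{O}_n\mid\det A=1\}$, and $\mathfrak{o}_n=\{a\in K^{n\times n}\mid a^TJ_n+J_na=0\}$. The standard Borel subgroup $B$ of $\mathrm{SO}_n$ consists of its upper-triangular matrices, and a standard parabolic subgroup is a subgroup $P$ containing $B$. A totally isotropic flag is a chain of nonzero subspaces $V_1\subsetneq\dots\subsetneq V_k$ of $K^n$ on each of which the bilinear form given by $J_n$ vanishes identically; a parabolic subgroup is the stabilizer of such a flag (for $n=2l$, the flag need not consist of subspaces of the form $\langle e_1,\dots,e_d\rangle$). Put $d_i=\dim V_i$; the block vector of $P$ is $(b_1,\dots,b_k)=(d_1,d_2-d_1,\dots,d_k-d_{k-1})$.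 An enhanced orthogonal oriented link pattern (eoolp) of size $k$ of type $(b_1,\dots,b_k)$ consists of $k$ vertices $1,\dots,k$ together with a collection of (undotted) oriented arrows between different vertices, a collection of (undotted) unoriented loops, and a collection of oriented arrows with dots between arbitrary vertices. Multiple arrows and multiple loops are allowed, and only their multiplicities matter. Loops with dots come in two different orientations (clockwise and counterclockwise), which are regarded as different. For each vertex $i$ let $x_i$ be the number of sources of oriented arrows at $i$ and $y_i$ the number of targets of oriented arrows at $i$ (dotted and undotted; a dotted loop at $i$ contributes $1$ to $x_i$ and $1$ to $y_i$; unoriented loops contribute to neither), and let $z_i$ be the number of unoriented loops at $i$. The pattern is required to satisfy, for each vertex $i$: $x_i+y_i+2z_i\leq b_i$.
   Formalization: The last member V_k of the flag is additionally assumed to be maximal totally isotropic (dim V_k = l); otherwise the claim fails, e.g. n=4 with flag <e_1>: block vector (1) allows one pattern, but N(2) has more than one P-orbit. *)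

theory Defs
  imports "HOL-Analysis.Analysis" "HOL-Algebra.Group_Action" "HOL-Library.Multiset"
begin

section \<open>The special orthogonal group and its Lie algebra\<close>

text \<open>
  The index type \<open>'n\<close> is an arbitrary finite linear order, so \<open>CARD('n)\<close> plays the role of \<open>n\<close>.
  The \<open>r\<close>-th element of \<open>'n\<close> (counted from 0) is the one with \<open>card {..<i} = r\<close>.
\<close>

type_synonym 'n cvec = "(complex, 'n) vec"
type_synonym 'n cmat = "((complex, 'n) vec, 'n) vec"

definition antidiag :: "'n::{finite,linorder} cmat" where
  "antidiag = (\<chi> i j. if card {..<i} + card {..<j} + 1 = CARD('n) then 1 else 0)"

definition oform :: "'n::{finite,linorder} cvec \<Rightarrow> 'n cvec \<Rightarrow> complex" where
  "oform u v = (\<Sum>i\<in>UNIV. u $ i * (antidiag *v v) $ i)"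

definition orthogonal_group :: "'n::{finite,linorder} cmat set" where
  "orthogonal_group = {A. invertible A \<and> transpose A ** antidiag ** A = antidiag}"

definition special_orthogonal :: "'n::{finite,linorder} cmat set" where
  "special_orthogonal = {A \<in> orthogonal_group. det A = 1}"

definition SO :: "'n::{finite,linorder} cmat monoid" where
  "SO = \<lparr>carrier = special_orthogonal, mult = (**), one = mat 1\<rparr>"

definition orthogonal_lie :: "'n::{finite,linorder} cmat set" where
  "orthogonal_lie = {a. transpose a ** antidiag + antidiag ** a = 0}"

definition nilpotent2 :: "'n::{finite,linorder} cmat set" where
  "nilpotent2 = {x \<in> orthogonal_lie. x ** x = 0}"

definition conjugation :: "'n::finite cmat \<Rightarrow> 'n cmat \<Rightarrow> 'n cmat" where
  "conjugation A x = A ** x ** matrix_inv A"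

section \<open>Parabolic subgroups and isotropic flags\<close>

definition borel_subgroup :: "'n::{finite,linorder} cmat set" where
  "borel_subgroup = {A \<in> special_orthogonal. \<forall>i j. j < i \<longrightarrow> A $ i $ j = 0}"

definition standard_parabolic :: "'n::{finite,linorder} cmat set \<Rightarrow> bool" where
  "standard_parabolic P \<longleftrightarrow> subgroup P SO \<and> borel_subgroup \<subseteq> P"

text \<open>
  Flags are indexed by \<open>1, \<dots>, k\<close>; values of \<open>V\<close> outside this range are irrelevant.
  The constants of \<open>vec\<close> are the complex-linear ones (unprefixed \<open>subspace\<close>, \<open>dim\<close> are real).
\<close>

definition isotropic_flag :: "nat \<Rightarrow> (nat \<Rightarrow> 'n::{finite,linorder} cvec set) \<Rightarrow> bool" where
  "isotropic_flag k V \<longleftrightarrow>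
     (\<forall>i\<in>{1..k}. vec.subspace (V i) \<and> V i \<noteq> {0} \<and> (\<forall>u\<in>V i. \<forall>v\<in>V i. oform u v = 0)) \<and>
     (\<forall>i\<in>{1..<k}. V i \<subset> V (Suc i))"

definition flag_stabilizer ::
    "nat \<Rightarrow> (nat \<Rightarrow> 'n::{finite,linorder} cvec set) \<Rightarrow> 'n cmat set" where
  "flag_stabilizer k V = {A \<in> special_orthogonal. \<forall>i\<in>{1..k}. (\<lambda>v. A *v v) ` V i = V i}"

definition flag_dim :: "(nat \<Rightarrow> 'n::finite cvec set) \<Rightarrow> nat \<Rightarrow> nat" where
  "flag_dim V i = (if i = 0 then 0 else vec.dim (V i))"

text \<open>
  A parabolic subgroup determines this vector only if the flag is normalised. For \<open>n = 4\<close> the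
  flags \<open>\<langle>e\<^sub>1\<rangle>\<close> and \<open>\<langle>e\<^sub>1\<rangle> \<subset> \<langle>e\<^sub>1, e\<^sub>2\<rangle>\<close> both have stabilizer \<open>B\<close>, with block vectors \<open>(1)\<close>
  and \<open>(1, 1)\<close>; there are five \<open>B\<close>-orbits, five patterns of type \<open>(1, 1)\<close>, and one pattern of
  type \<open>(1)\<close>. More generally, patterns carry no data for the space \<open>V\<^sub>k\<^sup>\<bottom>/V\<^sub>k\<close>, so they
  can count orbits only if its dimension \<open>n - 2 d\<^sub>k\<close> is 0 or 1, that is, if \<open>V\<^sub>k\<close> is a maximal
  totally isotropic subspace (\<open>d\<^sub>k = l\<close> for \<open>n \<in> {2l, 2l+1}\<close>).
\<close>

definition block_vector :: "(nat \<Rightarrow> 'n::finite cvec set) \<Rightarrow> nat \<Rightarrow> nat" where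
  "block_vector V i = flag_dim V i - flag_dim V (i - 1)"

section \<open>Enhanced orthogonal oriented link patterns\<close>

datatype orientation = Clockwise | Counterclockwise

datatype link =
    Arrow nat nat
  | Loop nat
  | DotArrow nat nat
  | DotLoop orientation nat

fun source :: "link \<Rightarrow> nat" where
  "source (Arrow i j) = i"
| "source (Loop i) = i"
| "source (DotArrow i j) = i"
| "source (DotLoop r i) = i"

fun target :: "link \<Rightarrow> nat" where
  "target (Arrow i j) = j"
| "target (Loop i) = i"
| "target (DotArrow i j) = j"
| "target (DotLoop r i) = i"

fun is_oriented :: "link \<Rightarrow> bool" where
  "is_oriented (Loop i) = False"
| "is_oriented L = True"

fun wf_link :: "nat \<Rightarrow> link \<Rightarrow> bool" where
  "wf_link k (Arrow i j) \<longleftrightarrow> i \<in> {1..k} \<and> j \<in> {1..k} \<and> i \<noteq> j"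
| "wf_link k (Loop i) \<longleftrightarrow> i \<in> {1..k}"
| "wf_link k (DotArrow i j) \<longleftrightarrow> i \<in> {1..k} \<and> j \<in> {1..k} \<and> i \<noteq> j"
| "wf_link k (DotLoop r i) \<longleftrightarrow> i \<in> {1..k}"

definition num_sources :: "link multiset \<Rightarrow> nat \<Rightarrow> nat" where
  "num_sources E i = size {# L \<in># E. is_oriented L \<and> source L = i #}"

definition num_targets :: "link multiset \<Rightarrow> nat \<Rightarrow> nat" where
  "num_targets E i = size {# L \<in># E. is_oriented L \<and> target L = i #}"

definition num_loops :: "link multiset \<Rightarrow> nat \<Rightarrow> nat" where
  "num_loops E i = count E (Loop i)"

definition eoolps :: "nat \<Rightarrow> (nat \<Rightarrow> nat) \<Rightarrow> link multiset set" where
  "eoolps k b = {E. (\<forall>L\<in>#E. wf_link k L) \<and>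
     (\<forall>i\<in>{1..k}. num_sources E i + num_targets E i + 2 * num_loops E i \<le> b i)}"

section \<open>The pattern of a 2-nilpotent element\<close>

text \<open>
  A slot \<open>(i, s)\<close> with \<open>s < b\<^sub>i\<close> stands for a basis vector \<open>e (i, s)\<close> lying in \<open>V\<^sub>i\<close> but not in
  \<open>V\<^bsub>i-1\<^esub>\<close>, and for its dual partner \<open>f (i, s)\<close> with respect to the bilinear form.
\<close>

definition slots :: "nat \<Rightarrow> (nat \<Rightarrow> nat) \<Rightarrow> (nat \<times> nat) set" where
  "slots k b = (SIGMA i:{1..k}. {..<b i})"

definition adapted_basis :: "nat \<Rightarrow> (nat \<Rightarrow> 'n::{finite,linorder} cvec set) \<Rightarrow>
    (nat \<times> nat \<Rightarrow> 'n cvec) \<Rightarrow> (nat \<times> nat \<Rightarrow> 'n cvec) \<Rightarrow> bool" where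
  "adapted_basis k V e f \<longleftrightarrow>
     (\<forall>i\<in>{1..k}. V i = vec.span (e ` slots i (block_vector V))) \<and>
     (\<forall>p\<in>slots k (block_vector V). \<forall>q\<in>slots k (block_vector V).
        oform (e p) (e q) = 0 \<and> oform (f p) (f q) = 0 \<and>
        oform (e p) (f q) = (if p = q then 1 else 0))"

text \<open>The skew endomorphism given by \<open>w \<mapsto> (u, w) v - (v, w) u\<close>.\<close>

definition wedge :: "'n::{finite,linorder} cvec \<Rightarrow> 'n cvec \<Rightarrow> 'n cmat" where
  "wedge u v = matrix (\<lambda>w. oform u w *s v - oform v w *s u)"

text \<open>
  The elementary block of \<open>x\<close> drawn as a link whose ends sit in the slots \<open>p\<close> and \<open>q\<close>. Undotted
  links are \<open>e p \<mapsto> e q\<close>, \<open>f q \<mapsto> - f p\<close>; dotted links are \<open>e p \<mapsto> f q\<close>, \<open>e q \<mapsto> - f p\<close> or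
  \<open>f p \<mapsto> e q\<close>, \<open>f q \<mapsto> - e p\<close>. As the latter two shapes are symmetric in \<open>p\<close> and \<open>q\<close> up to sign,
  the orientation of the dotted link is free to record which one is meant: arrows from a smaller to
  a larger vertex and clockwise loops stand for the first, all others for the second.
\<close>

fun link_block :: "(nat \<times> nat \<Rightarrow> 'n::{finite,linorder} cvec) \<Rightarrow> (nat \<times> nat \<Rightarrow> 'n cvec) \<Rightarrow>
    link \<Rightarrow> nat \<times> nat \<Rightarrow> nat \<times> nat \<Rightarrow> 'n cmat" where
  "link_block e f (Arrow i j) p q = wedge (f p) (e q)"
| "link_block e f (Loop i) p q = wedge (f p) (e q)"
| "link_block e f (DotArrow i j) p q = (if i < j then wedge (f p) (f q) else wedge (e p) (e q))"
| "link_block e f (DotLoop Clockwise i) p q = wedge (f p) (f q)"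
| "link_block e f (DotLoop Counterclockwise i) p q = wedge (e p) (e q)"

text \<open>
  A drawing of \<open>E\<close> attaches the two ends of every link to slots over its source and its target,
  no slot being used twice; \<open>x\<close> has pattern \<open>E\<close> if it is the sum of the corresponding blocks in
  some adapted basis. If \<open>n = 2l + 1\<close>, the vector completing the basis is killed by \<open>x\<close>.
\<close>

definition drawing :: "nat \<Rightarrow> (nat \<Rightarrow> nat) \<Rightarrow> link multiset \<Rightarrow>
    (link \<times> (nat \<times> nat) \<times> (nat \<times> nat)) set \<Rightarrow> bool" where
  "drawing k b E D \<longleftrightarrow> finite D \<and> image_mset fst (mset_set D) = E \<and>
     (\<forall>(L, p, q)\<in>D. p \<in> slots k b \<and> q \<in> slots k b \<and>
        fst p = source L \<and> fst q = target L \<and> p \<noteq> q) \<and>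
     (\<forall>(L, p, q)\<in>D. \<forall>(L', p', q')\<in>D. (L, p, q) \<noteq> (L', p', q') \<longrightarrow> {p, q} \<inter> {p', q'} = {})"

definition has_pattern :: "nat \<Rightarrow> (nat \<Rightarrow> 'n::{finite,linorder} cvec set) \<Rightarrow>
    'n cmat \<Rightarrow> link multiset \<Rightarrow> bool" where
  "has_pattern k V x E \<longleftrightarrow>
     (\<exists>e f D. adapted_basis k V e f \<and> drawing k (block_vector V) E D \<and>
        x = (\<Sum>(L, p, q)\<in>D. link_block e f L p q))"

end

theory Submission
  imports Defs
begin

text \<open>
  Existence of a pattern: extend the flag by the orthogonal complements of its members to a
  self-dual filtration \<open>0 = F\<^sub>0 \<subseteq> \<dots> \<subseteq> F\<^bsub>2k+1\<^esub>\<close> of the whole space and take a nonzero vector \<open>e\<close> in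
  the first nonzero member. According to whether \<open>x e \<noteq> 0\<close>, or \<open>x e = 0\<close> and \<open>e\<close> is or is not in
  the image of \<open>x\<close>, one finds one or two hyperbolic planes that are \<open>x\<close>-stable, compatible with the
  filtration and carry \<open>0\<close> or one elementary block; their orthogonal complement is handled by
  induction on the dimension.

  Uniqueness: in an adapted basis the dimension of \<open>x F\<^sub>a \<inter> F\<^sub>c\<close> is the number of basis vectors of
  level at most \<open>a\<close> sent by \<open>x\<close>, up to sign, to basis vectors of level at most \<open>c\<close>, and these
  numbers determine the multiplicities of the links.

  Equal patterns give conjugate elements: the orthogonal map matching two adapted bases stabilizes
  the flag. In odd dimension its determinant is corrected by a factor \<open>-1\<close>; in even dimension it is
  1 because the map preserves a Lagrangian subspace.
\<close>

section \<open>The bilinear form\<close>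

text \<open>In the existence part, maximality of \<open>V k\<close> enters as \<open>middle\<close>:
  isotropic vectors of the self-dual step \<open>F (k + 1)\<close> lie in \<open>F k\<close>. So
  each hyperbolic pair offers a vector of the flag as its \<open>e\<close>, and \<open>x\<close>
  vanishes on the remainder once \<open>F k\<close> is zero. Taking \<open>e\<close> in the lowest
  nonzero step leaves its partner unconstrained, because the complementary step is already the whole
  space; only the second plane needs control of levels.

  Basis vectors get levels: \<open>i\<close> for an \<open>e\<close> over vertex \<open>i\<close>,
  and \<open>2 * k + 2 - i\<close> for an \<open>f\<close>. Every block is a wedge of two basis
  vectors whose first factor has at least the level of the second. This single rule covers arrows,
  loops and both dotted shapes; it is the reason for the orientation convention of dotted arrows. A
  wedge sends the partner of its first factor to the second, and the partner of the second to minus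
  the first, so each link is seen twice by the dimensions of intersections. The two sightings have
  the same pair of levels only if both ends have equal levels, that is, for dotted loops.\<close>

lemma antidiag_symmetric: "antidiag $ i $ j = antidiag $ j $ i"
  by (simp add: antidiag_def add.commute)

lemma oform_alt: "oform u v = (\<Sum>i\<in>UNIV. \<Sum>j\<in>UNIV. u $ i * antidiag $ i $ j * v $ j)"
  by (simp add: oform_def matrix_vector_mult_def sum_distrib_left mult.assoc)

lemma oform_commute: "oform u v = oform v u"
proof -
  have "oform u v = (\<Sum>j\<in>UNIV. \<Sum>i\<in>UNIV. u $ i * antidiag $ i $ j * v $ j)"
    unfolding oform_alt by (rule sum.swap)
  also have "\<dots> = oform v u"
    unfolding oform_alt
    by (intro sum.cong refl) (metis antidiag_symmetric mult.assoc mult.commute)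
  finally show ?thesis .
qed

lemma oform_add_right: "oform u (v + w) = oform u v + oform u w"
  by (simp add: oform_def vec.add distrib_left sum.distrib)

lemma oform_scale_right: "oform u (c *s v) = c * oform u v"
  by (simp add: oform_def vec.scale sum_distrib_left mult_ac)

lemma oform_add_left: "oform (u + v) w = oform u w + oform v w"
  using oform_add_right oform_commute by metis

lemma oform_scale_left: "oform (c *s u) v = c * oform u v"
  using oform_scale_right oform_commute by metis

lemma oform_zero_right [simp]: "oform u 0 = 0"
  by (simp add: oform_def)

lemma oform_zero_left [simp]: "oform 0 u = 0"
  using oform_zero_right oform_commute by metis

lemma oform_minus_right: "oform u (- v) = - oform u v"
  using oform_scale_right[of u "-1" v] by simp

lemma oform_minus_left: "oform (- u) v = - oform u v"
  using oform_scale_left[of "-1" u v] by simp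

lemma oform_diff_right: "oform u (v - w) = oform u v - oform u w"
  using oform_add_right[of u v "- w"] by (simp add: oform_minus_right)

lemma oform_diff_left: "oform (u - v) w = oform u w - oform v w"
  using oform_add_left[of u "- v" w] by (simp add: oform_minus_left)

lemma oform_sum_right: "oform u (\<Sum>a\<in>S. g a) = (\<Sum>a\<in>S. oform u (g a))"
  by (induction S rule: infinite_finite_induct) (simp_all add: oform_add_right)

lemma oform_sum_left: "oform (\<Sum>a\<in>S. g a) u = (\<Sum>a\<in>S. oform (g a) u)"
  by (induction S rule: infinite_finite_induct) (simp_all add: oform_add_left)

lemmas oform_linear = oform_add_left oform_add_right oform_diff_left oform_diff_right
  oform_scale_left oform_scale_right oform_minus_left oform_minus_right

lemma bij_betw_rank: "bij_betw (\<lambda>i::'n::{finite,linorder}. card {..<i}) UNIV {..<CARD('n)}"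
proof -
  have less: "card {..<i} < card {..<j}" if "i < j" for i j :: 'n
    using that by (intro psubset_card_mono) auto
  have inj: "inj (\<lambda>i::'n. card {..<i})"
    by (rule injI) (metis less less_irrefl linorder_neqE)
  have "card {..<i} < CARD('n)" for i :: 'n
    by (intro psubset_card_mono) auto
  then have "range (\<lambda>i::'n. card {..<i}) = {..<CARD('n)}"
    by (intro card_subset_eq) (auto simp: card_image inj)
  with inj show ?thesis
    by (simp add: bij_betw_def)
qed

text \<open>The matrix is the permutation matrix of the order reversal of the index type, so pairing
  with a coordinate vector returns a single coordinate.\<close>

lemma antidiag_involution:
  obtains r :: "'n::{finite,linorder} \<Rightarrow> 'n" where
    "\<And>i j. antidiag $ i $ j = (if i = r j then 1 else 0)" "\<And>i. r (r i) = i"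
proof -
  let ?c = "\<lambda>i::'n. card {..<i}"
  have inj: "?c i = ?c j \<Longrightarrow> i = j" for i j
    using bij_betw_rank by (metis bij_betw_imp_inj_on injD)
  have lt: "?c j < CARD('n)" for j :: 'n
    using bij_betw_rank[where 'n='n] bij_betwE by fastforce
  have "\<exists>i. ?c i + ?c j + 1 = CARD('n)" for j
  proof -
    have "CARD('n) - 1 - ?c j \<in> ?c ` UNIV"
      using bij_betw_rank[where 'n='n] lt[of j] by (simp add: bij_betw_def)
    then obtain i where "CARD('n) - 1 - ?c j = ?c i"
      by blast
    with lt[of j] show ?thesis
      by (intro exI[of _ i]) linarith
  qed
  then obtain r where r: "\<And>j. ?c (r j) + ?c j + 1 = CARD('n)"
    by metis
  have uniq: "?c i + ?c j + 1 = CARD('n) \<longleftrightarrow> i = r j" for i j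
    using r[of j] inj[of i "r j"] by auto
  show thesis
  proof (rule that[of r])
    show "antidiag $ i $ j = (if i = r j then 1 else 0)" for i j
      using uniq[of i j] by (simp add: antidiag_def)
    show "r (r i) = i" for i
      using uniq[of i "r i"] r[of i] by simp
  qed
qed

lemma oform_axis:
  assumes "\<And>i j. antidiag $ i $ j = (if i = r j then 1 else 0)"
  shows "oform u (axis j 1) = u $ r j"
proof -
  have "(antidiag *v axis j 1) $ i = antidiag $ i $ j" for i
    by (simp add: matrix_vector_mult_def axis_def if_distrib[of "\<lambda>x. _ * x"] cong: if_cong)
  then show ?thesis
    by (simp add: oform_def assms if_distrib[of "\<lambda>x. _ * x"] cong: if_cong)
qed

lemma oform_nondegenerate:
  assumes "\<And>v. oform u v = 0"
  shows "u = 0"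
proof -
  obtain r :: "'a \<Rightarrow> 'a" where r:
    "\<And>i j. antidiag $ i $ j = (if i = r j then 1 else 0)" "\<And>i. r (r i) = i"
    using antidiag_involution by metis
  have "u $ i = 0" for i
    using oform_axis[OF r(1), of u "r i"] assms r(2) by simp
  then show ?thesis
    by (simp add: vec_eq_iff)
qed

lemma oform_represent:
  fixes \<phi> :: "'n::{finite,linorder} cvec \<Rightarrow> complex"
  assumes "\<And>u v. \<phi> (u + v) = \<phi> u + \<phi> v" "\<And>c u. \<phi> (c *s u) = c * \<phi> u"
  obtains w where "\<And>u. oform w u = \<phi> u"
proof -
  obtain r :: "'n \<Rightarrow> 'n" where r:
    "\<And>i j. antidiag $ i $ j = (if i = r j then 1 else 0)" "\<And>i. r (r i) = i"
    using antidiag_involution by metis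
  \<comment> \<open>Pairing a vector with \<open>axis (r i) 1\<close> returns its coordinate
    \<open>i\<close>, so this choice is forced.\<close>
  define w :: "'n cvec" where "w = (\<chi> i. \<phi> (axis (r i) 1))"
  have w: "oform w (axis j 1) = \<phi> (axis j 1)" for j
    using oform_axis[OF r(1), of w j] by (simp add: w_def r(2))
  have zero: "\<phi> 0 = 0"
    using assms(2)[of 0 0] by simp
  have sum: "\<phi> (\<Sum>i\<in>S. g i) = (\<Sum>i\<in>S. \<phi> (g i))" for S and g :: "'n \<Rightarrow> 'n cvec"
    by (induction S rule: infinite_finite_induct) (simp_all add: zero assms(1))
  have "oform w u = \<phi> u" for u
  proof -
    have "oform w u = oform w (\<Sum>i\<in>UNIV. u $ i *s axis i 1)"
      by (simp only: basis_expansion)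
    also have "\<dots> = \<phi> (\<Sum>i\<in>UNIV. u $ i *s axis i 1)"
      by (simp add: oform_sum_right sum oform_scale_right assms(2) w)
    finally show ?thesis
      by (simp only: basis_expansion)
  qed
  with that show thesis
    by blast
qed

section \<open>Orthogonal complements and separating functionals\<close>

definition orth :: "'n::{finite,linorder} cvec set \<Rightarrow> 'n cvec set" where
  "orth X = {w. \<forall>u\<in>X. oform w u = 0}"

lemma subspace_orth [simp]: "vec.subspace (orth X)"
  by (auto simp: vec.subspace_def orth_def oform_linear)

lemma orth_antimono: "X \<subseteq> Y \<Longrightarrow> orth Y \<subseteq> orth X"
  by (auto simp: orth_def)

text \<open>A basis of \<open>X\<close> stays independent after adding \<open>v\<close>, so some
  linear functional kills \<open>X\<close> and is 1 at \<open>v\<close>; the form represents it.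
  Vectors with prescribed pairings are obtained from this below.\<close>

lemma separating_functional:
  assumes "vec.subspace X" "v \<notin> X"
  obtains w where "w \<in> orth X" "oform w v = 1"
proof -
  obtain B where B: "B \<subseteq> X" "vec.independent B" "X \<subseteq> vec.span B"
    using vec.basis_exists by metis
  have span: "vec.span B = X"
    by (rule antisym[OF vec.span_minimal[OF B(1) assms(1)] B(3)])
  have ind: "vec.independent (insert v B)"
    using B(2) assms(2) span by (simp add: vec.independent_insert)
  \<comment> \<open>An arbitrary index: the functional is coordinate \<open>i0\<close> of an
    endomorphism \<open>g\<close>.\<close>
  obtain i0 :: 'a where True by simp
  obtain g :: "'a cvec \<Rightarrow> 'a cvec" where g: "Vector_Spaces.linear (*s) (*s) g"
    "\<forall>b\<in>insert v B. g b = (if b = v then axis i0 1 else 0)"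
    using vec.linear_independent_extend[OF ind, of "\<lambda>b. if b = v then axis i0 1 else 0"] by blast
  interpret g: Vector_Spaces.linear "(*s)" "(*s)" g
    by (rule g(1))
  have vB: "v \<notin> B"
    using assms(2) B(1) by auto
  have gB: "g u = 0" if "u \<in> X" for u
    using that unfolding span[symmetric]
  proof (induction rule: vec.span_induct_alt)
    case (step c x y)
    then show ?case
      using g(2) vB by (auto simp: g.add g.scale)
  qed simp
  obtain w where w: "\<And>u. oform w u = g u $ i0"
    by (rule oform_represent[of "\<lambda>u. g u $ i0"]) (auto simp: g.add g.scale)
  show thesis
    by (rule that[of w]) (auto simp: orth_def w gB g(2))
qed

lemma orth_orth:
  assumes "vec.subspace X"
  shows "orth (orth X) = X"
proof
  show "X \<subseteq> orth (orth X)"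
    by (auto simp: orth_def oform_commute)
  show "orth (orth X) \<subseteq> X"
  proof
    fix v assume v: "v \<in> orth (orth X)"
    show "v \<in> X"
    proof (rule ccontr)
      assume "v \<notin> X"
      then obtain w where "w \<in> orth X" "oform w v = 1"
        using separating_functional assms by metis
      with v show False
        by (auto simp: orth_def oform_commute[of w])
    qed
  qed
qed

section \<open>Lie algebra, orthogonal group and determinants in terms of the form\<close>

lemma dot_transpose:
  fixes A :: "'n::finite cmat"
  shows "(\<Sum>i\<in>UNIV. (A *v u) $ i * w $ i) = (\<Sum>i\<in>UNIV. u $ i * (transpose A *v w) $ i)"
proof -
  have "(\<Sum>i\<in>UNIV. (A *v u) $ i * w $ i) = (\<Sum>i\<in>UNIV. \<Sum>j\<in>UNIV. A $ i $ j * u $ j * w $ i)"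
    by (simp add: matrix_vector_mult_def sum_distrib_right)
  also have "\<dots> = (\<Sum>j\<in>UNIV. \<Sum>i\<in>UNIV. A $ i $ j * u $ j * w $ i)"
    by (rule sum.swap)
  also have "\<dots> = (\<Sum>i\<in>UNIV. u $ i * (transpose A *v w) $ i)"
    by (simp add: matrix_vector_mult_def transpose_def sum_distrib_left mult_ac)
  finally show ?thesis .
qed

lemma matrix_eq_dotI:
  fixes M N :: "'n::finite cmat"
  assumes "\<And>u v. (\<Sum>i\<in>UNIV. u $ i * (M *v v) $ i) = (\<Sum>i\<in>UNIV. u $ i * (N *v v) $ i)"
  shows "M = N"
proof -
  have "(M *v v) $ j = (N *v v) $ j" for v j
    using assms[of "axis j 1" v]
    by (simp add: axis_def if_distrib[of "\<lambda>x. x * _"] cong: if_cong)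
  then show ?thesis
    by (simp add: matrix_eq vec_eq_iff)
qed

lemma oform_matrix:
  fixes A B :: "'n::{finite,linorder} cmat"
  shows "oform (A *v u) (B *v v) = (\<Sum>i\<in>UNIV. u $ i * ((transpose A ** antidiag ** B) *v v) $ i)"
proof -
  have "oform (A *v u) (B *v v) = (\<Sum>i\<in>UNIV. u $ i * (transpose A *v (antidiag *v (B *v v))) $ i)"
    unfolding oform_def by (rule dot_transpose)
  then show ?thesis
    by (simp only: matrix_vector_mul_assoc matrix_mul_assoc)
qed

lemma orthogonal_lie_iff:
  "a \<in> orthogonal_lie \<longleftrightarrow> (\<forall>u v. oform (a *v u) v = - oform u (a *v v))"
proof -
  have eq: "oform (a *v u) v + oform u (a *v v) =
      (\<Sum>i\<in>UNIV. u $ i * ((transpose a ** antidiag + antidiag ** a) *v v) $ i)" for u v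
    using oform_matrix[of a u "mat 1" v] oform_matrix[of "mat 1" u a v]
    by (simp add: matrix_vector_mult_add_rdistrib distrib_left sum.distrib)
  have "a \<in> orthogonal_lie \<longleftrightarrow> (\<forall>u v. oform (a *v u) v + oform u (a *v v) = 0)"
    unfolding orthogonal_lie_def eq
    using matrix_eq_dotI[of "transpose a ** antidiag + antidiag ** a" 0] by auto
  then show ?thesis
    by (simp add: eq_neg_iff_add_eq_0)
qed

lemma invertible_iff_kernel:
  fixes A :: "'n::finite cmat"
  shows "invertible A \<longleftrightarrow> (\<forall>u. A *v u = 0 \<longrightarrow> u = 0)"
  using matrix_left_invertible_ker[of A] invertible_left_inverse[of A] by simp

lemma orthogonal_group_iff:
  "A \<in> orthogonal_group \<longleftrightarrow> (\<forall>u v. oform (A *v u) (A *v v) = oform u v)"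
proof
  assume "A \<in> orthogonal_group"
  then show "\<forall>u v. oform (A *v u) (A *v v) = oform u v"
    unfolding oform_matrix by (simp add: orthogonal_group_def oform_def)
next
  assume A: "\<forall>u v. oform (A *v u) (A *v v) = oform u v"
  have "transpose A ** antidiag ** A = antidiag"
    using A unfolding oform_matrix by (intro matrix_eq_dotI) (simp add: oform_def)
  moreover have "invertible A"
    unfolding invertible_iff_kernel
  proof (intro allI impI)
    fix u assume "A *v u = 0"
    then show "u = 0"
      using A oform_nondegenerate[of u] by (metis oform_zero_left)
  qed
  ultimately show "A \<in> orthogonal_group"
    by (simp add: orthogonal_group_def)
qed

lemma det_antidiag: "det antidiag \<noteq> 0"
proof -
  have "u = 0" if "antidiag *v u = 0" for u :: "'a cvec"
  proof (rule oform_nondegenerate)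
    show "oform u v = 0" for v
      unfolding oform_commute[of u] by (simp add: oform_def that)
  qed
  then have "invertible (antidiag :: 'a cmat)"
    by (simp add: invertible_iff_kernel)
  then show ?thesis
    by (simp add: invertible_det_nz)
qed

lemma det_orthogonal:
  assumes "A \<in> orthogonal_group"
  shows "det A = 1 \<or> det A = -1"
proof -
  have "det (transpose A ** antidiag ** A) = det (antidiag :: 'a cmat)"
    using assms by (simp add: orthogonal_group_def)
  then have "det A * det A = 1"
    using det_antidiag[where 'a='a] by (simp add: det_mul)
  then show ?thesis
    using square_eq_1_iff by blast
qed

text \<open>The adjoint is the transpose conjugated by the invertible matrix
  \<open>antidiag\<close>. This will compare the two diagonal blocks of an orthogonal map that
  preserves a Lagrangian subspace.\<close>

lemma adjoint_det:
  assumes "\<And>u v. oform (A *v u) v = oform u (B *v v)"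
  shows "det A = det B"
proof -
  have "transpose A ** antidiag = antidiag ** B"
  proof (rule matrix_eq_dotI)
    fix u v
    show "(\<Sum>i\<in>UNIV. u $ i * ((transpose A ** antidiag) *v v) $ i) =
          (\<Sum>i\<in>UNIV. u $ i * ((antidiag ** B) *v v) $ i)"
      using assms[of u v] oform_matrix[of A u "mat 1" v] oform_matrix[of "mat 1" u B v]
      by simp
  qed
  then have "det (transpose A ** antidiag) = det (antidiag ** B)"
    by simp
  then show ?thesis
    using det_antidiag[where 'a='a] by (simp add: det_mul)
qed

lemma matrix_inv_invertible:
  fixes A :: "'n::finite cmat"
  assumes "invertible A"
  shows "A ** matrix_inv A = mat 1" "matrix_inv A ** A = mat 1"
  using assms unfolding invertible_def matrix_inv_def by (rule someI2_ex, blast)+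

lemma wedge_apply: "wedge u v *v w = oform u w *s v - oform v w *s u"
  unfolding wedge_def
  by (rule matrix_works)
     (unfold_locales, simp_all add: oform_linear vec_eq_iff algebra_simps)

lemma wedge_lie: "wedge u v \<in> orthogonal_lie"
  by (simp add: orthogonal_lie_iff wedge_apply oform_linear oform_commute)

lemma sum_matrix_apply:
  fixes X :: "'a \<Rightarrow> 'n::finite cmat"
  shows "(\<Sum>d\<in>D. X d) *v u = (\<Sum>d\<in>D. X d *v u)"
  by (induction D rule: infinite_finite_induct) (simp_all add: matrix_vector_mult_add_rdistrib)

lemma lie_sum:
  assumes "\<And>d. d \<in> D \<Longrightarrow> X d \<in> orthogonal_lie"
  shows "(\<Sum>d\<in>D. X d) \<in> orthogonal_lie"
  using assms
  by (simp add: orthogonal_lie_iff sum_matrix_apply oform_sum_left oform_sum_right sum_negf)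

section \<open>Splitting off hyperbolic summands\<close>

text \<open>\<open>W\<close> and \<open>orth W\<close> together span everything, because a vector
  orthogonal to both lies in \<open>W\<close> and in \<open>orth W\<close>. The
  \<open>W\<close>-component of \<open>w0\<close> is the required vector. This moves functionals of
  the full space into the summand under consideration.\<close>

lemma nondegenerate_complement:
  assumes "vec.subspace W" "W \<inter> orth W = {0}"
  obtains w where "w \<in> W" "\<And>u. u \<in> W \<Longrightarrow> oform w u = oform w0 u"
proof -
  define S where "S = {w + z | w z. w \<in> W \<and> z \<in> orth W}"
  have S: "vec.subspace S"
    using vec.subspace_sums[OF assms(1) subspace_orth] by (simp add: S_def)
  have zero: "0 \<in> W" "0 \<in> orth W"
    using assms(1) subspace_orth vec.subspace_0 by blast+
  have sub: "W \<subseteq> S" "orth W \<subseteq> S"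
    using zero by (auto simp: S_def) force+
  have "w0 \<in> S"
  proof (rule ccontr)
    assume "w0 \<notin> S"
    then obtain v where v: "v \<in> orth S" "oform v w0 = 1"
      using separating_functional S by metis
    have "v \<in> orth W" "v \<in> orth (orth W)"
      using v(1) orth_antimono sub by blast+
    then have "v = 0"
      using assms orth_orth by blast
    with v(2) show False
      by simp
  qed
  then obtain w z where wz: "w0 = w + z" "w \<in> W" "z \<in> orth W"
    by (auto simp: S_def)
  show thesis
    by (rule that[OF wz(2)]) (use wz in \<open>simp add: orth_def oform_linear\<close>)
qed

text \<open>As \<open>v\<close> is isotropic and pairs to 1 with \<open>w\<close>, subtracting
  \<open>c *s v\<close> changes the self-pairing of \<open>w\<close> by
  \<open>- 2 * c\<close>.\<close>

lemma isotropic_correction: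
  assumes "oform w v = 1" "oform v v = 0"
  defines "w' \<equiv> w - (oform w w / 2) *s v"
  shows "oform w' w' = 0"
  using assms by (simp add: w'_def oform_linear oform_commute[of v w] algebra_simps)

section \<open>Self-dual filtrations with a skew map of square zero\<close>

definition hyperbolic ::
    "'i set \<Rightarrow> ('i \<Rightarrow> 'n::{finite,linorder} cvec) \<Rightarrow> ('i \<Rightarrow> 'n cvec) \<Rightarrow> bool" where
  "hyperbolic I e f \<longleftrightarrow> finite I \<and> (\<forall>p\<in>I. \<forall>q\<in>I.
     oform (e p) (e q) = 0 \<and> oform (f p) (f q) = 0 \<and> oform (e p) (f q) = (if p = q then 1 else 0))"

lemma hyperbolicD:
  assumes "hyperbolic I e f"
  shows "finite I" "p \<in> I \<Longrightarrow> q \<in> I \<Longrightarrow> oform (e p) (e q) = 0"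
    "p \<in> I \<Longrightarrow> q \<in> I \<Longrightarrow> oform (f p) (f q) = 0"
    "p \<in> I \<Longrightarrow> q \<in> I \<Longrightarrow> oform (e p) (f q) = (if p = q then 1 else 0)"
    "p \<in> I \<Longrightarrow> q \<in> I \<Longrightarrow> oform (f p) (e q) = (if p = q then 1 else 0)"
  using assms by (auto simp: hyperbolic_def oform_commute[of "f p" "e q"])

text \<open>\<open>F (2 * k + 1)\<close> may be a proper subspace, so that the orthogonal complement
  of a split-off summand is again an instance. Taken at \<open>2 * k + 1\<close>,
  \<open>dual\<close> says that the form is nondegenerate on this space; taken at \<open>k\<close>,
  it makes \<open>F (k + 1)\<close> the orthogonal complement of \<open>F k\<close>. The condition
  \<open>middle\<close> is the form in which maximality of the flag survives the induction.\<close>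

locale filtered_nilpotent =
  fixes k :: nat and F :: "nat \<Rightarrow> 'n::{finite,linorder} cvec set" and x :: "'n cmat"
  assumes subspace: "j \<le> 2 * k + 1 \<Longrightarrow> vec.subspace (F j)"
    and bottom: "F 0 = {0}"
    and mono: "i \<le> j \<Longrightarrow> j \<le> 2 * k + 1 \<Longrightarrow> F i \<subseteq> F j"
    and dual: "j \<le> 2 * k + 1 \<Longrightarrow> F (2 * k + 1 - j) = F (2 * k + 1) \<inter> orth (F j)"
    and middle: "u \<in> F (k + 1) \<Longrightarrow> oform u u = 0 \<Longrightarrow> u \<in> F k"
    and skew: "oform (x *v u) v = - oform u (x *v v)"
    and square: "x *v (x *v u) = 0"
    and stable: "u \<in> F (2 * k + 1) \<Longrightarrow> x *v u \<in> F (2 * k + 1)"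
begin

abbreviation M :: nat where "M \<equiv> 2 * k + 1"

text \<open>\<open>F (M + 1 - s)\<close> is the first step that need not be orthogonal to
  \<open>F s\<close>. Partners in two such steps span a plane whose projection respects the
  filtration.\<close>

definition paired :: "'n cvec \<Rightarrow> 'n cvec \<Rightarrow> bool" where
  "paired a b \<longleftrightarrow> (\<exists>s\<in>{1..M}. a \<in> F s \<and> b \<in> F (M + 1 - s))"

lemma inW: "u \<in> F j \<Longrightarrow> j \<le> M \<Longrightarrow> u \<in> F M"
  using mono[of j M] by auto

lemma total: "F M \<inter> orth (F M) = {0}"
  using dual[of M] bottom by simp

lemma nondegenerate:
  assumes "u \<in> F M" "\<And>v. v \<in> F M \<Longrightarrow> oform u v = 0"
  shows "u = 0"
  using assms total by (auto simp: orth_def)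

lemma isotropic:
  assumes "u \<in> F i" "v \<in> F j" "i + j \<le> M"
  shows "oform u v = 0"
proof -
  have "u \<in> F (M - j)"
    using mono[of i "M - j"] assms by (auto simp: le_diff_conv2)
  then show ?thesis
    using dual[of j] assms by (auto simp: orth_def)
qed

lemma image_isotropic: "oform (x *v u) (x *v v) = 0"
  by (simp add: skew square)

lemma diagonal: "oform (x *v u) u = 0"
  using skew[of u u] oform_commute[of u "x *v u"] by simp

text \<open>Within \<open>F M\<close>, the step \<open>F (s - 1)\<close> is cut out by orthogonality
  to \<open>F (M + 1 - s)\<close>, so a vector outside it pairs nontrivially with some vector
  there.\<close>

lemma level_dual:
  assumes "a \<in> F M" "a \<notin> F (s - 1)" "1 \<le> s" "s \<le> M"
  obtains w where "w \<in> F (M + 1 - s)" "oform w a = 1"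
proof -
  have "F (s - 1) = F M \<inter> orth (F (M + 1 - s))"
    using dual[of "M + 1 - s"] assms(3,4) by simp
  then obtain w where w: "w \<in> F (M + 1 - s)" "oform w a \<noteq> 0"
    using assms(1,2) by (auto simp: orth_def oform_commute[of a])
  show thesis
  proof (rule that)
    show "(1 / oform w a) *s w \<in> F (M + 1 - s)"
      using w(1) subspace[of "M + 1 - s"] assms(3) by (intro vec.subspace_scale) auto
    show "oform ((1 / oform w a) *s w) a = 1"
      using w(2) by (simp add: oform_linear)
  qed
qed

lemma paired_sym: "paired a b \<Longrightarrow> paired b a"
  unfolding paired_def
proof (elim bexE conjE)
  fix s assume "s \<in> {1..M}" "a \<in> F s" "b \<in> F (M + 1 - s)"
  then show "\<exists>s\<in>{1..M}. b \<in> F s \<and> a \<in> F (M + 1 - s)"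
    by (intro bexI[of _ "M + 1 - s"]) auto
qed

lemma paired_inW: "paired a b \<Longrightarrow> a \<in> F M" "paired a b \<Longrightarrow> b \<in> F M"
  unfolding paired_def using inW by (auto, (metis Suc_diff_le diff_le_self le_SucI le_trans)?)

lemma paired_minus: "paired a b \<Longrightarrow> paired (- a) (- b)"
  unfolding paired_def using subspace vec.subspace_neg
  by (elim bexE, intro bexI) auto

text \<open>Either the level of \<open>a\<close> is at most \<open>j\<close>, or \<open>b\<close>
  lies in a step orthogonal to \<open>F j\<close> and the coefficient vanishes.\<close>

lemma paired_projection:
  assumes "paired a b" "u \<in> F j" "j \<le> M"
  shows "oform u b *s a \<in> F j"
proof -
  obtain s where s: "1 \<le> s" "s \<le> M" "a \<in> F s" "b \<in> F (M + 1 - s)"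
    using assms(1) by (auto simp: paired_def)
  show ?thesis
  proof (cases "s \<le> j")
    case True
    then show ?thesis
      using s mono[of s j] assms(3) subspace[of j] by (intro vec.subspace_scale) auto
  next
    case False
    then have "oform u b = 0"
      using isotropic[OF assms(2) s(4)] s by simp
    then show ?thesis
      using subspace[OF assms(3)] vec.subspace_0 by auto
  qed
qed

text \<open>One of \<open>s\<close> and \<open>M + 1 - s\<close> is at most \<open>k\<close>, unless
  both equal \<open>k + 1\<close>; there \<open>middle\<close> applies. The vector found in
  \<open>F k\<close> will be the \<open>e\<close>-vector of its plane.\<close>

lemma paired_low:
  assumes "paired a b" "oform a a = 0"
  shows "a \<in> F k \<or> b \<in> F k"
proof -
  obtain s where s: "1 \<le> s" "s \<le> M" "a \<in> F s" "b \<in> F (M + 1 - s)"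
    using assms(1) by (auto simp: paired_def)
  consider "s \<le> k" | "s = k + 1" | "M + 1 - s \<le> k"
    by linarith
  then show ?thesis
  proof cases
    case 1
    then show ?thesis using s mono[of s k] by auto
  next
    case 2
    then show ?thesis using s middle assms by auto
  next
    case 3
    then show ?thesis using s mono[of "M + 1 - s" k] by auto
  qed
qed

definition single_pair :: "'n cvec \<Rightarrow> 'n cvec \<Rightarrow> bool" where
  "single_pair a a' \<longleftrightarrow> paired a a' \<and> oform a a = 0 \<and> oform a' a' = 0 \<and> oform a a' = 1 \<and>
     x *v a = 0 \<and> x *v a' = 0"

text \<open>The last line says that \<open>x\<close> acts on the four vectors as
  \<open>wedge a b\<close>.\<close>

definition double_pair :: "'n cvec \<Rightarrow> 'n cvec \<Rightarrow> 'n cvec \<Rightarrow> 'n cvec \<Rightarrow> bool" where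
  "double_pair a a' b b' \<longleftrightarrow> paired a a' \<and> paired b b' \<and>
     oform a a = 0 \<and> oform a' a' = 0 \<and> oform a a' = 1 \<and>
     oform b b = 0 \<and> oform b' b' = 0 \<and> oform b b' = 1 \<and>
     oform a b = 0 \<and> oform a b' = 0 \<and> oform a' b = 0 \<and> oform a' b' = 0 \<and>
     x *v a = 0 \<and> x *v b = 0 \<and> x *v a' = b \<and> x *v b' = - a"

text \<open>Preliminary partners have the right images under \<open>x\<close> but possibly wrong
  pairings. Every correction subtracts a multiple of a vector killed by \<open>x\<close>, so the
  images survive; a correction that could leave the prescribed step turns out to be zero unless that
  step is large enough to contain it.\<close>

lemma peel:
  assumes "F k \<noteq> {0}"
  shows "(\<exists>a a'. single_pair a a') \<or> (\<exists>a a' b b'. double_pair a a' b b')"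
proof -
  define i where "i = (LEAST i. F i \<noteq> {0})"
  have Fi: "F i \<noteq> {0}" and ik: "i \<le> k"
    unfolding i_def using assms by (metis (mono_tags, lifting) LeastI, metis (mono_tags, lifting) Least_le)
  have below: "F j = {0}" if "j < i" for j
    using that not_less_Least[of j "\<lambda>i. F i \<noteq> {0}"] unfolding i_def by blast
  have i1: "1 \<le> i"
    using Fi bottom by (cases i) auto
  \<comment> \<open>Where the lowest steps vanish, the complementary ones fill \<open>F M\<close>.
    Hence \<open>pe\<close> below puts no condition on the level of the partner of
    \<open>e\<close>.\<close>
  have above: "F (M - j) = F M" if "j < i" for j
    using dual[of j] that ik below[OF that] by (auto simp: orth_def)
  have "0 \<in> F i"
    using subspace[of i] ik vec.subspace_0 by auto
  then obtain e where e: "e \<in> F i" "e \<noteq> 0"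
    using Fi by auto
  have eW: "e \<in> F M"
    using inW[OF e(1)] ik by simp
  have ee: "oform e e = 0"
    using isotropic[OF e(1) e(1)] ik by simp
  have pe: "paired e u" if "u \<in> F M" for u
    unfolding paired_def using above[of "i - 1"] i1 ik e(1) that
    by (intro bexI[of _ i]) auto
  note W = subspace[OF order.refl]
  note closed = vec.subspace_add[OF W] vec.subspace_diff[OF W] vec.subspace_scale[OF W]
    vec.subspace_neg[OF W]
  show ?thesis
  proof (cases "x *v e = 0")
    case xe: True
    show ?thesis
    proof (cases "e \<in> (*v) x ` F M")
      case False
      have "vec.subspace ((*v) x ` F M)"
        using W by (rule vec.subspace_image)
      then obtain w0 where w0: "w0 \<in> orth ((*v) x ` F M)" "oform w0 e = 1"
        using separating_functional False by metis
      obtain w where w: "w \<in> F M" "\<And>u. u \<in> F M \<Longrightarrow> oform w u = oform w0 u"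
        using nondegenerate_complement[OF W] total by metis
      \<comment> \<open>On \<open>F M\<close>, pairing with \<open>w\<close> kills the image of
        \<open>x\<close>; skewness turns this into \<open>x *v w = 0\<close>.\<close>
      have xw: "x *v w = 0"
      proof (rule nondegenerate)
        show "x *v w \<in> F M"
          using stable w(1) by simp
        show "oform (x *v w) v = 0" if "v \<in> F M" for v
          using w0(1) w(2)[OF stable[OF that]] that by (auto simp: skew orth_def)
      qed
      define e' where "e' = w - (oform w w / 2) *s e"
      have we: "oform w e = 1"
        using w(2)[OF eW] w0(2) by simp
      have "single_pair e e'"
        unfolding single_pair_def
      proof (intro conjI)
        show "paired e e'"
          unfolding e'_def by (intro pe closed w eW)
        show "oform e' e' = 0"
          unfolding e'_def by (rule isotropic_correction[OF we ee])
        show "oform e e' = 1"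
          by (simp add: e'_def oform_linear ee oform_commute[of e w] we)
        show "x *v e' = 0"
          by (simp add: e'_def vec.diff vec.scale xw xe)
      qed (simp_all add: ee xe)
      then show ?thesis
        by blast
    next
      case True
      \<comment> \<open>The least step that contains a preimage of \<open>e\<close>. That
        \<open>e\<close> has no preimage in \<open>F (b - 1)\<close> is what puts \<open>w'\<close>
        into the complementary step.\<close>
      define b where "b = (LEAST b. e \<in> (*v) x ` F b)"
      have "e \<in> (*v) x ` F b" and bM: "b \<le> M"
        unfolding b_def using True by (rule LeastI, rule Least_le)
      then obtain w where w: "w \<in> F b" "x *v w = e"
        by auto
      have b1: "1 \<le> b"
        using w bottom e(2) by (cases b) auto
      have "e \<notin> (*v) x ` F (b - 1)"
        using not_less_Least[of "b - 1" "\<lambda>b. e \<in> (*v) x ` F b"] b1 unfolding b_def[symmetric] by simp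
      moreover have "vec.subspace ((*v) x ` F (b - 1))"
        using bM by (intro vec.subspace_image subspace) simp
      ultimately obtain w0 where w0: "w0 \<in> orth ((*v) x ` F (b - 1))" "oform w0 e = 1"
        using separating_functional by metis
      obtain e' where e': "e' \<in> F M" "\<And>u. u \<in> F M \<Longrightarrow> oform e' u = oform w0 u"
        using nondegenerate_complement[OF W] total by metis
      have e'e: "oform e' e = 1"
        using e'(2)[OF eW] w0(2) by simp
      \<comment> \<open>By skewness, pairing \<open>w'\<close> with \<open>u\<close> is pairing
        \<open>e'\<close> with \<open>x *v u\<close>. So \<open>w'\<close> is orthogonal to
        \<open>F (b - 1)\<close> and pairs to 1 with \<open>w\<close>.\<close>
      define w' where "w' = - (x *v e')"
      have w'W: "w' \<in> F M"
        unfolding w'_def by (intro closed stable e')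
      have xw': "x *v w' = 0"
        by (simp add: w'_def square vec.neg)
      have "oform w' u = 0" if "u \<in> F (b - 1)" for u
      proof -
        have "u \<in> F M"
          using inW that bM by simp
        then have "oform e' (x *v u) = oform w0 (x *v u)"
          by (intro e' stable)
        also have "\<dots> = 0"
          using w0(1) that by (auto simp: orth_def)
        finally show ?thesis
          by (simp add: w'_def oform_linear skew)
      qed
      then have w'F: "w' \<in> F (M + 1 - b)"
        using dual[of "b - 1"] w'W b1 bM by (simp add: orth_def)
      have w'w: "oform w' w = 1"
        by (simp add: w'_def oform_linear skew w(2) e'e)
      have w'w': "oform w' w' = 0" and ew': "oform e w' = 0"
        unfolding w(2)[symmetric] by (simp_all add: w'_def oform_linear image_isotropic)
      have ew: "oform e w = 0"
        unfolding w(2)[symmetric] by (rule diagonal)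
      have w'e': "oform w' e' = 0"
        by (simp add: w'_def oform_linear diagonal)
      \<comment> \<open>The first correction achieves orthogonality to \<open>w\<close>, the second
        one isotropy.\<close>
      define e1 where "e1 = e' - oform e' w *s w'"
      define e2 where "e2 = e1 - (oform e1 e1 / 2) *s e"
      have e1e: "oform e1 e = 1"
        by (simp add: e1_def oform_linear e'e oform_commute[of w' e] ew')
      have e1w: "oform e1 w = 0"
        by (simp add: e1_def oform_linear w'w)
      have e2: "oform e2 e2 = 0" "oform e e2 = 1" "oform e2 w = 0" "oform w' e2 = 0"
          "x *v e2 = - w'"
      proof -
        show "oform e2 e2 = 0"
          unfolding e2_def by (rule isotropic_correction[OF e1e ee])
        show "oform e e2 = 1"
          by (simp add: e2_def oform_linear ee oform_commute[of e e1] e1e)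
        show "oform e2 w = 0"
          by (simp add: e2_def oform_linear ew e1w)
        show "oform w' e2 = 0"
          by (simp add: e2_def e1_def oform_linear w'e' w'w' oform_commute[of w' e] ew')
        show "x *v e2 = - w'"
          by (simp add: e2_def e1_def vec.diff vec.scale xw' xe) (simp add: w'_def)
      qed
      define w1 where "w1 = w - (oform w w / 2) *s w'"
      have w1: "oform w1 w1 = 0" "oform w' w1 = 1" "oform w1 e2 = 0" "oform w1 e = 0" "x *v w1 = e"
      proof -
        show "oform w1 w1 = 0"
          unfolding w1_def using w'w w'w' by (intro isotropic_correction) (simp_all add: oform_commute)
        show "oform w' w1 = 1"
          by (simp add: w1_def oform_linear w'w w'w')
        show "oform w1 e2 = 0"
          by (simp add: w1_def oform_linear e2 oform_commute[of w e2])
        show "oform w1 e = 0"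
          by (simp add: w1_def oform_linear oform_commute[of w e] ew oform_commute[of w' e] ew')
        show "x *v w1 = e"
          by (simp add: w1_def vec.diff vec.scale xw' w)
      qed
      \<comment> \<open>A nonzero self-pairing of \<open>w\<close> forces \<open>M < b + b\<close>,
        and then the step of \<open>w'\<close> is contained in \<open>F b\<close>.\<close>
      have w1F: "w1 \<in> F b"
      proof (cases "oform w w = 0")
        case True
        then show ?thesis using w by (simp add: w1_def)
      next
        case False
        then have "M < b + b"
          using isotropic[OF w(1) w(1)] by linarith
        then have "w' \<in> F b"
          using w'F mono[of "M + 1 - b" b] bM by (auto simp: le_diff_conv)
        then show ?thesis
          unfolding w1_def using w(1) subspace[OF bM]
          by (intro vec.subspace_diff vec.subspace_scale)
      qed
      have "double_pair w' w1 e e2"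
        unfolding double_pair_def
      proof (intro conjI)
        show "paired w' w1"
          unfolding paired_def using w'F w1F b1 bM by (intro bexI[of _ "M + 1 - b"]) auto
        show "paired e e2"
          unfolding e2_def e1_def by (intro pe closed e' w'W eW)
      qed (simp_all add: w1 e2 w'w' ee ew' xw' xe oform_commute[of w' e])
      then show ?thesis
        by blast
    qed
  next
    case False
    define v where "v = x *v e"
    have v0: "v \<noteq> 0" and vW: "v \<in> F M"
      using False stable[OF eW] by (auto simp: v_def)
    define m where "m = (LEAST m. v \<in> F m)"
    have vm: "v \<in> F m" and mM: "m \<le> M"
      unfolding m_def using vW by (rule LeastI, rule Least_le)
    have m1: "1 \<le> m"
      using vm v0 bottom by (cases m) auto
    have "v \<notin> F (m - 1)"
      using not_less_Least[of "m - 1" "\<lambda>m. v \<in> F m"] m1 unfolding m_def[symmetric] by simp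
    then obtain w0 where w0: "w0 \<in> F (M + 1 - m)" "oform w0 v = 1"
      using level_dual[OF vW _ m1 mM] by metis
    have w0W: "w0 \<in> F M"
      using inW[OF w0(1)] m1 by simp
    \<comment> \<open>Its pairing with \<open>e\<close> is the pairing of \<open>w0\<close> with
      \<open>x *v e\<close>, which is 1, and \<open>x\<close> kills it because of its square being
      zero.\<close>
    define e' where "e' = - (x *v w0)"
    have e'W: "e' \<in> F M"
      unfolding e'_def by (intro closed stable w0W)
    have e'e: "oform e' e = 1"
      using w0(2) by (simp add: e'_def oform_linear skew v_def)
    have e'v: "oform e' v = 0" and e'e': "oform e' e' = 0" and vv: "oform v v = 0"
      by (simp_all add: e'_def v_def oform_linear image_isotropic)
    have ve: "oform v e = 0"
      by (simp add: v_def diagonal)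
    have xv: "x *v v = 0" and xe': "x *v e' = 0"
      by (simp_all add: v_def e'_def square vec.neg)
    define w1 where "w1 = w0 - oform w0 e *s e'"
    \<comment> \<open>If \<open>w0\<close> and \<open>e\<close> are not orthogonal, then
      \<open>m \<le> i\<close>, and \<open>F (M + 1 - m)\<close> is all of
      \<open>F M\<close>.\<close>
    have w1F: "w1 \<in> F (M + 1 - m)"
    proof (cases "oform w0 e = 0")
      case True
      then show ?thesis using w0 by (simp add: w1_def)
    next
      case False
      then have "M < (M + 1 - m) + i"
        using isotropic[OF w0(1) e(1)] by linarith
      then have "F (M + 1 - m) = F M"
        using above[of "m - 1"] m1 mM by simp
      then show ?thesis
        unfolding w1_def using w0 e'W by (simp only:) (intro closed)
    qed
    have w1v: "oform w1 v = 1"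
      by (simp add: w1_def oform_linear w0 e'v)
    have w1e: "oform w1 e = 0"
      by (simp add: w1_def oform_linear e'e)
    have xw1: "x *v w1 = - e'"
      by (simp add: w1_def vec.diff vec.scale xe') (simp add: e'_def)
    define w2 where "w2 = w1 - (oform w1 w1 / 2) *s v"
    have w2F: "w2 \<in> F (M + 1 - m)"
    proof (cases "oform w1 w1 = 0")
      case True
      then show ?thesis using w1F by (simp add: w2_def)
    next
      case False
      then have "M < (M + 1 - m) + (M + 1 - m)"
        using isotropic[OF w1F w1F] by linarith
      then have "m \<le> M + 1 - m" "M + 1 - m \<le> M"
        using m1 by linarith+
      then have "v \<in> F (M + 1 - m)"
        using vm mono[of m "M + 1 - m"] by blast
      then show ?thesis
        unfolding w2_def using w1F subspace[of "M + 1 - m"] m1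
        by (intro vec.subspace_diff vec.subspace_scale) auto
    qed
    have w2: "oform w2 w2 = 0" "oform v w2 = 1" "oform e w2 = 0" "x *v w2 = - e'"
    proof -
      show "oform w2 w2 = 0"
        unfolding w2_def by (rule isotropic_correction[OF w1v vv])
      show "oform v w2 = 1"
        by (simp add: w2_def oform_linear vv oform_commute[of v w1] w1v)
      show "oform e w2 = 0"
        by (simp add: w2_def oform_linear oform_commute[of e w1] w1e oform_commute[of e v] ve)
      show "x *v w2 = - e'"
        by (simp add: w2_def vec.diff vec.scale xv xw1)
    qed
    have e'w2: "oform e' w2 = 0"
      using diagonal[of w2] by (simp add: w2 oform_linear)
    have "double_pair e' e v w2"
      unfolding double_pair_def
    proof (intro conjI)
      show "paired e' e"
        by (rule paired_sym[OF pe[OF e'W]])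
      show "paired v w2"
        unfolding paired_def using vm w2F m1 mM by (intro bexI[of _ m]) auto
    qed (simp_all add: w2 e'e' ee e'e e'v e'w2 vv ve xv xe' oform_commute[of e v] v_def[symmetric])
    then show ?thesis
      by blast
  qed
qed

end

section \<open>Sums of blocks as matchings of basis vectors\<close>

definition side :: "('i \<Rightarrow> 'a) \<Rightarrow> ('i \<Rightarrow> 'a) \<Rightarrow> 'i \<times> bool \<Rightarrow> 'a" where
  "side e f s = (if snd s then e (fst s) else f (fst s))"

text \<open>A pair \<open>(s, t)\<close> stands for the wedge of the two basis vectors named by
  \<open>s\<close> and \<open>t\<close>. Disjointness is imposed on indices rather than on sides: if
  \<open>e p\<close> occurs in a block, then \<open>f p\<close> occurs in none.\<close>

definition matching :: "'i set \<Rightarrow> (('i \<times> bool) \<times> ('i \<times> bool)) set \<Rightarrow> bool" where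
  "matching I D \<longleftrightarrow> finite D \<and>
     (\<forall>(s, t)\<in>D. fst s \<in> I \<and> fst t \<in> I \<and> fst s \<noteq> fst t) \<and>
     (\<forall>(s, t)\<in>D. \<forall>(s', t')\<in>D. (s, t) \<noteq> (s', t') \<longrightarrow> {fst s, fst t} \<inter> {fst s', fst t'} = {})"

lemma matchingD:
  assumes "matching I D" "(s, t) \<in> D"
  shows "fst s \<in> I" "fst t \<in> I" "fst s \<noteq> fst t"
  using assms by (auto simp: matching_def)

lemma matching_disjoint:
  assumes "matching I D" "(s, t) \<in> D" "(s', t') \<in> D" "(s, t) \<noteq> (s', t')"
  shows "{fst s, fst t} \<inter> {fst s', fst t'} = {}"
  using assms unfolding matching_def by blast

definition blocks :: "('i \<Rightarrow> 'n::{finite,linorder} cvec) \<Rightarrow> ('i \<Rightarrow> 'n cvec) \<Rightarrow>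
    (('i \<times> bool) \<times> ('i \<times> bool)) set \<Rightarrow> 'n cmat" where
  "blocks e f D = (\<Sum>(s, t)\<in>D. wedge (side e f s) (side e f t))"

lemma blocks_apply:
  "blocks e f D *v u = (\<Sum>(s, t)\<in>D. oform (side e f s) u *s side e f t - oform (side e f t) u *s side e f s)"
  by (simp add: blocks_def sum_matrix_apply wedge_apply case_prod_unfold)

lemma blocks_orthogonal:
  assumes "matching I D" "\<And>p. p \<in> I \<Longrightarrow> oform u (e p) = 0 \<and> oform u (f p) = 0"
  shows "blocks e f D *v u = 0" "oform u (blocks e f D *v v) = 0"
proof -
  have z: "oform (side e f s) u = 0 \<and> oform (side e f t) u = 0" if "(s, t) \<in> D" for s t
  proof -
    have "fst s \<in> I" "fst t \<in> I"
      using assms(1) that by (auto simp: matching_def)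
    then show ?thesis
      using assms(2) by (auto simp: side_def oform_commute[of _ u])
  qed
  show "blocks e f D *v u = 0"
    unfolding blocks_apply using z by (intro sum.neutral) auto
  show "oform u (blocks e f D *v v) = 0"
    unfolding blocks_apply oform_sum_right using z
    by (intro sum.neutral) (auto simp: oform_linear oform_commute[of u])
qed

text \<open>Give \<open>fst p\<close> the index of its first step as level, and \<open>snd p\<close>
  the complementary level. Then each alternative says that the first factor has at least the level
  of the second. Membership is used in place of levels because it carries over when all steps are
  intersected with a subspace containing the vectors.\<close>

definition level_ordered :: "nat \<Rightarrow> (nat \<Rightarrow> 'a set) \<Rightarrow> (('a \<times> 'a) \<times> bool) \<times> (('a \<times> 'a) \<times> bool) \<Rightarrow> bool" where
  "level_ordered k F = (\<lambda>((p, c), (q, d)).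
     (\<not> c \<and> d) \<or>
     (\<not> c \<and> \<not> d \<and> (\<forall>j\<le>k. fst q \<in> F j \<longrightarrow> fst p \<in> F j)) \<or>
     (c \<and> d \<and> (\<forall>j\<le>k. fst p \<in> F j \<longrightarrow> fst q \<in> F j)))"

text \<open>Pairs of vectors are their own indices, so normal forms of orthogonal summands are
  combined by plain unions. The action is described on \<open>F (2 * k + 1)\<close> only, since
  outside this summand \<open>x\<close> may act differently.\<close>

definition normal_form :: "nat \<Rightarrow> (nat \<Rightarrow> 'n::{finite,linorder} cvec set) \<Rightarrow> 'n cmat \<Rightarrow>
    ('n cvec \<times> 'n cvec) set \<Rightarrow> ((('n cvec \<times> 'n cvec) \<times> bool) \<times> (('n cvec \<times> 'n cvec) \<times> bool)) set \<Rightarrow> bool" where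
  "normal_form k F x I D \<longleftrightarrow> hyperbolic I fst snd \<and>
     (\<forall>p\<in>I. fst p \<in> F k \<and> snd p \<in> F (2 * k + 1)) \<and>
     (\<forall>j\<le>k. F j \<subseteq> vec.span (fst ` {p \<in> I. fst p \<in> F j})) \<and>
     matching I D \<and> (\<forall>d\<in>D. level_ordered k F d) \<and>
     (\<forall>u\<in>F (2 * k + 1). x *v u = blocks fst snd D *v u)"

context filtered_nilpotent
begin

definition summand :: "('n cvec \<times> 'n cvec) set \<Rightarrow>
    ((('n cvec \<times> 'n cvec) \<times> bool) \<times> (('n cvec \<times> 'n cvec) \<times> bool)) set \<Rightarrow> bool" where
  "summand I D \<longleftrightarrow> I \<noteq> {} \<and> hyperbolic I fst snd \<and>
     (\<forall>p\<in>I. fst p \<in> F k \<and> paired (fst p) (snd p)) \<and>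
     matching I D \<and> (\<forall>d\<in>D. level_ordered k F d) \<and>
     (\<forall>p\<in>I. x *v fst p = blocks fst snd D *v fst p \<and> x *v snd p = blocks fst snd D *v snd p)"

lemma single_pair_summand:
  assumes "single_pair a a'"
  shows "\<exists>I D. summand I D"
proof -
  have "a \<in> F k \<or> a' \<in> F k"
    using assms paired_low by (auto simp: single_pair_def)
  then have "summand {(a, a')} {} \<or> summand {(a', a)} {}"
    using assms
    by (auto simp: summand_def single_pair_def hyperbolic_def matching_def blocks_def paired_sym
        oform_commute[of a' a])
  then show ?thesis
    by blast
qed

text \<open>This reflects \<open>wedge a b = wedge b (- a)\<close>: the order of the two factors can
  be exchanged.\<close>

lemma double_pair_rotate:
  assumes "double_pair a a' b b'"
  shows "double_pair b b' (- a) (- a')"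
proof -
  have "oform b a = oform a b" "oform b a' = oform a' b" "oform b' a = oform a b'"
    "oform b' a' = oform a' b'"
    by (rule oform_commute)+
  with assms show ?thesis
    by (simp add: double_pair_def paired_minus oform_linear vec.neg)
qed

text \<open>\<open>c\<close> and \<open>d\<close> select which vector of each plane is the
  \<open>e\<close>-vector. With either choice \<open>side\<close> returns \<open>a\<close> and
  \<open>b\<close>, so the block remains \<open>wedge a b\<close>.\<close>

lemma double_pair_summand_aux:
  assumes "double_pair a a' b b'"
    and "p = (if c then (a, a') else (a', a))" "q = (if d then (b, b') else (b', b))"
    and "fst p \<in> F k" "fst q \<in> F k" "level_ordered k F ((p, c), (q, d))"
  shows "summand {p, q} {((p, c), (q, d))}"
proof -
  note dp = assms(1)[unfolded double_pair_def]
  have comm: "oform a' a = 1" "oform b' b = 1" "oform b a = 0" "oform b' a = 0" "oform b a' = 0" "oform b' a' = 0"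
    using dp oform_commute by metis+
  have "p \<noteq> q"
    using dp comm unfolding assms(2,3) by (auto split: if_splits)
  moreover have "hyperbolic {p, q} fst snd"
  proof -
    have "oform a a = 0" "oform a' a' = 0" "oform a a' = 1" "oform b b = 0" "oform b' b' = 0"
      "oform b b' = 1" "oform a b = 0" "oform a b' = 0" "oform a' b = 0" "oform a' b' = 0"
      using dp by blast+
    note simps = this comm
    show ?thesis
      using \<open>p \<noteq> q\<close> \<open>p \<noteq> q\<close>[symmetric] unfolding hyperbolic_def assms(2,3)
      by (cases c; cases d) (simp_all add: simps)
  qed
  moreover have "\<forall>r\<in>{p, q}. paired (fst r) (snd r)"
  proof -
    have "paired a a'" "paired a' a" "paired b b'" "paired b' b"
      using dp paired_sym by blast+
    then show ?thesis
      unfolding assms(2,3) by (cases c; cases d) simp_all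
  qed
  moreover have "blocks fst snd {((p, c), (q, d))} = wedge a b"
    unfolding blocks_def side_def assms(2,3) by (cases c; cases d) simp_all
  moreover have "\<forall>r\<in>{p, q}. x *v fst r = wedge a b *v fst r \<and> x *v snd r = wedge a b *v snd r"
  proof -
    have "x *v a = wedge a b *v a" "x *v b = wedge a b *v b" "x *v a' = wedge a b *v a'"
      "x *v b' = wedge a b *v b'"
      using dp comm by (simp_all add: wedge_apply)
    then show ?thesis
      unfolding assms(2,3) by (cases c; cases d) simp_all
  qed
  ultimately show ?thesis
    using assms(4-6) by (auto simp: summand_def matching_def)
qed

text \<open>The cases record which vector of each plane lies in \<open>F k\<close>. Cases 1 and 2
  lead to undotted links, cases 3 and 4 to dotted ones; \<open>rot\<close> is used whenever the two
  factors stand in the wrong order.\<close>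

lemma double_pair_summand:
  assumes "double_pair a a' b b'"
  shows "\<exists>I D. summand I D"
proof -
  have mixed: "\<exists>I D. summand I D" if "double_pair a a' b b'" "a' \<in> F k" "b \<in> F k" for a a' b b'
    using double_pair_summand_aux[OF that(1), of "(a', a)" False "(b, b')" True] that
    by (auto simp: level_ordered_def)
  have chain: "(\<forall>j\<le>k. u \<in> F j \<longrightarrow> v \<in> F j) \<or> (\<forall>j\<le>k. v \<in> F j \<longrightarrow> u \<in> F j)" for u v
  proof (rule ccontr)
    assume "\<not> ?thesis"
    then obtain i j where ij: "i \<le> k" "u \<in> F i" "v \<notin> F i" "j \<le> k" "v \<in> F j" "u \<notin> F j"
      by blast
    then show False
      using mono[of i j] mono[of j i] by (cases "i \<le> j") auto
  qed
  have neg: "- u \<in> F j \<longleftrightarrow> u \<in> F j" if "j \<le> k" for u j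
    using subspace[of j] vec.subspace_neg[of "F j"] that
    by (metis add.inverse_inverse mult_2 trans_le_add1)
  note rot = double_pair_rotate[OF assms]
  have "a \<in> F k \<or> a' \<in> F k" "b \<in> F k \<or> b' \<in> F k"
    using assms paired_low by (auto simp: double_pair_def)
  then consider "a' \<in> F k" "b \<in> F k" | "a \<in> F k" "b' \<in> F k" | "a' \<in> F k" "b' \<in> F k" | "a \<in> F k" "b \<in> F k"
    by blast
  then show ?thesis
  proof cases
    case 1
    then show ?thesis using mixed assms by blast
  next
    case 2
    then show ?thesis using mixed[OF rot] neg by blast
  next
    case 3
    from chain[of b' a'] show ?thesis
    proof
      assume "\<forall>j\<le>k. b' \<in> F j \<longrightarrow> a' \<in> F j"
      then show ?thesis
        using double_pair_summand_aux[OF assms, of "(a', a)" False "(b', b)" False] 3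
        by (auto simp: level_ordered_def)
    next
      assume "\<forall>j\<le>k. a' \<in> F j \<longrightarrow> b' \<in> F j"
      then show ?thesis
        using double_pair_summand_aux[OF rot, of "(b', b)" False "(- a', - a)" False] 3
        by (auto simp: level_ordered_def neg)
    qed
  next
    case 4
    from chain[of a b] show ?thesis
    proof
      assume "\<forall>j\<le>k. a \<in> F j \<longrightarrow> b \<in> F j"
      then show ?thesis
        using double_pair_summand_aux[OF assms, of "(a, a')" True "(b, b')" True] 4
        by (auto simp: level_ordered_def)
    next
      assume "\<forall>j\<le>k. b \<in> F j \<longrightarrow> a \<in> F j"
      then show ?thesis
        using double_pair_summand_aux[OF rot, of "(b, b')" True "(- a, - a')" True] 4
        by (auto simp: level_ordered_def neg)
    qed
  qed
qed

lemma summand_exists: "F k \<noteq> {0} \<Longrightarrow> \<exists>I D. summand I D"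
  using peel single_pair_summand double_pair_summand by blast

end

section \<open>The orthogonal complement of a summand\<close>

locale split_summand = filtered_nilpotent k F x
  for k :: nat and F :: "nat \<Rightarrow> 'n::{finite,linorder} cvec set" and x :: "'n cmat" +
  fixes I :: "('n cvec \<times> 'n cvec) set"
    and D :: "((('n cvec \<times> 'n cvec) \<times> bool) \<times> (('n cvec \<times> 'n cvec) \<times> bool)) set"
  assumes summand: "summand I D"
begin

definition complement :: "'n cvec set" where
  "complement = {w. \<forall>p\<in>I. oform w (fst p) = 0 \<and> oform w (snd p) = 0}"

definition projection :: "'n cvec \<Rightarrow> 'n cvec" where
  "projection u = (\<Sum>p\<in>I. oform u (snd p) *s fst p + oform u (fst p) *s snd p)"

lemma hyp: "hyperbolic I fst snd" and finI: "finite I" and match: "matching I D"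
  and low: "p \<in> I \<Longrightarrow> fst p \<in> F k" and pair: "p \<in> I \<Longrightarrow> paired (fst p) (snd p)"
  and ordered: "d \<in> D \<Longrightarrow> level_ordered k F d"
  and action: "p \<in> I \<Longrightarrow> x *v fst p = blocks fst snd D *v fst p"
    "p \<in> I \<Longrightarrow> x *v snd p = blocks fst snd D *v snd p"
  using summand by (auto simp: summand_def hyperbolic_def)

lemma complement_subspace: "vec.subspace complement"
  by (auto simp: vec.subspace_def complement_def oform_linear)

lemma projection_mem:
  assumes "u \<in> F j" "j \<le> M"
  shows "projection u \<in> F j"
  unfolding projection_def
  using assms pair paired_sym paired_projection subspace[OF assms(2)]
  by (intro vec.subspace_sum vec.subspace_add) blast+

lemma diff_projection: "u - projection u \<in> complement"
proof -
  have "oform (projection u) (fst q) = oform u (fst q)"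
    "oform (projection u) (snd q) = oform u (snd q)" if "q \<in> I" for q
    unfolding projection_def
    using that finI by (simp_all add: oform_sum_left oform_linear hyperbolicD[OF hyp]
        if_distrib[of "\<lambda>x. _ * x"] cong: if_cong)
  then show ?thesis
    by (simp add: complement_def oform_linear)
qed

lemma oform_projection: "w \<in> complement \<Longrightarrow> oform w (projection u) = 0"
  by (simp add: projection_def oform_sum_right oform_linear complement_def)

lemma blocks_complement:
  assumes "w \<in> complement"
  shows "blocks fst snd D *v w = 0" "oform w (blocks fst snd D *v v) = 0"
  using blocks_orthogonal[OF match, of w fst snd] assms by (simp_all add: complement_def)

definition G :: "nat \<Rightarrow> 'n cvec set" where
  "G j = F j \<inter> complement"

text \<open>The projection preserves every step, so a vector of \<open>complement\<close> that is
  orthogonal to \<open>G j\<close> is orthogonal to \<open>F j\<close>; this carries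
  \<open>dual\<close> over. The complement is stable because \<open>x\<close> agrees on the summand
  with \<open>blocks fst snd D\<close>, whose values are orthogonal to
  \<open>complement\<close>.\<close>

lemma filtered: "filtered_nilpotent k G x"
proof
  show "vec.subspace (G j)" if "j \<le> 2 * k + 1" for j
    unfolding G_def using subspace[OF that] complement_subspace by (rule vec.subspace_inter)
  show "G 0 = {0}"
    using bottom vec.subspace_0[OF complement_subspace] by (auto simp: G_def)
  show "G i \<subseteq> G j" if "i \<le> j" "j \<le> 2 * k + 1" for i j
    using mono[OF that] by (auto simp: G_def)
  show "G (2 * k + 1 - j) = G (2 * k + 1) \<inter> orth (G j)" if j: "j \<le> 2 * k + 1" for j
  proof
    show "G (2 * k + 1 - j) \<subseteq> G (2 * k + 1) \<inter> orth (G j)"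
      using dual[OF j] by (auto simp: G_def orth_def)
    show "G (2 * k + 1) \<inter> orth (G j) \<subseteq> G (2 * k + 1 - j)"
    proof
      fix w assume w: "w \<in> G (2 * k + 1) \<inter> orth (G j)"
      have "oform w u = 0" if u: "u \<in> F j" for u
      proof -
        have "u - projection u \<in> G j"
          using diff_projection projection_mem[OF u j] u subspace[OF j]
          by (auto simp: G_def vec.subspace_diff)
        then have "oform w (u - projection u) = 0"
          using w by (auto simp: orth_def)
        then show ?thesis
          using w oform_projection[of w u] by (simp add: oform_linear G_def)
      qed
      then show "w \<in> G (2 * k + 1 - j)"
        using dual[OF j] w by (auto simp: G_def orth_def)
    qed
  qed
  show "u \<in> G k" if "u \<in> G (k + 1)" "oform u u = 0" for u
    using middle that by (auto simp: G_def)
  show "oform (x *v u) v = - oform u (x *v v)" for u v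
    by (rule skew)
  show "x *v (x *v u) = 0" for u
    by (rule square)
  show "x *v u \<in> G (2 * k + 1)" if "u \<in> G (2 * k + 1)" for u
    using that stable blocks_complement(2)
    by (auto simp: G_def complement_def skew action)
qed

lemma smaller: "vec.dim (G (2 * k + 1)) < vec.dim (F (2 * k + 1))"
proof (rule vec.dim_psubset)
  obtain p where p: "p \<in> I"
    using summand by (auto simp: summand_def)
  have "fst p \<in> F M" "fst p \<notin> complement"
    using inW[OF low[OF p]] hyperbolicD(4)[OF hyp p p] p by (force simp: complement_def)+
  then have "G M \<subset> F M"
    by (auto simp: G_def)
  moreover have "vec.span (G M) = G M" "vec.span (F M) = F M"
    using subspace[OF order.refl] filtered_nilpotent.subspace[OF filtered order.refl]
    by (simp_all only: vec.span_eq_iff)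
  ultimately show "vec.span (G M) \<subset> vec.span (F M)"
    by (simp only:)
qed

text \<open>\<open>blocks fst snd D\<close> kills \<open>complement\<close>, and
  \<open>blocks fst snd D'\<close> kills the split-off summand. Their sum therefore reproduces
  \<open>x\<close> on both parts of \<open>F M\<close>.\<close>

lemma normal_form_extend:
  assumes "normal_form k G x I' D'"
  shows "normal_form k F x (I \<union> I') (D \<union> D')"
proof -
  have hyp': "hyperbolic I' fst snd" and match': "matching I' D'"
    and memG: "\<And>p. p \<in> I' \<Longrightarrow> fst p \<in> G k \<and> snd p \<in> G M"
    and span': "\<And>j. j \<le> k \<Longrightarrow> G j \<subseteq> vec.span (fst ` {p \<in> I'. fst p \<in> G j})"
    and ordered': "\<And>d. d \<in> D' \<Longrightarrow> level_ordered k G d"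
    and action': "\<And>u. u \<in> G M \<Longrightarrow> x *v u = blocks fst snd D' *v u"
    using assms by (auto simp: normal_form_def)
  have cross: "oform (fst q) (fst p) = 0" "oform (fst q) (snd p) = 0"
    "oform (snd q) (fst p) = 0" "oform (snd q) (snd p) = 0" if "p \<in> I" "q \<in> I'" for p q
    using memG[OF that(2)] that(1) by (auto simp: G_def complement_def)
  have cross': "oform (fst p) (fst q) = 0" "oform (snd p) (fst q) = 0"
    "oform (fst p) (snd q) = 0" "oform (snd p) (snd q) = 0" if "p \<in> I" "q \<in> I'" for p q
    using cross[OF that] oform_commute by metis+
  have disj: "p \<noteq> q" if "p \<in> I" "q \<in> I'" for p q
    using cross(2)[OF that] hyperbolicD(4)[OF hyp that(1) that(1)] by auto
  have h: "hyperbolic (I \<union> I') fst snd"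
    unfolding hyperbolic_def
  proof (intro conjI ballI)
    show "finite (I \<union> I')"
      using finI hyp' by (simp add: hyperbolic_def)
  next
    fix p q assume pq: "p \<in> I \<union> I'" "q \<in> I \<union> I'"
    consider "p \<in> I" "q \<in> I" | "p \<in> I" "q \<in> I'" | "p \<in> I'" "q \<in> I" | "p \<in> I'" "q \<in> I'"
      using pq by blast
    then have "oform (fst p) (fst q) = 0 \<and> oform (snd p) (snd q) = 0 \<and>
        oform (fst p) (snd q) = (if p = q then 1 else 0)"
    proof cases
      case 1
      then show ?thesis using hyperbolicD[OF hyp] by blast
    next
      case 2
      then show ?thesis using cross'[of p q] disj[of p q] by simp
    next
      case 3
      then show ?thesis using cross[of q p] disj[of q p] by auto
    next
      case 4
      then show ?thesis using hyperbolicD[OF hyp'] by blast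
    qed
    then show "oform (fst p) (fst q) = 0" "oform (snd p) (snd q) = 0"
        "oform (fst p) (snd q) = (if p = q then 1 else 0)"
      by blast+
  qed
  have sp: "F j \<subseteq> vec.span (fst ` {p \<in> I \<union> I'. fst p \<in> F j})" if j: "j \<le> k" for j
  proof
    fix u assume u: "u \<in> F j"
    have jM: "j \<le> M"
      using j by simp
    note Fj = subspace[OF jM]
    let ?S = "fst ` {p \<in> I \<union> I'. fst p \<in> F j}"
    have "u - projection u \<in> G j"
      using diff_projection projection_mem[OF u jM] u Fj by (auto simp: G_def vec.subspace_diff)
    then have "u - projection u \<in> vec.span (fst ` {p \<in> I'. fst p \<in> G j})"
      using span'[OF j] by blast
    also have "\<dots> \<subseteq> vec.span ?S"
      by (rule vec.span_mono) (auto simp: G_def)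
    finally have 1: "u - projection u \<in> vec.span ?S" .
    have "oform u (snd p) *s fst p + oform u (fst p) *s snd p \<in> vec.span ?S" if p: "p \<in> I" for p
    proof -
      have z: "oform u (fst p) = 0"
        using isotropic[OF u low[OF p]] j by simp
      have m: "oform u (snd p) *s fst p \<in> F j"
        by (rule paired_projection[OF pair[OF p] u jM])
      show ?thesis
      proof (cases "oform u (snd p) = 0")
        case True
        then show ?thesis by (simp add: z vec.span_zero)
      next
        case False
        \<comment> \<open>The projection of \<open>u\<close> to \<open>fst p\<close> stays in
          \<open>F j\<close>; a nonzero coefficient thus places \<open>fst p\<close> itself in
          \<open>F j\<close>.\<close>
        have "(1 / oform u (snd p)) *s (oform u (snd p) *s fst p) \<in> F j"
          using Fj m by (rule vec.subspace_scale)
        then have "fst p \<in> F j"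
          using False by simp
        then have "fst p \<in> ?S"
          using p by blast
        then show ?thesis
          by (simp add: z vec.span_base vec.span_scale)
      qed
    qed
    then have 2: "projection u \<in> vec.span ?S"
      unfolding projection_def by (intro vec.span_sum)
    show "u \<in> vec.span ?S"
      using vec.span_add[OF 1 2] by simp
  qed
  have mt: "matching (I \<union> I') (D \<union> D')"
  proof -
    have a: "fst s \<in> I \<and> fst t \<in> I" if "(s, t) \<in> D" for s t
      using matchingD[OF match that] by blast
    have b: "fst s \<in> I' \<and> fst t \<in> I'" if "(s, t) \<in> D'" for s t
      using matchingD[OF match' that] by blast
    have c: "{fst s, fst t} \<inter> {fst s', fst t'} = {}" "{fst s', fst t'} \<inter> {fst s, fst t} = {}"
      if "(s, t) \<in> D" "(s', t') \<in> D'" for s t s' t'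
      using a[OF that(1)] b[OF that(2)] disj by auto
    show ?thesis
      unfolding matching_def
    proof (intro conjI ballI)
      show "finite (D \<union> D')"
        using match match' by (simp add: matching_def)
    next
      fix d assume "d \<in> D \<union> D'"
      then show "case d of (s, t) \<Rightarrow> fst s \<in> I \<union> I' \<and> fst t \<in> I \<union> I' \<and> fst s \<noteq> fst t"
        using match match' by (auto simp: matching_def)
    next
      fix d assume d: "d \<in> D \<union> D'"
      obtain s t where st: "d = (s, t)" by (cases d)
      show "case d of (s, t) \<Rightarrow> \<forall>(s', t')\<in>D \<union> D'. (s, t) \<noteq> (s', t') \<longrightarrow> {fst s, fst t} \<inter> {fst s', fst t'} = {}"
        unfolding st prod.case
      proof (intro ballI)
        fix d' assume d': "d' \<in> D \<union> D'"
        obtain s' t' where st': "d' = (s', t')" by (cases d')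
        show "case d' of (s', t') \<Rightarrow> (s, t) \<noteq> (s', t') \<longrightarrow> {fst s, fst t} \<inter> {fst s', fst t'} = {}"
          unfolding st' prod.case
          using d[unfolded st] d'[unfolded st'] matching_disjoint[OF match] matching_disjoint[OF match'] c by blast
      qed
    qed
  qed
  have ord: "level_ordered k F d" if "d \<in> D \<union> D'" for d
  proof (cases "d \<in> D")
    case True
    then show ?thesis by (rule ordered)
  next
    case False
    with that have d: "d \<in> D'" by simp
    obtain p c q c' where e: "d = ((p, c), (q, c'))"
      by (metis surj_pair)
    have "p \<in> I'" "q \<in> I'"
      using match' d unfolding e matching_def by auto
    then have "fst p \<in> complement" "fst q \<in> complement"
      using memG by (auto simp: G_def)
    then show ?thesis
      using ordered'[OF d] unfolding e level_ordered_def by (auto simp: G_def)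
  qed
  have act: "x *v u = blocks fst snd (D \<union> D') *v u" if u: "u \<in> F M" for u
  proof -
    let ?w = "u - projection u"
    have w: "?w \<in> complement"
      by (rule diff_projection)
    have wG: "?w \<in> G M"
      using w projection_mem[OF u order.refl] u subspace[OF order.refl]
      by (auto simp: G_def intro: vec.subspace_diff)
    have fins: "finite D" "finite D'"
      using match match' by (auto simp: matching_def)
    have "D \<inter> D' = {}"
    proof (rule ccontr)
      assume "D \<inter> D' \<noteq> {}"
      then obtain s t where "(s, t) \<in> D" "(s, t) \<in> D'"
        by auto
      then have "fst s \<in> I" "fst s \<in> I'"
        using matchingD[OF match] matchingD[OF match'] by blast+
      then show False
        using disj by blast
    qed
    then have sum: "blocks fst snd (D \<union> D') *v v = blocks fst snd D *v v + blocks fst snd D' *v v" for v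
      unfolding blocks_apply by (rule sum.union_disjoint[OF fins])
    have "blocks fst snd D' *v projection u = 0"
    proof (rule blocks_orthogonal(1)[OF match'])
      fix q assume "q \<in> I'"
      then have "fst q \<in> complement" "snd q \<in> complement"
        using memG by (auto simp: G_def)
      then show "oform (projection u) (fst q) = 0 \<and> oform (projection u) (snd q) = 0"
        using oform_projection oform_commute by metis
    qed
    moreover have "blocks fst snd D *v projection u = x *v projection u"
      unfolding projection_def vec.sum
      by (intro sum.cong refl) (simp add: vec.add vec.scale action)
    moreover have "blocks fst snd D' *v ?w = x *v ?w"
      using action'[OF wG] by simp
    moreover have "blocks fst snd D *v ?w = 0"
      by (rule blocks_complement(1)[OF w])
    ultimately have "blocks fst snd (D \<union> D') *v (?w + projection u) = x *v (?w + projection u)"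
      by (simp only: sum vec.add add_0_left add_0_right)
    then show ?thesis
      by simp
  qed
  have mem: "fst p \<in> F k \<and> snd p \<in> F M" if "p \<in> I \<union> I'" for p
    using that memG[of p] low[of p] pair[of p] paired_inW(2)[of "fst p" "snd p"] by (auto simp: G_def)
  show ?thesis
    unfolding normal_form_def
  proof (intro conjI ballI allI impI)
    show "fst p \<in> F k" "snd p \<in> F M" if "p \<in> I \<union> I'" for p
      using mem[OF that] by auto
  qed (fact h sp mt ord act)+
qed

end

theorem normal_form_exists:
  assumes "filtered_nilpotent k F x"
  shows "\<exists>I D. normal_form k F x I D"
  using assms
proof (induction "vec.dim (F (2 * k + 1))" arbitrary: F rule: less_induct)
  case less
  interpret filtered_nilpotent k F x
    by (rule less.prems)
  show ?case
  proof (cases "F k = {0}")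
    case True
    \<comment> \<open>Now the self-dual step is everything. Images under \<open>x\<close> are
      isotropic, so \<open>middle\<close> puts them into \<open>F k\<close>, which is zero.\<close>
    have "F (k + 1) = F M \<inter> orth (F k)"
      using dual[of k] by (simp add: numeral_2_eq_2)
    then have top: "F (k + 1) = F M"
      using True by (auto simp: orth_def)
    have "x *v u = 0" if "u \<in> F M" for u
      using middle[of "x *v u"] stable[OF that] image_isotropic[of u u] True top by auto
    moreover have "F j \<subseteq> {0}" if "j \<le> k" for j
      using mono[OF that] True by auto
    ultimately have "normal_form k F x {} {}"
      by (simp add: normal_form_def hyperbolic_def matching_def blocks_def)
    then show ?thesis
      by blast
  next
    case False
    then obtain I D where "summand I D"
      using summand_exists by blast
    then interpret split_summand k F x I D
      by unfold_locales
    obtain I' D' where "normal_form k G x I' D'"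
      using less.hyps[OF smaller filtered] by blast
    then show ?thesis
      using normal_form_extend by blast
  qed
qed

section \<open>Normal forms in adapted bases\<close>

lemma independent_family:
  fixes g :: "'j \<Rightarrow> 'n::finite cvec"
  assumes "finite J" "\<And>c. (\<Sum>j\<in>J. c j *s g j) = 0 \<Longrightarrow> \<forall>j\<in>J. c j = 0"
  shows "inj_on g J" "vec.independent (g ` J)"
proof -
  show inj: "inj_on g J"
  proof (rule inj_onI, rule ccontr)
    fix i j assume ij: "i \<in> J" "j \<in> J" "g i = g j" "i \<noteq> j"
    let ?c = "\<lambda>m. if m = i then 1 else if m = j then -1 else (0::complex)"
    have "(\<Sum>m\<in>J. ?c m *s g m) = (\<Sum>m\<in>{i, j}. ?c m *s g m)"
      using assms(1) ij by (intro sum.mono_neutral_right) auto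
    also have "\<dots> = 0"
      using ij by simp
    finally show False
      using assms(2)[of ?c] ij by auto
  qed
  show "vec.independent (g ` J)"
  proof
    assume "vec.dependent (g ` J)"
    then obtain u v where uv: "v \<in> g ` J" "u v \<noteq> 0" "(\<Sum>v\<in>g ` J. u v *s v) = 0"
      using vec.dependent_finite[of "g ` J"] assms(1) by auto
    have "(\<Sum>j\<in>J. u (g j) *s g j) = 0"
      using uv(3) by (simp add: sum.reindex[OF inj])
    then show False
      using assms(2)[of "\<lambda>j. u (g j)"] uv(1,2) by auto
  qed
qed

text \<open>Pairing a linear relation with \<open>e q\<close> isolates the coefficient of
  \<open>f q\<close>. Once these vanish, pairing with \<open>f q\<close> isolates the coefficient of
  \<open>e q\<close>. The \<open>f\<close>-vectors are allowed to pair arbitrarily with each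
  other.\<close>

lemma half_hyperbolic_independent:
  fixes e f :: "'i \<Rightarrow> 'n::{finite,linorder} cvec"
  assumes "finite I" "\<And>p q. p \<in> I \<Longrightarrow> q \<in> I \<Longrightarrow> oform (e p) (e q) = 0"
    "\<And>p q. p \<in> I \<Longrightarrow> q \<in> I \<Longrightarrow> oform (e p) (f q) = (if p = q then 1 else 0)"
  shows "inj_on (side e f) (I \<times> UNIV)" "vec.independent (side e f ` (I \<times> UNIV))"
proof -
  have *: "\<forall>s\<in>I \<times> UNIV. c s = 0" if sum: "(\<Sum>s\<in>I \<times> UNIV. c s *s side e f s) = 0" for c
  proof -
    have split: "(\<Sum>s\<in>I \<times> UNIV. c s *s side e f s) = (\<Sum>p\<in>I. c (p, True) *s e p + c (p, False) *s f p)"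
    proof -
      have "(\<Sum>s\<in>I \<times> UNIV. c s *s side e f s) = (\<Sum>p\<in>I. \<Sum>d\<in>UNIV. c (p, d) *s side e f (p, d))"
        by (simp add: sum.cartesian_product)
      then show ?thesis
        by (simp add: UNIV_bool side_def add.commute)
    qed
    have form: "oform w (\<Sum>p\<in>I. c (p, True) *s e p + c (p, False) *s f p) = 0" for w
      using sum by (simp add: split)
    have F: "c (q, False) = 0" if "q \<in> I" for q
      using form[of "e q"] that assms
      by (simp add: oform_sum_right oform_linear if_distrib[of "\<lambda>x. _ * x"] cong: if_cong)
    have T: "c (q, True) = 0" if "q \<in> I" for q
      using form[of "f q"] that assms
      by (simp add: F oform_sum_right oform_linear oform_commute[of "f q"] if_distrib[of "\<lambda>x. _ * x"] cong: if_cong)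
    show ?thesis
    proof
      fix s :: "'i \<times> bool" assume "s \<in> I \<times> UNIV"
      then show "c s = 0"
        using F T by (cases s; cases "snd s") auto
    qed
  qed
  show "inj_on (side e f) (I \<times> UNIV)" "vec.independent (side e f ` (I \<times> UNIV))"
    using independent_family[of "I \<times> UNIV" "side e f"] * assms(1) by auto
qed

lemma half_hyperbolic_card:
  fixes e f :: "'i \<Rightarrow> 'n::{finite,linorder} cvec"
  assumes "finite I" "\<And>p q. p \<in> I \<Longrightarrow> q \<in> I \<Longrightarrow> oform (e p) (e q) = 0"
    "\<And>p q. p \<in> I \<Longrightarrow> q \<in> I \<Longrightarrow> oform (e p) (f q) = (if p = q then 1 else 0)"
  shows "2 * card I \<le> CARD('n)"
proof -
  have "2 * card I = card (side e f ` (I \<times> UNIV))"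
    using half_hyperbolic_independent(1)[OF assms] by (simp add: card_image card_cartesian_product)
  also have "\<dots> \<le> CARD('n)"
    using half_hyperbolic_independent(2)[OF assms] dim_subset_UNIV_cart_gen
    by (metis vec.dim_eq_card_independent)
  finally show ?thesis .
qed

text \<open>Separating functionals give dual vectors for a basis of \<open>X\<close>. They are in
  general not isotropic, hence the use of half-hyperbolic systems.\<close>

lemma isotropic_subspace_dim:
  fixes X :: "'n::{finite,linorder} cvec set"
  assumes "\<And>u v. u \<in> X \<Longrightarrow> v \<in> X \<Longrightarrow> oform u v = 0"
  shows "2 * vec.dim X \<le> CARD('n)"
proof -
  obtain B where B: "B \<subseteq> X" "vec.independent B" "card B = vec.dim X"
    using vec.basis_exists by metis
  have "\<exists>f. f \<in> orth (vec.span (B - {p})) \<and> oform f p = 1" if "p \<in> B" for p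
    using separating_functional[OF vec.subspace_span, of p "B - {p}"] B(2) that
    unfolding vec.dependent_def by metis
  then obtain f where f: "\<And>p. p \<in> B \<Longrightarrow> f p \<in> orth (vec.span (B - {p})) \<and> oform (f p) p = 1"
    by metis
  have "oform p (f q) = (if p = q then 1 else 0)" if "p \<in> B" "q \<in> B" for p q
    using f[OF that(2)] that vec.span_base[of p "B - {q}"]
    by (auto simp: oform_commute[of p] orth_def)
  then show ?thesis
    using half_hyperbolic_card[of B id f] vec.finiteI_independent[OF B(2)] B assms
    by (auto simp: subset_iff)
qed

text \<open>Bijections between fibers are glued. This places a basis into slots over the right
  vertices, and later matches the links and the free slots of two drawings.\<close>

lemma fiberwise_bijection:
  assumes "finite A" "finite B" "\<And>c. card {a \<in> A. f a = c} = card {b \<in> B. g b = c}"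
  obtains h where "bij_betw h A B" "\<And>a. a \<in> A \<Longrightarrow> g (h a) = f a"
proof -
  have "\<exists>h. bij_betw h {a \<in> A. f a = c} {b \<in> B. g b = c}" for c
    using assms by (intro finite_same_card_bij) auto
  then obtain h where h: "\<And>c. bij_betw (h c) {a \<in> A. f a = c} {b \<in> B. g b = c}"
    by metis
  have mem: "h (f a) a \<in> B" "g (h (f a) a) = f a" if "a \<in> A" for a
    using bij_betw_apply[OF h, of a "f a"] that by auto
  have "bij_betw (\<lambda>a. h (f a) a) A B"
  proof (rule bij_betwI')
    fix a a' assume aa: "a \<in> A" "a' \<in> A"
    show "h (f a) a = h (f a') a' \<longleftrightarrow> a = a'"
    proof
      assume eq: "h (f a) a = h (f a') a'"
      then have "f a = f a'"
        using mem aa by metis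
      then show "a = a'"
        using eq aa bij_betw_imp_inj_on[OF h, of "f a"] by (auto simp: inj_on_def)
    qed simp
  next
    fix a assume "a \<in> A"
    then show "h (f a) a \<in> B" by (rule mem)
  next
    fix b assume b: "b \<in> B"
    then have "b \<in> h (g b) ` {a \<in> A. f a = g b}"
      using bij_betw_imp_surj_on[OF h] by auto
    then obtain a where "a \<in> A" "f a = g b" "b = h (g b) a"
      by auto
    then show "\<exists>a\<in>A. b = h (f a) a"
      by (intro bexI[of _ a]) simp_all
  qed
  with mem that show thesis
    by blast
qed

section \<open>Links and the kinds of their ends\<close>

fun end_kinds :: "link \<Rightarrow> bool \<times> bool" where
  "end_kinds (Arrow i j) = (False, True)"
| "end_kinds (Loop i) = (False, True)"
| "end_kinds (DotArrow i j) = (if i < j then (False, False) else (True, True))"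
| "end_kinds (DotLoop Clockwise i) = (False, False)"
| "end_kinds (DotLoop Counterclockwise i) = (True, True)"

lemma link_block_wedge:
  "link_block e f L p q = wedge (side e f (p, fst (end_kinds L))) (side e f (q, snd (end_kinds L)))"
  by (cases L rule: end_kinds.cases) (auto simp: side_def)

text \<open>\<open>True\<close> stands for an \<open>e\<close>-end and \<open>False\<close> for an
  \<open>f\<close>-end. This inverts \<open>end_kinds\<close> on ends in the right order: an
  \<open>e\<close>-end followed by an \<open>f\<close>-end never occurs there, and for a dotted
  arrow the direction agrees with the kind.\<close>

definition link_of :: "nat \<Rightarrow> bool \<Rightarrow> nat \<Rightarrow> bool \<Rightarrow> link" where
  "link_of i c j d =
     (if c = d then
        if i = j then DotLoop (if c then Counterclockwise else Clockwise) i else DotArrow i j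
      else if i = j then Loop i else Arrow i j)"

lemma link_of_simps [simp]: "source (link_of i c j d) = i" "target (link_of i c j d) = j"
  by (auto simp: link_of_def)

lemma wf_link_of: "i \<in> {1..k} \<Longrightarrow> j \<in> {1..k} \<Longrightarrow> wf_link k (link_of i c j d)"
  by (auto simp: link_of_def)

lemma end_kinds_link_of:
  assumes "\<not> (c \<and> \<not> d)" "\<not> c \<Longrightarrow> \<not> d \<Longrightarrow> i \<le> j" "c \<Longrightarrow> d \<Longrightarrow> j \<le> i"
  shows "end_kinds (link_of i c j d) = (c, d)"
  using assms by (cases c; cases d) (auto simp: link_of_def)

lemma finite_slots: "finite (slots j b)"
  by (simp add: slots_def)

lemma card_slots_fiber: "card {p \<in> slots k b. fst p = i} = (if i \<in> {1..k} then b i else 0)"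
proof -
  have "{p \<in> slots k b. fst p = i} = (if i \<in> {1..k} then Pair i ` {..<b i} else {})"
    by (auto simp: slots_def)
  then show ?thesis
    by (simp add: card_image inj_on_def)
qed

section \<open>The filtration of a maximal isotropic flag\<close>

locale maximal_flag =
  fixes l k :: nat and V :: "nat \<Rightarrow> 'n::{finite,linorder} cvec set"
  assumes card: "CARD('n) = 2 * l \<or> CARD('n) = 2 * l + 1"
    and flag: "isotropic_flag k V"
    and maximal: "flag_dim V k = l"
begin

abbreviation b :: "nat \<Rightarrow> nat" where "b \<equiv> block_vector V"

text \<open>The zero space is put at index 0, so that \<open>F\<close> starts with zero and ends
  with the orthogonal complement of zero, the full space.\<close>

definition U :: "nat \<Rightarrow> 'n cvec set" where
  "U j = (if j = 0 then {0} else V j)"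

definition F :: "nat \<Rightarrow> 'n cvec set" where
  "F j = (if j \<le> k then U j else orth (U (2 * k + 1 - j)))"

lemma dim_U: "vec.dim (U j) = flag_dim V j"
  by (simp add: U_def flag_dim_def)

lemma subspace_U: "j \<le> k \<Longrightarrow> vec.subspace (U j)"
  using flag by (auto simp: U_def isotropic_flag_def vec.subspace_single_0)

lemma U_Suc: "Suc j \<le> k \<Longrightarrow> U j \<subseteq> U (Suc j)"
  using flag vec.subspace_0[OF subspace_U[of "Suc j"]]
  by (cases j) (auto simp: U_def isotropic_flag_def)

lemma U_mono:
  assumes "i \<le> j" "j \<le> k"
  shows "U i \<subseteq> U j"
  using assms by (induction rule: dec_induct) (use U_Suc in force)+

lemma U_isotropic: "j \<le> k \<Longrightarrow> u \<in> U j \<Longrightarrow> v \<in> U j \<Longrightarrow> oform u v = 0"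
  using flag by (cases "j = 0") (auto simp: U_def isotropic_flag_def dest!: bspec[of _ _ j])

text \<open>Otherwise \<open>u\<close> and \<open>U k\<close> together would span a totally
  isotropic subspace of dimension \<open>l + 1\<close>, contradicting the bound by half of
  \<open>CARD('n)\<close>.\<close>

lemma U_maximal:
  assumes "u \<in> orth (U k)" "oform u u = 0"
  shows "u \<in> U k"
proof (rule ccontr)
  assume u: "u \<notin> U k"
  have span: "vec.span (U k) = U k"
    using subspace_U vec.span_eq_iff by blast
  have uv: "oform u v = 0" "oform v u = 0" if "v \<in> U k" for v
    using assms(1) that by (auto simp: orth_def oform_commute[of v])
  have "2 * vec.dim (insert u (U k)) \<le> CARD('n)"
    by (rule isotropic_subspace_dim) (use assms(2) uv U_isotropic[OF order.refl] in auto)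
  moreover have "vec.dim (insert u (U k)) = l + 1"
    using u by (simp add: vec.dim_insert span dim_U maximal)
  ultimately show False
    using card by simp
qed

lemma filtered:
  assumes "x \<in> nilpotent2"
  shows "filtered_nilpotent k F x"
proof
  show "vec.subspace (F j)" if "j \<le> 2 * k + 1" for j
    using subspace_U by (simp add: F_def)
  show "F 0 = {0}"
    by (simp add: F_def U_def)
  show "F i \<subseteq> F j" if ij: "i \<le> j" "j \<le> 2 * k + 1" for i j
  proof -
    consider "j \<le> k" | "i \<le> k" "k < j" | "k < i"
      using ij by linarith
    then show ?thesis
    proof cases
      case 1
      then show ?thesis using ij U_mono by (simp add: F_def)
    next
      case 2
      then have "U i \<subseteq> U k" "U (2 * k + 1 - j) \<subseteq> U k"
        by (intro U_mono; simp)+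
      then show ?thesis
        using 2 U_isotropic[of k] by (auto simp: F_def orth_def subset_iff)
    next
      case 3
      then have "U (2 * k + 1 - j) \<subseteq> U (2 * k + 1 - i)"
        using ij by (intro U_mono) simp_all
      then show ?thesis
        using 3 ij orth_antimono by (simp add: F_def)
    qed
  qed
  show "F (2 * k + 1 - j) = F (2 * k + 1) \<inter> orth (F j)" if j: "j \<le> 2 * k + 1" for j
  proof -
    have "F (2 * k + 1) = UNIV"
      by (auto simp: F_def U_def orth_def)
    moreover have "F (2 * k + 1 - j) = orth (F j)"
    proof (cases "j \<le> k")
      case True
      then show ?thesis using j by (auto simp: F_def)
    next
      case False
      then have "orth (orth (U (2 * k + 1 - j))) = U (2 * k + 1 - j)"
        by (intro orth_orth subspace_U) simp
      then show ?thesis using False j by (auto simp: F_def)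
    qed
    ultimately show ?thesis by simp
  qed
  show "u \<in> F k" if "u \<in> F (k + 1)" "oform u u = 0" for u
    using that U_maximal by (simp add: F_def numeral_2_eq_2)
  show "oform (x *v u) v = - oform u (x *v v)" for u v
    using assms by (simp add: nilpotent2_def orthogonal_lie_iff)
  show "x *v (x *v u) = 0" for u
    using assms by (simp add: nilpotent2_def matrix_vector_mul_assoc)
  show "x *v u \<in> F (2 * k + 1)" for u
    by (auto simp: F_def U_def orth_def)
qed

text \<open>The pairs of vectors indexing a normal form are renamed by slots. The first components
  of level at most \<open>j\<close> form a basis of \<open>F j\<close>, so exactly
  \<open>b i\<close> pairs have level \<open>i\<close>, as many as there are slots over vertex
  \<open>i\<close>.\<close>

lemma pattern_exists:
  assumes "x \<in> nilpotent2"
  shows "\<exists>E. has_pattern k V x E \<and> (\<forall>L\<in>#E. wf_link k L)"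
proof -
  interpret filtered_nilpotent k F x
    by (rule filtered[OF assms])
  obtain I D where nf: "normal_form k F x I D"
    using normal_form_exists[OF filtered[OF assms]] by blast
  have hyp: "hyperbolic I fst snd" and match: "matching I D"
    and low: "\<And>p. p \<in> I \<Longrightarrow> fst p \<in> F k"
    and span: "\<And>j. j \<le> k \<Longrightarrow> F j \<subseteq> vec.span (fst ` {p \<in> I. fst p \<in> F j})"
    and ordered: "\<And>d. d \<in> D \<Longrightarrow> level_ordered k F d"
    and act: "\<And>u. u \<in> F M \<Longrightarrow> x *v u = blocks fst snd D *v u"
    using nf by (auto simp: normal_form_def)
  note finI = hyperbolicD(1)[OF hyp]
  define lev where "lev p = (LEAST j. fst p \<in> F j)" for p :: "'n cvec \<times> 'n cvec"
  have lev_in: "fst p \<in> F (lev p)" and lev_k: "lev p \<le> k" if "p \<in> I" for p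
    unfolding lev_def using low[OF that] by (rule LeastI, rule Least_le)
  have lev_iff: "fst p \<in> F j \<longleftrightarrow> lev p \<le> j" if "p \<in> I" "j \<le> k" for p j
    using lev_in[OF that(1)] mono[of "lev p" j] that(2) Least_le[of "\<lambda>j. fst p \<in> F j" j]
    by (auto simp: lev_def)
  have lev_1: "1 \<le> lev p" if "p \<in> I" for p
    using lev_in[OF that] hyperbolicD(4)[OF hyp that that] bottom by (cases "lev p") auto
  have "inj_on (side fst snd) (I \<times> UNIV)" "vec.independent (side fst snd ` (I \<times> UNIV))"
    using half_hyperbolic_independent[of I fst snd] finI hyperbolicD[OF hyp] by auto
  then have inj: "inj_on fst I" and ind: "vec.independent (fst ` I)"
  proof -
    assume *: "inj_on (side fst snd) (I \<times> UNIV)" "vec.independent (side fst snd ` (I \<times> UNIV))"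
    have eq: "fst p = side fst snd (p, True)" for p :: "'n cvec \<times> 'n cvec"
      by (simp add: side_def)
    show "inj_on fst I"
    proof (rule inj_onI)
      fix p q assume "p \<in> I" "q \<in> I" "fst p = fst q"
      then show "p = q"
        using inj_onD[OF *(1), of "(p, True)" "(q, True)"] by (simp add: side_def)
    qed
    show "vec.independent (fst ` I)"
      by (rule vec.independent_mono[OF *(2)]) (force simp: eq)
  qed
  have Fspan: "F j = vec.span (fst ` {p \<in> I. lev p \<le> j})" if j: "j \<le> k" for j
  proof
    have set: "{p \<in> I. lev p \<le> j} = {p \<in> I. fst p \<in> F j}"
      using lev_iff j by auto
    show "F j \<subseteq> vec.span (fst ` {p \<in> I. lev p \<le> j})"
      using span[OF j] unfolding set .
    show "vec.span (fst ` {p \<in> I. lev p \<le> j}) \<subseteq> F j"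
      unfolding set using subspace[of j] j by (intro vec.span_minimal) auto
  qed
  have card_le: "card {p \<in> I. lev p \<le> j} = flag_dim V j" if j: "j \<le> k" for j
  proof -
    have "card {p \<in> I. lev p \<le> j} = card (fst ` {p \<in> I. lev p \<le> j})"
      by (rule card_image[symmetric], rule inj_on_subset[OF inj]) auto
    also have "\<dots> = vec.dim (F j)"
      unfolding Fspan[OF j] vec.dim_span
      by (rule vec.dim_eq_card_independent[symmetric], rule vec.independent_mono[OF ind]) auto
    finally show ?thesis
      using j by (simp add: F_def dim_U)
  qed
  have card_eq: "card {p \<in> I. lev p = i} = (if i \<in> {1..k} then b i else 0)" for i
  proof (cases "i \<in> {1..k}")
    case True
    have "{p \<in> I. lev p = i} = {p \<in> I. lev p \<le> i} - {p \<in> I. lev p \<le> i - 1}"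
      using True by auto
    moreover have "{p \<in> I. lev p \<le> i - 1} \<subseteq> {p \<in> I. lev p \<le> i}"
      by auto
    ultimately have "card {p \<in> I. lev p = i} = card {p \<in> I. lev p \<le> i} - card {p \<in> I. lev p \<le> i - 1}"
      using finI by (simp add: card_Diff_subset)
    then show ?thesis
      using card_le[of i] card_le[of "i - 1"] True by (simp add: block_vector_def le_diff_conv)
  next
    case False
    then have "{p \<in> I. lev p = i} = {}"
      using lev_1 lev_k by auto
    then show ?thesis
      by (simp only: if_not_P[OF False] card.empty)
  qed
  obtain h where h: "bij_betw h I (slots k b)" "\<And>p. p \<in> I \<Longrightarrow> fst (h p) = lev p"
    by (rule fiberwise_bijection[of I "slots k b" lev fst])
       (use finI finite_slots card_eq card_slots_fiber in auto)
  define g where "g = the_inv_into I h"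
  have gh: "g (h p) = p" if "p \<in> I" for p
    using that h(1) by (simp add: g_def the_inv_into_f_f bij_betw_def)
  have hslot: "h p \<in> slots k b" if "p \<in> I" for p
    using h(1) that bij_betwE by blast
  have g: "bij_betw g (slots k b) I"
    unfolding g_def by (rule bij_betw_the_inv_into[OF h(1)])
  have slot_le: "slots j b = h ` {p \<in> I. lev p \<le> j}" if j: "j \<le> k" for j
  proof -
    have "slots j b = {s \<in> h ` I. fst s \<le> j}"
      using j h(1) by (auto simp: slots_def bij_betw_def)
    also have "\<dots> = h ` {p \<in> I. lev p \<le> j}"
      using h(2) by auto
    finally show ?thesis .
  qed
  define e where "e = fst \<circ> g"
  define f where "f = snd \<circ> g"
  have side_h: "side e f (h p, c) = side fst snd (p, c)" if "p \<in> I" for p c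
    using gh[OF that] by (simp add: side_def e_def f_def)
  have adapted: "adapted_basis k V e f"
    unfolding adapted_basis_def
  proof (intro conjI ballI)
    fix i assume i: "i \<in> {1..k}"
    have "e ` slots i b = fst ` {p \<in> I. lev p \<le> i}"
      using i slot_le[of i] gh by (auto simp: e_def image_image image_iff)
    then show "V i = vec.span (e ` slots i b)"
      using Fspan[of i] i by (simp add: F_def U_def)
  next
    fix s t assume st: "s \<in> slots k b" "t \<in> slots k b"
    have "g s \<in> I" "g t \<in> I" "g s = g t \<longleftrightarrow> s = t"
      using g st by (auto simp: bij_betw_def inj_on_def)
    then show "oform (e s) (e t) = 0" "oform (f s) (f t) = 0"
        "oform (e s) (f t) = (if s = t then 1 else 0)"
      using hyperbolicD[OF hyp] by (simp_all add: e_def f_def)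
  qed
  \<comment> \<open>Different elements of \<open>D\<close> use different slots, so no multiplicity
    is lost in passing to links.\<close>
  define \<phi> where "\<phi> = (\<lambda>((p, c), (q, d)). (link_of (lev p) c (lev q) d, h p, h q))"
  have hinj: "h p = h q \<longleftrightarrow> p = q" if "p \<in> I" "q \<in> I" for p q
    using h(1) that by (auto simp: bij_betw_def inj_on_def)
  have inj\<phi>: "inj_on \<phi> D"
  proof (rule inj_onI, rule ccontr)
    fix s s' assume ss: "s \<in> D" "s' \<in> D" "\<phi> s = \<phi> s'" "s \<noteq> s'"
    obtain p c q d where s: "s = ((p, c), (q, d))" by (metis surj_pair)
    obtain p' c' q' d' where s': "s' = ((p', c'), (q', d'))" by (metis surj_pair)
    have "p = p'"
      using ss(3) hinj[of p p'] matchingD(1)[OF match ss(1)[unfolded s]] matchingD(1)[OF match ss(2)[unfolded s']]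
      by (simp add: \<phi>_def s s')
    then show False
      using matching_disjoint[OF match ss(1)[unfolded s] ss(2)[unfolded s']] ss(4) by (auto simp: s s')
  qed
  have finD: "finite D"
    using match by (simp add: matching_def)
  have "drawing k b (image_mset fst (mset_set (\<phi> ` D))) (\<phi> ` D)"
    unfolding drawing_def
  proof (intro conjI ballI)
    show "finite (\<phi> ` D)" using finD by simp
    show "image_mset fst (mset_set (\<phi> ` D)) = image_mset fst (mset_set (\<phi> ` D))" ..
  next
    fix z assume "z \<in> \<phi> ` D"
    then obtain p c q d where z: "z = \<phi> ((p, c), (q, d))" "((p, c), (q, d)) \<in> D"
      by auto
    show "case z of (L, p, q) \<Rightarrow> p \<in> slots k b \<and> q \<in> slots k b \<and> fst p = source L \<and> fst q = target L \<and> p \<noteq> q"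
      using matchingD[OF match z(2)] by (simp add: z(1) \<phi>_def hslot h(2) hinj)
  next
    fix z assume "z \<in> \<phi> ` D"
    then obtain p c q d where z: "z = \<phi> ((p, c), (q, d))" "((p, c), (q, d)) \<in> D"
      by auto
    have "{h p, h q} \<inter> {h p', h q'} = {}"
      if "((p', c'), (q', d')) \<in> D" "z \<noteq> \<phi> ((p', c'), (q', d'))" for p' c' q' d'
    proof -
      have "((p, c), (q, d)) \<noteq> ((p', c'), (q', d'))"
        using that(2) z(1) by blast
      then have "{p, q} \<inter> {p', q'} = {}"
        using matching_disjoint[OF match z(2) that(1)] by simp
      moreover have "p \<in> I" "q \<in> I" "p' \<in> I" "q' \<in> I"
        using matchingD[OF match z(2)] matchingD[OF match that(1)] by simp_all
      ultimately show ?thesis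
        by (simp add: hinj)
    qed
    note disj = this
    have zeq: "z = (link_of (lev p) c (lev q) d, h p, h q)"
      by (simp add: z(1) \<phi>_def)
    show "case z of (L, p, q) \<Rightarrow> \<forall>(L', p', q')\<in>\<phi> ` D. (L, p, q) \<noteq> (L', p', q') \<longrightarrow> {p, q} \<inter> {p', q'} = {}"
      unfolding zeq prod.case
    proof (intro ballI)
      fix z' assume "z' \<in> \<phi> ` D"
      then obtain p' c' q' d' where z': "z' = \<phi> ((p', c'), (q', d'))" "((p', c'), (q', d')) \<in> D"
        by auto
      show "case z' of (L', p', q') \<Rightarrow> (link_of (lev p) c (lev q) d, h p, h q) \<noteq> (L', p', q') \<longrightarrow>
          {h p, h q} \<inter> {p', q'} = {}"
        using disj[OF z'(2)] unfolding z'(1) zeq by (simp add: \<phi>_def)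
    qed
  qed
  moreover have "x = (\<Sum>(L, p, q)\<in>\<phi> ` D. link_block e f L p q)"
  proof -
    \<comment> \<open>The normal form describes \<open>x\<close> on \<open>F M\<close>; this being
      everything, the matrices agree.\<close>
    have "F M = UNIV"
      by (auto simp: F_def U_def orth_def)
    then have "x = blocks fst snd D"
      using act by (simp add: matrix_eq)
    also have "\<dots> = (\<Sum>s\<in>D. case \<phi> s of (L, p, q) \<Rightarrow> link_block e f L p q)"
      unfolding blocks_def
    proof (intro sum.cong refl)
      fix s assume s: "s \<in> D"
      obtain p c q d where sp: "s = ((p, c), (q, d))" by (metis surj_pair)
      have pq: "p \<in> I" "q \<in> I"
        using matchingD[OF match s[unfolded sp]] by auto
      have "end_kinds (link_of (lev p) c (lev q) d) = (c, d)"
      proof (rule end_kinds_link_of)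
        note o = ordered[OF s, unfolded sp level_ordered_def prod.case]
        show "\<not> (c \<and> \<not> d)"
          using o by blast
        show "lev p \<le> lev q" if "\<not> c" "\<not> d"
          using o that lev_iff[OF pq(1) lev_k[OF pq(2)]] lev_in[OF pq(2)] lev_k[OF pq(2)] by blast
        show "lev q \<le> lev p" if "c" "d"
          using o that lev_iff[OF pq(2) lev_k[OF pq(1)]] lev_in[OF pq(1)] lev_k[OF pq(1)] by blast
      qed
      then show "(case s of (s, t) \<Rightarrow> wedge (side fst snd s) (side fst snd t)) =
          (case \<phi> s of (L, p, q) \<Rightarrow> link_block e f L p q)"
        by (simp add: sp \<phi>_def link_block_wedge side_h pq)
    qed
    also have "\<dots> = (\<Sum>(L, p, q)\<in>\<phi> ` D. link_block e f L p q)"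
      by (simp add: sum.reindex[OF inj\<phi>] o_def)
    finally show ?thesis .
  qed
  ultimately have "has_pattern k V x (image_mset fst (mset_set (\<phi> ` D)))"
    using adapted unfolding has_pattern_def by blast
  moreover have "wf_link k L" if "L \<in># image_mset fst (mset_set (\<phi> ` D))" for L
  proof -
    obtain p c q d where "((p, c), (q, d)) \<in> D" "L = link_of (lev p) c (lev q) d"
      using \<open>L \<in># _\<close> finD by (auto simp: \<phi>_def)
    then show ?thesis
      using matchingD[OF match, of "(p, c)" "(q, d)"] lev_1 lev_k by (simp add: wf_link_of)
  qed
  ultimately show ?thesis
    by blast
qed

text \<open>A pattern of the zero matrix already comes with an adapted basis.\<close>

lemma adapted_basis_exists: "\<exists>e f. adapted_basis k V e f"
proof -
  have "(0 :: 'n cmat) \<in> nilpotent2"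
    by (simp add: nilpotent2_def orthogonal_lie_iff)
  then show ?thesis
    using pattern_exists unfolding has_pattern_def by blast
qed

end

section \<open>Uniqueness of the pattern\<close>

definition to_match :: "link \<times> (nat \<times> nat) \<times> (nat \<times> nat) \<Rightarrow>
    ((nat \<times> nat) \<times> bool) \<times> ((nat \<times> nat) \<times> bool)" where
  "to_match = (\<lambda>(L, p, q). ((p, fst (end_kinds L)), (q, snd (end_kinds L))))"

lemma drawingD:
  assumes "drawing k b E D" "(L, p, q) \<in> D"
  shows "p \<in> slots k b" "q \<in> slots k b" "fst p = source L" "fst q = target L" "p \<noteq> q"
proof -
  have "\<forall>(L, p, q)\<in>D. p \<in> slots k b \<and> q \<in> slots k b \<and> fst p = source L \<and> fst q = target L \<and> p \<noteq> q"
    using assms(1)[unfolded drawing_def] by (elim conjE) assumption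
  from bspec[OF this assms(2)] show "p \<in> slots k b" "q \<in> slots k b" "fst p = source L"
      "fst q = target L" "p \<noteq> q"
    by simp_all
qed

lemma drawing_disjoint:
  assumes "drawing k b E D" "d \<in> D" "d' \<in> D" "d \<noteq> d'"
  shows "{fst (snd d), snd (snd d)} \<inter> {fst (snd d'), snd (snd d')} = {}"
proof -
  have "\<forall>(L, p, q)\<in>D. \<forall>(L', p', q')\<in>D. (L, p, q) \<noteq> (L', p', q') \<longrightarrow> {p, q} \<inter> {p', q'} = {}"
    using assms(1)[unfolded drawing_def] by (elim conjE) assumption
  note disj = this
  obtain L p q where d: "d = (L, p, q)"
    by (cases d)
  obtain L' p' q' where d': "d' = (L', p', q')"
    by (cases d')
  have "(L, p, q) \<noteq> (L', p', q') \<longrightarrow> {p, q} \<inter> {p', q'} = {}"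
    using bspec[OF bspec[OF disj assms(2), unfolded d prod.case] assms(3), unfolded d' prod.case] .
  then show ?thesis
    using assms(4) unfolding d d' fst_conv snd_conv by blast
qed

lemma drawing_finite: "drawing k b E D \<Longrightarrow> finite D"
  and drawing_image: "drawing k b E D \<Longrightarrow> image_mset fst (mset_set D) = E"
  unfolding drawing_def by blast+

lemma drawing_inj:
  assumes "drawing k b E D"
  shows "inj_on to_match D"
proof (rule inj_onI, rule ccontr)
  fix d d' assume d: "d \<in> D" "d' \<in> D" "to_match d = to_match d'" "d \<noteq> d'"
  then have "fst (snd d) = fst (snd d')"
    by (auto simp: to_match_def split: prod.splits)
  then show False
    using drawing_disjoint[OF assms d(1,2,4)] by auto
qed

lemma drawing_matching:
  assumes "drawing k b E D"
  shows "matching (slots k b) (to_match ` D)"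
  unfolding matching_def
proof (intro conjI ballI)
  show "finite (to_match ` D)"
    using drawing_finite[OF assms] by simp
next
  fix z assume "z \<in> to_match ` D"
  then obtain L p q where "(L, p, q) \<in> D" "z = to_match (L, p, q)"
    by auto
  then show "case z of (s, t) \<Rightarrow> fst s \<in> slots k b \<and> fst t \<in> slots k b \<and> fst s \<noteq> fst t"
    using drawingD[OF assms] by (simp add: to_match_def)
next
  fix z assume "z \<in> to_match ` D"
  then obtain d where d: "d \<in> D" "z = to_match d"
    by auto
  have fst: "fst (fst (to_match d)) = fst (snd d)" "fst (snd (to_match d)) = snd (snd d)" for d
    by (simp_all add: to_match_def case_prod_unfold)
  show "case z of (s, t) \<Rightarrow> \<forall>(s', t')\<in>to_match ` D. (s, t) \<noteq> (s', t') \<longrightarrow>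
      {fst s, fst t} \<inter> {fst s', fst t'} = {}"
    unfolding case_prod_unfold
  proof (intro ballI impI)
    fix z' assume z': "z' \<in> to_match ` D" "(fst z, snd z) \<noteq> (fst z', snd z')"
    then obtain d' where d': "d' \<in> D" "z' = to_match d'"
      by auto
    have "d \<noteq> d'"
      using z'(2) d(2) d'(2) by auto
    then show "{fst (fst z), fst (snd z)} \<inter> {fst (fst z'), fst (snd z')} = {}"
      using drawing_disjoint[OF assms d(1) d'(1)] by (simp only: d(2) d'(2) fst) simp
  qed
qed

lemma pattern_blocks:
  assumes "drawing k b E D"
  shows "(\<Sum>(L, p, q)\<in>D. link_block e f L p q) = blocks e f (to_match ` D)"
  unfolding blocks_def sum.reindex[OF drawing_inj[OF assms]]
  by (rule sum.cong) (auto simp: to_match_def link_block_wedge)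

section \<open>The action of blocks on basis vectors\<close>

definition opp :: "'i \<times> bool \<Rightarrow> 'i \<times> bool" where
  "opp s = (fst s, \<not> snd s)"

lemma fst_opp [simp]: "fst (opp s) = fst s" and opp_opp [simp]: "opp (opp s) = s"
  by (simp_all add: opp_def)

lemma oform_side:
  assumes "hyperbolic I e f" "fst s \<in> I" "fst t \<in> I"
  shows "oform (side e f s) (side e f t) = (if t = opp s then 1 else 0)"
  using hyperbolicD[OF assms(1)] assms(2,3)
  by (cases s; cases t) (auto simp: side_def opp_def)

text \<open>\<open>opp s\<close> pairs nontrivially with \<open>s\<close> only, and its slot occurs
  in no other element of \<open>N\<close>; a single summand of the block sum survives.\<close>

lemma blocks_side:
  assumes "hyperbolic I e f" "matching I N" "(s, t) \<in> N"
  shows "blocks e f N *v side e f (opp s) = side e f t"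
    "blocks e f N *v side e f (opp t) = - side e f s"
proof -
  have fin: "finite N"
    using assms(2) by (simp add: matching_def)
  have st: "fst s \<in> I" "fst t \<in> I" "fst s \<noteq> fst t"
    using matchingD[OF assms(2,3)] by auto
  have z: "oform (side e f s') (side e f (opp r)) = 0 \<and> oform (side e f t') (side e f (opp r)) = 0"
    if "(s', t') \<in> N" "(s', t') \<noteq> (s, t)" "r = s \<or> r = t" for s' t' r
  proof -
    have "fst s' \<in> I" "fst t' \<in> I" "{fst s, fst t} \<inter> {fst s', fst t'} = {}"
      using matchingD[OF assms(2) that(1)] matching_disjoint[OF assms(2,3) that(1)] that(2) by auto
    moreover from this that(3) st have "fst r \<in> I" "fst r \<noteq> fst s'" "fst r \<noteq> fst t'"
      by auto
    ultimately show ?thesis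
      using oform_side[OF assms(1), of s' "opp r"] oform_side[OF assms(1), of t' "opp r"]
      by (metis fst_opp)
  qed
  have single: "blocks e f N *v side e f (opp r) =
      oform (side e f s) (side e f (opp r)) *s side e f t - oform (side e f t) (side e f (opp r)) *s side e f s"
    if "r = s \<or> r = t" for r
  proof -
    have "blocks e f N *v side e f (opp r) = (\<Sum>(s', t')\<in>{(s, t)}.
        oform (side e f s') (side e f (opp r)) *s side e f t' - oform (side e f t') (side e f (opp r)) *s side e f s')"
      unfolding blocks_apply
    proof (intro sum.mono_neutral_right fin ballI)
      fix d assume d: "d \<in> N - {(s, t)}"
      obtain s' t' where "d = (s', t')" by (cases d)
      then show "(case d of (s', t') \<Rightarrow> oform (side e f s') (side e f (opp r)) *s side e f t' -
          oform (side e f t') (side e f (opp r)) *s side e f s') = 0"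
        using z[OF _ _ that, of s' t'] d by simp
    qed (use assms(3) in simp)
    then show ?thesis by simp
  qed
  have "s \<noteq> t" "opp s \<noteq> opp t"
    using st by (auto simp: opp_def)
  moreover have "opp t \<noteq> opp s" "t \<noteq> s"
    using calculation by auto
  ultimately show "blocks e f N *v side e f (opp s) = side e f t"
    "blocks e f N *v side e f (opp t) = - side e f s"
    using single[of s] single[of t] oform_side[OF assms(1), of s "opp s"] oform_side[OF assms(1), of t "opp s"]
      oform_side[OF assms(1), of s "opp t"] oform_side[OF assms(1), of t "opp t"] st
    by auto
qed

lemma hyperbolic_independent:
  assumes "hyperbolic I e f"
  shows "inj_on (side e f) (I \<times> UNIV)" "vec.independent (side e f ` (I \<times> UNIV))"
  by (rule half_hyperbolic_independent[OF hyperbolicD(1)[OF assms] hyperbolicD(2)[OF assms]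
        hyperbolicD(4)[OF assms]]; assumption)+

lemma orth_span: "(\<And>u. u \<in> X \<Longrightarrow> oform w u = 0) \<Longrightarrow> w \<in> orth (vec.span X)"
proof -
  assume X: "\<And>u. u \<in> X \<Longrightarrow> oform w u = 0"
  have "vec.span X \<subseteq> orth {w}"
    by (rule vec.span_minimal[OF _ subspace_orth]) (use X in \<open>auto simp: orth_def oform_commute[of _ w]\<close>)
  then show ?thesis
    by (auto simp: orth_def oform_commute[of w])
qed

section \<open>Images of the filtration steps\<close>

context maximal_flag
begin

lemma zero_nilpotent: "(0 :: 'n cmat) \<in> nilpotent2"
  by (simp add: nilpotent2_def orthogonal_lie_iff)

lemma F_subspace: "j \<le> 2 * k + 1 \<Longrightarrow> vec.subspace (F j)"
  using filtered_nilpotent.subspace[OF filtered[OF zero_nilpotent]] .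

lemma F_mono: "i \<le> j \<Longrightarrow> j \<le> 2 * k + 1 \<Longrightarrow> F i \<subseteq> F j"
  using filtered_nilpotent.mono[OF filtered[OF zero_nilpotent]] .

lemma F_isotropic: "u \<in> F i \<Longrightarrow> v \<in> F j \<Longrightarrow> i + j \<le> 2 * k + 1 \<Longrightarrow> oform u v = 0"
  using filtered_nilpotent.isotropic[OF filtered[OF zero_nilpotent]] .

lemma adapted_hyperbolic: "adapted_basis k V e f \<Longrightarrow> hyperbolic (slots k b) e f"
  by (auto simp: adapted_basis_def hyperbolic_def finite_slots)

text \<open>An \<open>f\<close>-vector over vertex \<open>i\<close> is orthogonal to
  \<open>U (i - 1)\<close> and so lies in \<open>F (2 * k + 2 - i)\<close>. The levels of partners
  add up to \<open>2 * k + 2\<close>; level \<open>k + 1\<close> is never taken over a slot.\<close>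

definition level :: "(nat \<times> nat) \<times> bool \<Rightarrow> nat" where
  "level s = (if snd s then fst (fst s) else 2 * k + 2 - fst (fst s))"

lemma level_bounds: "fst s \<in> slots k b \<Longrightarrow> 1 \<le> level s \<and> level s \<le> 2 * k + 1"
  by (auto simp: slots_def level_def)

lemma level_opp: "fst s \<in> slots k b \<Longrightarrow> level (opp s) = 2 * k + 2 - level s"
  by (auto simp: slots_def level_def opp_def)

lemma side_in_F:
  assumes "adapted_basis k V e f" "fst s \<in> slots k b"
  shows "side e f s \<in> F (level s)"
proof -
  define i where "i = fst (fst s)"
  have i: "1 \<le> i" "i \<le> k"
    using assms(2) by (auto simp: slots_def i_def)
  have V: "V j = vec.span (e ` slots j b)" if "1 \<le> j" "j \<le> k" for j
    using assms(1) that by (auto simp: adapted_basis_def)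
  show ?thesis
  proof (cases "snd s")
    case True
    have "fst s \<in> slots i b"
      using assms(2) by (auto simp: slots_def i_def)
    then have "e (fst s) \<in> V i"
      unfolding V[OF i] by (intro vec.span_base) simp
    then show ?thesis
      using True i by (simp add: side_def level_def F_def U_def i_def)
  next
    case False
    have "f (fst s) \<in> orth (U (i - 1))"
    proof (cases "i - 1 = 0")
      case True
      then show ?thesis by (simp add: U_def orth_def)
    next
      case False
      have "f (fst s) \<in> orth (vec.span (e ` slots (i - 1) b))"
      proof (rule orth_span)
        fix u assume "u \<in> e ` slots (i - 1) b"
        then obtain q where q: "u = e q" "q \<in> slots (i - 1) b"
          by auto
        then have "q \<in> slots k b" "fst q \<le> i - 1"
          using i by (auto simp: slots_def)
        then have "q \<in> slots k b" "q \<noteq> fst s"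
          using i by (auto simp: i_def)
        then show "oform (f (fst s)) u = 0"
          using hyperbolicD(5)[OF adapted_hyperbolic[OF assms(1)] assms(2)] q(1) by simp
      qed
      then show ?thesis
        using V[of "i - 1"] False i by (simp add: U_def)
    qed
    moreover have "2 * k + 1 - (2 * k + 2 - i) = i - 1" "\<not> 2 * k + 2 - i \<le> k"
      using i by linarith+
    ultimately show ?thesis
      using False by (simp add: side_def level_def F_def i_def[symmetric])
  qed
qed

text \<open>The coefficient of \<open>side e f t\<close> is read off by pairing with the partner of
  \<open>t\<close>. If \<open>level t\<close> exceeds \<open>c\<close>, this partner lies in a step
  orthogonal to \<open>F c\<close>.\<close>

lemma span_inter_F:
  assumes "adapted_basis k V e f" "fst ` T \<subseteq> slots k b" "c \<le> 2 * k + 1"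
  shows "vec.span (side e f ` T) \<inter> F c = vec.span (side e f ` {t \<in> T. level t \<le> c})"
proof
  note hyp = adapted_hyperbolic[OF assms(1)]
  have sub: "T \<subseteq> slots k b \<times> UNIV"
    using assms(2) by force
  have fin: "finite T"
    by (rule finite_subset[OF sub]) (simp add: finite_slots)
  have inj: "inj_on (side e f) T"
    by (rule inj_on_subset[OF hyperbolic_independent(1)[OF hyp] sub])
  show "vec.span (side e f ` {t \<in> T. level t \<le> c}) \<subseteq> vec.span (side e f ` T) \<inter> F c"
  proof (rule Int_greatest)
    show "vec.span (side e f ` {t \<in> T. level t \<le> c}) \<subseteq> vec.span (side e f ` T)"
      by (rule vec.span_mono) auto
    have "side e f t \<in> F c" if "t \<in> T" "level t \<le> c" for t
      using side_in_F[OF assms(1), of t] F_mono[OF that(2) assms(3)] that assms(2) by auto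
    then show "vec.span (side e f ` {t \<in> T. level t \<le> c}) \<subseteq> F c"
      by (intro vec.span_minimal F_subspace assms(3)) auto
  qed
  show "vec.span (side e f ` T) \<inter> F c \<subseteq> vec.span (side e f ` {t \<in> T. level t \<le> c})"
  proof
    fix w assume w: "w \<in> vec.span (side e f ` T) \<inter> F c"
    obtain g where "w = (\<Sum>v\<in>side e f ` T. g v *s v)"
      using w vec.span_finite[of "side e f ` T"] fin by auto
    then have wsum: "w = (\<Sum>t\<in>T. g (side e f t) *s side e f t)"
      by (simp add: sum.reindex[OF inj])
    have coeff: "g (side e f t) = 0" if t: "t \<in> T" "\<not> level t \<le> c" for t
    proof -
      have ts: "fst t \<in> slots k b"
        using assms(2) t by auto
      have eq: "oform (side e f r) (side e f (opp t)) = (if r = t then 1 else 0)" if "r \<in> T" for r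
        using oform_side[OF hyp, of r "opp t"] that assms(2) ts by (auto simp: opp_def prod_eq_iff)
      have "oform w (side e f (opp t)) = g (side e f t)"
        unfolding wsum oform_sum_left using t(1) fin
        by (simp add: oform_linear eq if_distrib[of "\<lambda>x. _ * x"] cong: if_cong)
      moreover have "oform w (side e f (opp t)) = 0"
      proof (rule F_isotropic)
        show "w \<in> F c" using w by simp
        show "side e f (opp t) \<in> F (level (opp t))"
          using side_in_F[OF assms(1), of "opp t"] ts by simp
        show "c + level (opp t) \<le> 2 * k + 1"
          using t level_bounds[OF ts] level_opp[OF ts] by simp
      qed
      ultimately show ?thesis by simp
    qed
    have "g (side e f t) *s side e f t \<in> vec.span (side e f ` {t \<in> T. level t \<le> c})" if "t \<in> T" for t
      using that coeff[OF that] vec.span_base[of "side e f t" "side e f ` {t \<in> T. level t \<le> c}"]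
      by (cases "level t \<le> c") (auto intro: vec.span_scale simp: vec.span_zero)
    then show "w \<in> vec.span (side e f ` {t \<in> T. level t \<le> c})"
      unfolding wsum by (rule vec.span_sum)
  qed
qed

text \<open>A pair \<open>(s, t)\<close> sends \<open>opp s\<close> to \<open>t\<close> and
  \<open>opp t\<close> to minus \<open>s\<close>. The set collects the sides hit, up to sign, from
  sides of level at most \<open>a\<close>.\<close>

definition reached :: "(((nat \<times> nat) \<times> bool) \<times> ((nat \<times> nat) \<times> bool)) set \<Rightarrow> nat \<Rightarrow>
    ((nat \<times> nat) \<times> bool) set" where
  "reached N a = snd ` {d \<in> N. level (opp (fst d)) \<le> a} \<union> fst ` {d \<in> N. level (opp (snd d)) \<le> a}"

text \<open>For the inclusion into the span, vectors of \<open>F a\<close> are only paired with the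
  sides, never expanded in a basis of \<open>F a\<close>. The vector completing the basis in odd
  dimension thus never appears.\<close>

lemma image_F:
  assumes "adapted_basis k V e f" "matching (slots k b) N" "a \<le> 2 * k + 1"
  shows "(*v) (blocks e f N) ` F a = vec.span (side e f ` reached N a)"
proof
  note hyp = adapted_hyperbolic[OF assms(1)]
  let ?S = "vec.span (side e f ` reached N a)"
  have slot: "fst s \<in> slots k b" "fst t \<in> slots k b" if "(s, t) \<in> N" for s t
    using matchingD[OF assms(2) that] by auto
  show "(*v) (blocks e f N) ` F a \<subseteq> ?S"
  proof
    fix z assume "z \<in> (*v) (blocks e f N) ` F a"
    then obtain w where w: "w \<in> F a" "z = blocks e f N *v w"
      by auto
    have z: "oform (side e f s) w = 0" if "fst s \<in> slots k b" "\<not> level (opp s) \<le> a" for s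
    proof (rule F_isotropic[OF side_in_F[OF assms(1) that(1)] w(1)])
      show "level s + a \<le> 2 * k + 1"
        using that(2) level_bounds[OF that(1)] level_opp[OF that(1)] by simp
    qed
    have "oform (side e f s) w *s side e f t - oform (side e f t) w *s side e f s \<in> ?S"
      if st: "(s, t) \<in> N" for s t
    proof (rule vec.span_diff)
      show "oform (side e f s) w *s side e f t \<in> ?S"
      proof (cases "level (opp s) \<le> a")
        case True
        then have "t \<in> reached N a"
          using st by (force simp: reached_def)
        then show ?thesis
          by (intro vec.span_scale vec.span_base) simp
      next
        case False
        then show ?thesis using z[OF slot(1)[OF st]] by (simp add: vec.span_zero)
      qed
      show "oform (side e f t) w *s side e f s \<in> ?S"
      proof (cases "level (opp t) \<le> a")
        case True
        then have "s \<in> reached N a"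
          using st by (force simp: reached_def)
        then show ?thesis
          by (intro vec.span_scale vec.span_base) simp
      next
        case False
        then show ?thesis using z[OF slot(2)[OF st]] by (simp add: vec.span_zero)
      qed
    qed
    then show "z \<in> ?S"
      unfolding w(2) blocks_apply by (intro vec.span_sum) auto
  qed
  have sub: "vec.subspace ((*v) (blocks e f N) ` F a)"
    by (intro vec.subspace_image F_subspace assms(3))
  show "?S \<subseteq> (*v) (blocks e f N) ` F a"
  proof (rule vec.span_minimal[OF _ sub])
    show "side e f ` reached N a \<subseteq> (*v) (blocks e f N) ` F a"
    proof
      fix z assume "z \<in> side e f ` reached N a"
      then consider s t where "(s, t) \<in> N" "level (opp s) \<le> a" "z = side e f t"
        | s t where "(s, t) \<in> N" "level (opp t) \<le> a" "z = side e f s"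
        by (auto simp: reached_def)
      then show "z \<in> (*v) (blocks e f N) ` F a"
      proof cases
        case 1
        have "side e f (opp s) \<in> F a"
          using side_in_F[OF assms(1), of "opp s"] slot[OF 1(1)] F_mono[OF 1(2) assms(3)] by auto
        then show ?thesis
          using blocks_side(1)[OF hyp assms(2) 1(1)] 1(3) by (metis imageI)
      next
        case 2
        have "side e f (opp t) \<in> F a"
          using side_in_F[OF assms(1), of "opp t"] slot[OF 2(1)] F_mono[OF 2(2) assms(3)] by auto
        then have "- side e f s \<in> (*v) (blocks e f N) ` F a"
          using blocks_side(2)[OF hyp assms(2) 2(1)] by (metis imageI)
        then have "- (- side e f s) \<in> (*v) (blocks e f N) ` F a"
          by (rule vec.subspace_neg[OF sub])
        then show ?thesis using 2(3) by simp
      qed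
    qed
  qed
qed

text \<open>An element of \<open>N\<close> may contribute to both summands, once for each end;
  disjointness of slots excludes any other coincidence.\<close>

lemma card_reached:
  assumes "matching (slots k b) N"
  shows "card {t \<in> reached N a. level t \<le> c} =
    card {d \<in> N. level (opp (fst d)) \<le> a \<and> level (snd d) \<le> c} +
    card {d \<in> N. level (opp (snd d)) \<le> a \<and> level (fst d) \<le> c}"
proof -
  have fin: "finite N"
    using assms by (simp add: matching_def)
  let ?A = "{d \<in> N. level (opp (fst d)) \<le> a \<and> level (snd d) \<le> c}"
  let ?B = "{d \<in> N. level (opp (snd d)) \<le> a \<and> level (fst d) \<le> c}"
  have apart: "fst (fst d) \<noteq> fst (fst d')" "fst (snd d) \<noteq> fst (snd d')" "fst (fst d) \<noteq> fst (snd d')"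
    if "d \<in> N" "d' \<in> N" "d \<noteq> d'" for d d'
    using matching_disjoint[OF assms, of "fst d" "snd d" "fst d'" "snd d'"] that by auto
  have self: "fst (fst d) \<noteq> fst (snd d)" if "d \<in> N" for d
    using matchingD(3)[OF assms, of "fst d" "snd d"] that by simp
  have "{t \<in> reached N a. level t \<le> c} = snd ` ?A \<union> fst ` ?B"
    by (auto simp: reached_def)
  moreover have "inj_on snd ?A"
  proof (rule inj_onI, rule ccontr)
    fix d d' assume "d \<in> ?A" "d' \<in> ?A" "snd d = snd d'" "d \<noteq> d'"
    then show False
      using apart(2)[of d d'] by simp
  qed
  moreover have "inj_on fst ?B"
  proof (rule inj_onI, rule ccontr)
    fix d d' assume "d \<in> ?B" "d' \<in> ?B" "fst d = fst d'" "d \<noteq> d'"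
    then show False
      using apart(1)[of d d'] by simp
  qed
  moreover have "snd ` ?A \<inter> fst ` ?B = {}"
  proof (rule ccontr)
    assume "snd ` ?A \<inter> fst ` ?B \<noteq> {}"
    then obtain z where z: "z \<in> snd ` ?A" "z \<in> fst ` ?B"
      by blast
    from z(1) obtain d where d: "d \<in> N" "z = snd d"
      by blast
    from z(2) obtain d' where d': "d' \<in> N" "z = fst d'"
      by blast
    show False
    proof (cases "d = d'")
      case True
      then show False using self[OF d(1)] d(2) d'(2) by simp
    next
      case False
      then show False using apart(3)[OF d'(1) d(1)] d(2) d'(2) by simp
    qed
  qed
  ultimately show ?thesis
    using fin by (simp add: card_Un_disjoint card_image)
qed

section \<open>Links determined by the levels of their ends\<close>

definition source_level :: "link \<Rightarrow> nat" where
  "source_level L = (if fst (end_kinds L) then source L else 2 * k + 2 - source L)"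

definition target_level :: "link \<Rightarrow> nat" where
  "target_level L = (if snd (end_kinds L) then target L else 2 * k + 2 - target L)"

abbreviation opposite_level :: "nat \<Rightarrow> nat" where
  "opposite_level a \<equiv> 2 * k + 2 - a"

text \<open>An end of a link has the same level in every drawing, so the right-hand side depends on
  \<open>E\<close> alone, whereas the left-hand side depends on \<open>x\<close> and the
  flag.\<close>

lemma pattern_dimension:
  assumes "has_pattern k V x E" "a \<le> 2 * k + 1" "c \<le> 2 * k + 1"
  shows "vec.dim ((*v) x ` F a \<inter> F c) =
    size {#L \<in># E. opposite_level (source_level L) \<le> a \<and> target_level L \<le> c#} +
    size {#L \<in># E. opposite_level (target_level L) \<le> a \<and> source_level L \<le> c#}"
proof -
  obtain e f D where ef: "adapted_basis k V e f" and D: "drawing k b E D"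
    and x: "x = (\<Sum>(L, p, q)\<in>D. link_block e f L p q)"
    using assms(1) unfolding has_pattern_def by blast
  let ?N = "to_match ` D"
  note match = drawing_matching[OF D]
  note hyp = adapted_hyperbolic[OF ef]
  have slots: "reached ?N a \<subseteq> slots k b \<times> UNIV"
  proof
    fix t assume "t \<in> reached ?N a"
    then obtain d where d: "d \<in> ?N" "t = fst d \<or> t = snd d"
      unfolding reached_def by blast
    then show "t \<in> slots k b \<times> UNIV"
      using matchingD[OF match, of "fst d" "snd d"] by (auto simp: mem_Times_iff)
  qed
  let ?T = "{t \<in> reached ?N a. level t \<le> c}"
  have "(*v) x ` F a \<inter> F c = vec.span (side e f ` ?T)"
    unfolding x pattern_blocks[OF D] image_F[OF ef match assms(2)]
    by (rule span_inter_F[OF ef _ assms(3)]) (use image_mono[OF slots, of fst] in auto)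
  moreover have "inj_on (side e f) ?T" "vec.independent (side e f ` ?T)"
    by (rule inj_on_subset[OF hyperbolic_independent(1)[OF hyp]],
        use slots in force,
        rule vec.independent_mono[OF hyperbolic_independent(2)[OF hyp]],
        use slots in force)
  ultimately have "vec.dim ((*v) x ` F a \<inter> F c) = card ?T"
    by (simp add: vec.dim_eq_card_independent card_image)
  also have "\<dots> = card {d \<in> ?N. level (opp (fst d)) \<le> a \<and> level (snd d) \<le> c} +
    card {d \<in> ?N. level (opp (snd d)) \<le> a \<and> level (fst d) \<le> c}"
    by (rule card_reached[OF match])
  also have "\<dots> = size {#L \<in># E. opposite_level (source_level L) \<le> a \<and> target_level L \<le> c#} +
    size {#L \<in># E. opposite_level (target_level L) \<le> a \<and> source_level L \<le> c#}"
  proof -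
    have count: "card {d \<in> ?N. Q d} = size {#L \<in># E. Q' L#}"
      if Q: "\<And>L p q. (L, p, q) \<in> D \<Longrightarrow> Q (to_match (L, p, q)) = Q' L" for Q Q'
    proof -
      have "{d \<in> ?N. Q d} = to_match ` {d \<in> D. Q' (fst d)}"
        using Q by auto
      then have "card {d \<in> ?N. Q d} = card {d \<in> D. Q' (fst d)}"
        using card_image[OF inj_on_subset[OF drawing_inj[OF D]]] by fastforce
      also have "\<dots> = size (filter_mset Q' (image_mset fst (mset_set D)))"
        using drawing_finite[OF D] by (simp add: filter_mset_image_mset)
      also have "image_mset fst (mset_set D) = E"
        by (rule drawing_image[OF D])
      finally show ?thesis .
    qed
    have lv: "level (fst (to_match (L, p, q))) = source_level L" "level (snd (to_match (L, p, q))) = target_level L"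
      "level (opp (fst (to_match (L, p, q)))) = opposite_level (source_level L)"
      "level (opp (snd (to_match (L, p, q)))) = opposite_level (target_level L)"
      if d: "(L, p, q) \<in> D" for L p q
    proof -
      note dd = drawingD[OF D d]
      show 1: "level (fst (to_match (L, p, q))) = source_level L" "level (snd (to_match (L, p, q))) = target_level L"
        using dd by (simp_all add: to_match_def level_def source_level_def target_level_def)
      show "level (opp (fst (to_match (L, p, q)))) = opposite_level (source_level L)"
        "level (opp (snd (to_match (L, p, q)))) = opposite_level (target_level L)"
        using 1 level_opp[of "fst (to_match (L, p, q))"] level_opp[of "snd (to_match (L, p, q))"] dd
        by (simp_all add: to_match_def)
    qed
    show ?thesis
      by (intro arg_cong2[of _ _ _ _ "(+)"] count) (simp_all add: lv)
  qed
  finally show ?thesis .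
qed

text \<open>Inclusion and exclusion for a cumulative count in two variables, stated in the integers
  because of the subtractions. As \<open>a\<close> and \<open>c\<close> are positive,
  \<open>a - 1\<close> and \<open>c - 1\<close> are true predecessors.\<close>

lemma size_filter_difference:
  fixes \<alpha> \<beta> :: "'l \<Rightarrow> nat" and E :: "'l multiset"
  defines "r \<equiv> \<lambda>a c. int (size {#L \<in># E. \<alpha> L \<le> a \<and> \<beta> L \<le> c#})"
  assumes "1 \<le> a" "1 \<le> c"
  shows "int (size {#L \<in># E. \<alpha> L = a \<and> \<beta> L = c#}) = r a c - r (a - 1) c - r a (c - 1) + r (a - 1) (c - 1)"
  unfolding r_def using assms(2,3) by (induction E) auto

text \<open>Levels up to \<open>k\<close> belong to \<open>e\<close>-ends and levels from
  \<open>k + 2\<close> on to \<open>f\<close>-ends, so the two levels reveal the kinds and the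
  vertices of both ends.\<close>

lemma link_levels_inj:
  assumes "wf_link k L" "wf_link k L'" "source_level L = source_level L'" "target_level L = target_level L'"
  shows "L = L'"
  using assms
  by (cases L rule: end_kinds.cases; cases L' rule: end_kinds.cases)
     (auto simp: source_level_def target_level_def split: if_splits)

definition dot_loop :: "link \<Rightarrow> bool" where
  "dot_loop L \<longleftrightarrow> (\<exists>r i. L = DotLoop r i)"

text \<open>For a well-formed link \<open>source_level\<close> is at least
  \<open>target_level\<close>, with equality exactly for dotted loops. Levels can therefore agree
  after an exchange of the ends only in the case of equality.\<close>

lemma link_levels_dual:
  assumes "wf_link k L" "wf_link k L'"
  shows "opposite_level (target_level L) = opposite_level (source_level L') \<and> source_level L = target_level L' \<longleftrightarrow>
    L = L' \<and> dot_loop L'"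
  using assms
  by (cases L rule: end_kinds.cases; cases L' rule: end_kinds.cases)
     (auto simp: source_level_def target_level_def dot_loop_def split: if_splits)

lemma link_level_bounds:
  assumes "wf_link k L"
  shows "1 \<le> source_level L \<and> source_level L \<le> 2 * k + 1" "1 \<le> target_level L \<and> target_level L \<le> 2 * k + 1"
  using assms by (cases L rule: end_kinds.cases; auto simp: source_level_def target_level_def)+

lemma pattern_unique:
  assumes "has_pattern k V x E" "has_pattern k V x E'"
    "\<forall>L\<in>#E. wf_link k L" "\<forall>L\<in>#E'. wf_link k L"
  shows "E = E'"
proof (rule multiset_eqI)
  fix L0
  define n where "n E a c = size {#L \<in># E. opposite_level (source_level L) = a \<and> target_level L = c#} +
    size {#L \<in># E. opposite_level (target_level L) = a \<and> source_level L = c#}" for E a c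
  have int_n: "int (n A a c) =
      int (vec.dim ((*v) x ` F a \<inter> F c)) - int (vec.dim ((*v) x ` F (a - 1) \<inter> F c)) -
      int (vec.dim ((*v) x ` F a \<inter> F (c - 1))) + int (vec.dim ((*v) x ` F (a - 1) \<inter> F (c - 1)))"
    if "has_pattern k V x A" "1 \<le> a" "a \<le> 2 * k + 1" "1 \<le> c" "c \<le> 2 * k + 1" for A a c
    unfolding n_def of_nat_add size_filter_difference[OF that(2,4)]
    using that by (simp add: pattern_dimension)
  show "count E L0 = count E' L0"
  proof (cases "wf_link k L0")
    case False
    then have "L0 \<notin># E" "L0 \<notin># E'"
      using assms by auto
    then show ?thesis
      by (simp add: not_in_iff)
  next
    case True
    \<comment> \<open>The block of \<open>L0\<close> sends a basis vector of level \<open>a\<close>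
      to one of level \<open>c\<close>.\<close>
    define a c where "a = opposite_level (source_level L0)" and "c = target_level L0"
    have bounds: "1 \<le> a" "a \<le> 2 * k + 1" "1 \<le> c" "c \<le> 2 * k + 1"
      using link_level_bounds[OF True] by (auto simp: a_def c_def)
    \<comment> \<open>The factor 2 arises because a dotted loop is counted by both summands of
      \<open>n\<close>; any other link is counted by the first alone.\<close>
    have count: "n A a c = (if dot_loop L0 then 2 else 1) * count A L0" if A: "\<forall>L\<in>#A. wf_link k L" for A
    proof -
      have 1: "{#L \<in># A. opposite_level (source_level L) = a \<and> target_level L = c#} = {#L \<in># A. L = L0#}"
      proof (rule filter_mset_cong[OF refl])
        fix L assume "L \<in># A"
        then have wf: "wf_link k L"
          using A by blast
        show "(opposite_level (source_level L) = a \<and> target_level L = c) = (L = L0)"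
          using link_levels_inj[OF wf True] link_level_bounds[OF wf] link_level_bounds[OF True]
          by (auto simp: a_def c_def)
      qed
      have 2: "{#L \<in># A. opposite_level (target_level L) = a \<and> source_level L = c#} =
          {#L \<in># A. L = L0 \<and> dot_loop L0#}"
      proof (rule filter_mset_cong[OF refl])
        fix L assume "L \<in># A"
        then have wf: "wf_link k L"
          using A by blast
        show "(opposite_level (target_level L) = a \<and> source_level L = c) = (L = L0 \<and> dot_loop L0)"
          unfolding a_def c_def by (rule link_levels_dual[OF wf True])
      qed
      have "{#L \<in># A. L = L0#} = replicate_mset (count A L0) L0"
        by (rule filter_eq_replicate_mset)
      then show ?thesis
        unfolding n_def 1 2 by auto
    qed
    have "n E a c = n E' a c"
      using int_n[OF assms(1) bounds] int_n[OF assms(2) bounds] by linarith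
    then show ?thesis
      unfolding count[OF assms(3)] count[OF assms(4)] by (simp split: if_splits)
  qed
qed

end

section \<open>Change of adapted basis\<close>

lemma wedge_conjugate:
  assumes "A \<in> orthogonal_group"
  shows "A ** wedge u v = wedge (A *v u) (A *v v) ** A"
  using assms
  by (simp add: matrix_eq wedge_apply matrix_vector_mul_assoc[symmetric] vec.diff vec.scale
      orthogonal_group_iff)

lemma blocks_conjugate:
  assumes "A \<in> orthogonal_group" "matching I N"
    "\<And>p. p \<in> I \<Longrightarrow> A *v e p = e' p" "\<And>p. p \<in> I \<Longrightarrow> A *v f p = f' p"
  shows "A ** blocks e f N = blocks e' f' N ** A"
proof -
  have "A *v (blocks e f N *v w) = blocks e' f' N *v (A *v w)" for w
  proof -
    have "A *v (blocks e f N *v w) = (\<Sum>(s, t)\<in>N. A *v (wedge (side e f s) (side e f t) *v w))"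
      by (simp add: blocks_def sum_matrix_apply vec.sum case_prod_unfold)
    also have "\<dots> = (\<Sum>(s, t)\<in>N. wedge (side e' f' s) (side e' f' t) *v (A *v w))"
    proof (intro sum.cong refl)
      fix d assume d: "d \<in> N"
      obtain s t where st: "d = (s, t)" by (cases d)
      have "A *v side e f s = side e' f' s" "A *v side e f t = side e' f' t"
        using matchingD[OF assms(2) d[unfolded st]] assms(3,4) by (auto simp: side_def)
      moreover have "A *v (wedge (side e f s) (side e f t) *v w) =
          wedge (A *v side e f s) (A *v side e f t) *v (A *v w)"
        unfolding matrix_vector_mul_assoc wedge_conjugate[OF assms(1)] ..
      ultimately show "(case d of (s, t) \<Rightarrow> A *v (wedge (side e f s) (side e f t) *v w)) =
          (case d of (s, t) \<Rightarrow> wedge (side e' f' s) (side e' f' t) *v (A *v w))"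
        by (simp add: st)
    qed
    also have "\<dots> = blocks e' f' N *v (A *v w)"
      by (simp add: blocks_def sum_matrix_apply case_prod_unfold)
    finally show ?thesis .
  qed
  then show ?thesis
    by (simp add: matrix_eq matrix_vector_mul_assoc[symmetric])
qed

text \<open>The image lies in the span of the matched sides. No two of these are partners, since a
  slot is used by one side only; so every block kills this span.\<close>

lemma matching_nilpotent:
  assumes "hyperbolic I e f" "matching I N"
  shows "blocks e f N \<in> nilpotent2"
proof -
  have "blocks e f N \<in> orthogonal_lie"
    unfolding blocks_def by (rule lie_sum) (auto simp: wedge_lie)
  moreover have "blocks e f N *v (blocks e f N *v w) = 0" for w
  proof -
    have zero: "blocks e f N *v side e f r = 0" if st: "(s, t) \<in> N" "r = s \<or> r = t" for s t r
    proof -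
      have rI: "fst r \<in> I"
        using matchingD[OF assms(2) st(1)] st(2) by auto
      have "oform (side e f s') (side e f r) = 0 \<and> oform (side e f t') (side e f r) = 0"
        if st': "(s', t') \<in> N" for s' t'
      proof -
        have I: "fst s' \<in> I" "fst t' \<in> I" "fst s \<noteq> fst t"
          using matchingD[OF assms(2) st'] matchingD[OF assms(2) st(1)] by auto
        have "r \<noteq> opp s' \<and> r \<noteq> opp t'"
        proof (cases "(s', t') = (s, t)")
          case True
          have "s \<noteq> opp s" "t \<noteq> opp t"
            by (simp_all add: opp_def prod_eq_iff)
          then show ?thesis
            using st(2) I(3) True by (metis fst_opp prod.inject)
        next
          case False
          then have "{fst s, fst t} \<inter> {fst s', fst t'} = {}"
            using matching_disjoint[OF assms(2) st(1) st'] by auto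
          then show ?thesis
            using st(2) by (auto simp: opp_def)
        qed
        then show ?thesis
          using oform_side[OF assms(1) I(1) rI] oform_side[OF assms(1) I(2) rI] by simp
      qed
      then show ?thesis
        unfolding blocks_apply by (intro sum.neutral) auto
    qed
    have "blocks e f N *v (case d of (s, t) \<Rightarrow> oform (side e f s) w *s side e f t - oform (side e f t) w *s side e f s) = 0"
      if d: "d \<in> N" for d
    proof -
      obtain s t where st: "d = (s, t)" by (cases d)
      show ?thesis
        using zero[OF d[unfolded st], of s] zero[OF d[unfolded st], of t]
        by (simp add: st vec.diff vec.scale)
    qed
    then show ?thesis
      unfolding blocks_apply[of e f N w] vec.sum by (intro sum.neutral) blast
  qed
  ultimately show ?thesis
    by (simp add: nilpotent2_def matrix_eq matrix_vector_mul_assoc[symmetric])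
qed

lemma conjugation_iff:
  assumes "invertible A"
  shows "conjugation A x = y \<longleftrightarrow> A ** x = y ** A"
proof
  assume "conjugation A x = y"
  then have "y ** A = A ** x ** matrix_inv A ** A"
    by (simp add: conjugation_def)
  also have "\<dots> = A ** x ** (matrix_inv A ** A)"
    by (simp only: matrix_mul_assoc)
  finally show "A ** x = y ** A"
    by (simp add: matrix_inv_invertible[OF assms])
next
  assume "A ** x = y ** A"
  then have "conjugation A x = y ** (A ** matrix_inv A)"
    by (simp only: conjugation_def matrix_mul_assoc)
  then show "conjugation A x = y"
    by (simp add: matrix_inv_invertible[OF assms])
qed

section \<open>Coordinates in a hyperbolic system\<close>

definition expansion :: "'i set \<Rightarrow> ('i \<Rightarrow> 'n::{finite,linorder} cvec) \<Rightarrow> ('i \<Rightarrow> 'n cvec) \<Rightarrow> 'n cvec \<Rightarrow>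
    ('i \<Rightarrow> complex) \<Rightarrow> ('i \<Rightarrow> complex) \<Rightarrow> complex \<Rightarrow> 'n cvec" where
  "expansion I e f g a b c = (\<Sum>p\<in>I. a p *s e p + b p *s f p) + c *s g"

lemma oform_expansion:
  assumes "hyperbolic I e f" "\<forall>p\<in>I. oform g (e p) = 0 \<and> oform g (f p) = 0"
  shows "p \<in> I \<Longrightarrow> oform (e p) (expansion I e f g a b c) = b p"
    "p \<in> I \<Longrightarrow> oform (f p) (expansion I e f g a b c) = a p"
    "oform g (expansion I e f g a b c) = c * oform g g"
    "oform (expansion I e f g a b c) (expansion I e f g a' b' c') =
      (\<Sum>p\<in>I. a p * b' p + b p * a' p) + c * c' * oform g g"
proof -
  have comm: "oform (e p) g = 0" "oform (f p) g = 0" if "p \<in> I" for p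
    using assms(2) that oform_commute by metis+
  note fin = hyperbolicD(1)[OF assms(1)]
  show 1: "oform (e p) (expansion I e f g a b c) = b p" if "p \<in> I" for p a b c
    using that fin by (simp add: expansion_def oform_linear oform_sum_right hyperbolicD[OF assms(1)] comm
        if_distrib[of "\<lambda>x. _ * x"] cong: if_cong)
  show 2: "oform (f p) (expansion I e f g a b c) = a p" if "p \<in> I" for p a b c
    using that fin by (simp add: expansion_def oform_linear oform_sum_right hyperbolicD[OF assms(1)] comm
        if_distrib[of "\<lambda>x. _ * x"] cong: if_cong)
  show 3: "oform g (expansion I e f g a b c) = c * oform g g" for a b c
    using assms(2) by (simp add: expansion_def oform_linear oform_sum_right)
  have "oform (expansion I e f g a b c) z = (\<Sum>p\<in>I. a p * oform (e p) z + b p * oform (f p) z) + c * oform g z" for z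
    by (simp add: expansion_def oform_linear oform_sum_left)
  then show "oform (expansion I e f g a b c) (expansion I e f g a' b' c') =
      (\<Sum>p\<in>I. a p * b' p + b p * a' p) + c * c' * oform g g"
    by (simp add: 1 2 3 mult.assoc)
qed

lemma span_orthogonal_zero:
  assumes "vec.span B = UNIV" "\<And>u. u \<in> B \<Longrightarrow> oform w u = 0"
  shows "w = 0"
  using orth_span[of B w] assms oform_nondegenerate[of w] by (auto simp: orth_def)

lemma span_independent_card:
  fixes B :: "'n::finite cvec set"
  assumes "vec.independent B" "card B = CARD('n)"
  shows "vec.span B = UNIV"
  using vec.dim_eq_full[of B] vec.dim_eq_card_independent[OF assms(1)] assms(2)
  by (simp add: vec.dimension_def card_cart_basis)

text \<open>The vector \<open>g\<close> spans the one-dimensional orthogonal complement of a maximal hyperbolic system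
  in odd dimension; in even dimension it is \<open>0\<close>.\<close>

lemma completing_vector:
  fixes e f :: "'i \<Rightarrow> 'n::{finite,linorder} cvec"
  assumes "hyperbolic I e f" "CARD('n) = 2 * card I \<or> CARD('n) = 2 * card I + 1"
  obtains g where "\<forall>p\<in>I. oform g (e p) = 0 \<and> oform g (f p) = 0"
    "\<And>w. w = expansion I e f g (\<lambda>p. oform w (f p)) (\<lambda>p. oform w (e p)) (oform w g)"
    "if CARD('n) = 2 * card I then g = 0 else oform g g = 1"
proof -
  let ?B = "side e f ` (I \<times> UNIV)"
  note ind = hyperbolic_independent[OF assms(1)]
  note fin = hyperbolicD(1)[OF assms(1)]
  have card: "card ?B = 2 * card I"
    by (simp add: card_image[OF ind(1)] card_cartesian_product)
  have B: "e p \<in> ?B" "f p \<in> ?B" if "p \<in> I" for p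
    using that by (force simp: side_def image_iff)+
  let ?X = "\<lambda>g w. expansion I e f g (\<lambda>p. oform w (f p)) (\<lambda>p. oform w (e p)) (oform w g)"
  have expand: "w = ?X g w"
    if g: "\<forall>p\<in>I. oform g (e p) = 0 \<and> oform g (f p) = 0" "g = 0 \<or> oform g g = 1"
      and span: "vec.span (insert g ?B) = UNIV" for g w
  proof -
    have "w - ?X g w = 0"
    proof (rule span_orthogonal_zero[OF span])
      fix u assume "u \<in> insert g ?B"
      then consider "u = g" | p where "p \<in> I" "u = e p" | p where "p \<in> I" "u = f p"
        by (auto simp: side_def split: if_splits)
      then show "oform (w - ?X g w) u = 0"
        using oform_expansion[OF assms(1) g(1)] g(2)
        by cases (auto simp: oform_diff_left oform_commute[of "?X g w"])
    qed
    then show ?thesis by simp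
  qed
  show thesis
  proof (cases "CARD('n) = 2 * card I")
    case True
    have "vec.span ?B = UNIV"
      using ind(2) card True by (simp add: span_independent_card)
    then have "vec.span (insert 0 ?B) = UNIV"
      by (simp add: vec.span_insert_0)
    then show thesis
      using that[of 0] expand[of 0] True by simp
  next
    case False
    then have n: "CARD('n) = 2 * card I + 1"
      using assms(2) by simp
    have "vec.span ?B \<noteq> UNIV"
    proof
      assume "vec.span ?B = UNIV"
      then have "vec.dim ?B = CARD('n)"
        by (metis vec.dim_span vec_dim_card)
      then show False
        using ind(2) card n by (simp add: vec.dim_eq_card_independent)
    qed
    then obtain u where u: "u \<notin> vec.span ?B"
      by auto
    let ?pu = "expansion I e f 0 (\<lambda>p. oform u (f p)) (\<lambda>p. oform u (e p)) 0"
    \<comment> \<open>\<open>?pu\<close> is the projection of \<open>u\<close> to the hyperbolic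
      planes, so what is left is orthogonal to all of them.\<close>
    define g0 where "g0 = u - ?pu"
    have pu: "?pu \<in> vec.span ?B"
    proof -
      have "(\<Sum>p\<in>I. oform u (f p) *s e p + oform u (e p) *s f p) \<in> vec.span ?B"
        by (intro vec.span_sum vec.span_add vec.span_scale vec.span_base B)
      then show ?thesis
        by (simp add: expansion_def)
    qed
    have g0: "oform g0 (e p) = 0 \<and> oform g0 (f p) = 0" if "p \<in> I" for p
      using oform_expansion[OF assms(1), of 0] that
      by (simp add: g0_def oform_diff_left oform_commute[of ?pu])
    have g0B: "oform g0 v = 0" if "v \<in> ?B" for v
      using that g0 by (auto simp: side_def split: if_splits)
    have g0_span: "g0 \<notin> vec.span ?B"
    proof
      assume "g0 \<in> vec.span ?B"
      then have "g0 + ?pu \<in> vec.span ?B"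
        by (rule vec.span_add[OF _ pu])
      with u show False
        by (simp add: g0_def)
    qed
    have new: "g0 \<notin> ?B"
      using g0_span vec.span_base[of g0 ?B] by blast
    have ind': "vec.independent (insert g0 ?B)"
      unfolding vec.independent_insert using ind(2) g0_span by simp
    have "card (insert g0 ?B) = CARD('n)"
      using new fin n by (simp add: card)
    then have span: "vec.span (insert g0 ?B) = UNIV"
      by (rule span_independent_card[OF ind'])
    \<comment> \<open>If \<open>g0\<close> were isotropic, it would be orthogonal to a spanning
      set.\<close>
    have "oform g0 g0 \<noteq> 0"
    proof
      assume "oform g0 g0 = 0"
      then have "g0 = 0"
        using g0B by (intro span_orthogonal_zero[OF span]) auto
      then show False
        using g0_span vec.span_zero[of ?B] by blast
    qed
    then have c: "csqrt (oform g0 g0) \<noteq> 0" "csqrt (oform g0 g0) * csqrt (oform g0 g0) = oform g0 g0"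
      by (simp_all add: power2_eq_square[symmetric])
    \<comment> \<open>Normalizing the self-pairing to 1 makes the completing vectors of two bases
      isometric.\<close>
    define g where "g = (1 / csqrt (oform g0 g0)) *s g0"
    have gg: "oform g g = 1"
      using c by (simp add: g_def oform_linear field_simps)
    have g: "oform g (e p) = 0 \<and> oform g (f p) = 0" if "p \<in> I" for p
      using g0[OF that] by (simp add: g_def oform_linear)
    have "g0 = csqrt (oform g0 g0) *s g"
      using c by (simp add: g_def)
    then have "g0 \<in> vec.span (insert g ?B)"
      by (metis insertI1 vec.span_base vec.span_scale)
    then have "vec.span (insert g0 ?B) \<subseteq> vec.span (insert g ?B)"
      by (intro vec.span_minimal) (auto intro: vec.span_base)
    then have "vec.span (insert g ?B) = UNIV"
      using span by auto
    then show thesis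
      using that[of g] g gg expand[of g] False by simp
  qed
qed

text \<open>\<open>E\<close> and \<open>P\<close> are complementary projections, and
  \<open>N\<close> maps the image of \<open>P\<close> into that of \<open>E\<close>, so its square
  is zero. Conjugation by \<open>T\<close>, which is 2 on the image of \<open>E\<close> and 1 on
  that of \<open>P\<close>, doubles \<open>N\<close> and thus turns \<open>mat 1 + N\<close> into
  its square. The determinant equals its own square.\<close>

lemma det_unipotent:
  fixes N :: "'n::finite cmat"
  assumes "\<And>u. E *v u + P *v u = u" "\<And>u. E *v (E *v u) = E *v u"
    "\<And>u. P *v (E *v u) = 0" "\<And>u. E *v (P *v u) = 0"
    "\<And>u. N *v u = E *v (N *v (P *v u))"
  shows "det (mat 1 + N) = 0 \<or> det (mat 1 + N) = 1"
proof -
  have NE: "N *v (E *v u) = 0" for u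
    using assms(5)[of "E *v u"] by (simp add: assms(3))
  have EN: "E *v (N *v u) = N *v u" for u
    using assms(2)[of "N *v (P *v u)"] by (simp only: assms(5)[of u, symmetric])
  have NN: "N *v (N *v u) = 0" for u
    using NE[of "N *v u"] by (simp add: EN)
  have NP: "N *v (P *v u) = N *v u" for u
    using assms(1)[of u] vec.add[of N "E *v u" "P *v u"] by (simp add: NE)
  define T where "T = mat 1 + E"
  \<comment> \<open>Half of \<open>E\<close>, so that \<open>P + H\<close> inverts
    \<open>T\<close>.\<close>
  define H where "H = matrix (\<lambda>u. (1 / 2) *s (E *v u))"
  define T' where "T' = P + H"
  have half: "H *v u = (1 / 2) *s (E *v u)" for u
    unfolding H_def
    by (rule matrix_works) (unfold_locales, simp_all add: vec.add vec.scale vec_eq_iff algebra_simps)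
  note app = matrix_vector_mul_assoc[symmetric] matrix_vector_mult_add_rdistrib half
  have TT: "T ** T' = mat 1"
  proof -
    have "T *v (T' *v u) = u" for u
    proof -
      have T': "T' *v u = P *v u + (1 / 2) *s (E *v u)"
        by (simp only: T'_def app)
      have "T *v (T' *v u) = T' *v u + E *v (T' *v u)"
        by (simp only: T_def app matrix_vector_mul_lid)
      also have "E *v (T' *v u) = (1 / 2) *s (E *v u)"
        by (simp only: T' vec.add vec.scale assms(2,4) add_0_left)
      also have "T' *v u + (1 / 2) *s (E *v u) = E *v u + P *v u"
        unfolding T' by (simp add: vec_eq_iff)
      finally show ?thesis
        by (simp only: assms(1))
    qed
    then show ?thesis
      by (simp add: matrix_eq matrix_vector_mul_assoc[symmetric])
  qed
  have "T ** (mat 1 + N) ** T' = (mat 1 + N) ** (mat 1 + N)"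
  proof -
    have "T *v (T' *v u + N *v (T' *v u)) = u + N *v u + (N *v u + N *v (N *v u))" for u
    proof -
      have "N *v (T' *v u) = N *v u"
        by (simp only: T'_def app vec.add vec.scale NE NP) simp
      moreover have "T *v (T' *v u) = u"
        using TT by (simp add: matrix_vector_mul_assoc)
      moreover have "T *v (N *v u) = N *v u + N *v u"
        by (simp only: T_def app EN matrix_vector_mul_lid)
      ultimately show ?thesis
        by (simp add: vec.add NN)
    qed
    then show ?thesis
      by (simp add: matrix_eq app vec.add)
  qed
  then have "det T * det (mat 1 + N) * det T' = det (mat 1 + N) * det (mat 1 + N)"
    by (metis det_mul)
  moreover have "det T * det T' = 1"
    using TT by (metis det_I det_mul)
  ultimately have "det (mat 1 + N) = det (mat 1 + N) * det (mat 1 + N)"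
    by (metis mult.commute mult.left_commute mult_1_right)
  then show ?thesis
    by simp
qed

text \<open>An orthogonal transformation \<open>A\<close> preserving one Lagrangian subspace has determinant 1: it is the
  product of a block diagonal part, whose two blocks are mutually adjoint inverses, and a
  unipotent part.\<close>

lemma det_stabilizer_lagrangian:
  fixes e f :: "'i \<Rightarrow> 'n::{finite,linorder} cvec"
  assumes "hyperbolic I e f" "CARD('n) = 2 * card I" "A \<in> orthogonal_group"
    "(*v) A ` vec.span (e ` I) = vec.span (e ` I)"
  shows "det A = 1"
proof -
  obtain g where g: "\<And>w. w = expansion I e f g (\<lambda>p. oform w (f p)) (\<lambda>p. oform w (e p)) (oform w g)"
    "if CARD('n) = 2 * card I then g = 0 else oform g g = 1"
    by (rule completing_vector[OF assms(1) disjI1[OF assms(2)]]) blast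
  have "g = 0"
    using g(2) assms(2) by simp
  \<comment> \<open>\<open>E\<close> and \<open>P\<close> project to the spans of the
    \<open>e\<close>- and the \<open>f\<close>-vectors. As both spans are isotropic, the two
    projections are adjoint to each other.\<close>
  define E where "E = matrix (\<lambda>w. \<Sum>p\<in>I. oform w (f p) *s e p)"
  define P where "P = matrix (\<lambda>w. \<Sum>p\<in>I. oform w (e p) *s f p)"
  have E: "E *v w = (\<Sum>p\<in>I. oform w (f p) *s e p)" for w
    unfolding E_def
    by (rule matrix_works) (unfold_locales, simp_all add: oform_linear vec.scale_sum_right
        vec.scale_left_distrib sum.distrib)
  have P: "P *v w = (\<Sum>p\<in>I. oform w (e p) *s f p)" for w
    unfolding P_def
    by (rule matrix_works) (unfold_locales, simp_all add: oform_linear vec.scale_sum_right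
        vec.scale_left_distrib sum.distrib)
  have split: "E *v w + P *v w = w" for w
  proof -
    have "E *v w + P *v w = expansion I e f g (\<lambda>p. oform w (f p)) (\<lambda>p. oform w (e p)) (oform w g)"
      by (simp add: E P expansion_def sum.distrib \<open>g = 0\<close>)
    also have "\<dots> = w"
      by (rule g(1)[symmetric])
    finally show ?thesis .
  qed
  let ?S = "vec.span (e ` I)"
  have PS: "P *v w = 0" if "w \<in> ?S" for w
  proof -
    have "oform (e p) w = 0" if "p \<in> I" for p
      using orth_span[of "e ` I" "e p"] hyperbolicD(2)[OF assms(1) that] \<open>w \<in> ?S\<close> by (auto simp: orth_def)
    then show ?thesis
      unfolding P by (intro sum.neutral) (simp add: oform_commute[of w])
  qed
  have ES: "E *v w \<in> ?S" for w
    unfolding E by (intro vec.span_sum vec.span_scale vec.span_base) auto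
  have EP: "E *v (P *v w) = 0" for w
    unfolding E[of "P *v w"]
  proof (intro sum.neutral ballI)
    fix p assume "p \<in> I"
    then have "oform (P *v w) (f p) = 0"
      by (simp add: P oform_sum_left oform_linear hyperbolicD[OF assms(1)])
    then show "oform (P *v w) (f p) *s e p = 0"
      by simp
  qed
  have PE: "P *v (E *v w) = 0" for w
    by (rule PS[OF ES])
  have EE: "E *v (E *v w) = E *v w" for w
    using split[of "E *v w"] PE[of w] by simp
  have PP: "P *v (P *v w) = P *v w" for w
    using split[of "P *v w"] EP[of w] by simp
  have adjEP: "oform (E *v u) v = oform u (P *v v)" for u v
    by (simp add: E P oform_sum_left oform_sum_right oform_linear oform_commute[of v] mult.commute)
  have adjPE: "oform (P *v u) v = oform u (E *v v)" for u v
    using adjEP[of v u] oform_commute by metis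
  define B where "B = matrix_inv A"
  have inv: "invertible A"
    using assms(3) by (simp add: orthogonal_group_def)
  have AB: "A *v (B *v w) = w" and BA: "B *v (A *v w) = w" for w
    by (simp_all add: matrix_vector_mul_assoc B_def matrix_inv_invertible[OF inv])
  have adjA: "oform (B *v u) v = oform u (A *v v)" for u v
    using assms(3) AB unfolding orthogonal_group_iff by metis
  have AS: "A *v w \<in> ?S" if "w \<in> ?S" for w
    using imageI[OF that, of "(*v) A"] assms(4) by simp
  have BS: "B *v w \<in> ?S" if "w \<in> ?S" for w
  proof -
    have "w \<in> (*v) A ` ?S"
      using that assms(4) by simp
    then obtain v where "v \<in> ?S" "w = A *v v"
      by (elim imageE)
    then show ?thesis by (simp add: BA)
  qed
  have PAE: "P *v (A *v (E *v w)) = 0" for w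
    by (rule PS[OF AS[OF ES]])
  have PBE: "P *v (B *v (E *v w)) = 0" for w
    by (rule PS[OF BS[OF ES]])
  have EAE: "E *v (A *v (E *v w)) = A *v (E *v w)" for w
    using split[of "A *v (E *v w)"] by (simp add: PAE)
  have EBE: "E *v (B *v (E *v w)) = B *v (E *v w)" for w
    using split[of "B *v (E *v w)"] by (simp add: PBE)
  note app = matrix_vector_mul_assoc[symmetric] matrix_vector_mult_add_rdistrib vec.add
  \<comment> \<open>\<open>D1\<close> and \<open>D2\<close> undo the two diagonal blocks of
    \<open>A\<close>. As \<open>D3\<close> is adjoint to \<open>D2\<close> and inverse to
    \<open>D1\<close>, the determinants of \<open>D1\<close> and \<open>D2\<close> multiply to 1.
    \<open>N\<close> is the off-diagonal part that remains.\<close>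
  define D1 where "D1 = E ** B ** E + P"
  define D2 where "D2 = E + P ** B ** P"
  define D3 where "D3 = P + E ** A ** E"
  define N where "N = E ** B ** E ** A ** P"
  have "det D2 = det D3"
    by (rule adjoint_det) (simp add: D2_def D3_def app oform_add_left oform_add_right adjEP adjPE adjA)
  moreover have "D3 ** D1 = mat 1"
  proof -
    have "D3 *v (D1 *v w) = P *v w + E *v w" for w
      by (simp add: D1_def D3_def app EBE PBE PP EP AB EE)
    then show ?thesis
      using split by (simp add: matrix_eq app add.commute)
  qed
  ultimately have d12: "det (D1 ** D2) = 1"
    by (metis det_I det_mul mult.commute)
  have "D1 ** D2 ** A = mat 1 + N"
  proof -
    have 1: "D1 *v (D2 *v (A *v (E *v w))) = E *v w" for w
      by (simp add: D1_def D2_def app EAE PAE BA PE EE)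
    have 2: "D1 *v (D2 *v (A *v (P *v w))) = P *v w + N *v w" for w
    proof -
      have "P *v (B *v (P *v (A *v (P *v w)))) = P *v (B *v (E *v (A *v (P *v w)) + P *v (A *v (P *v w))))"
        by (simp add: app PBE)
      also have "\<dots> = P *v w"
        by (simp add: split BA PP)
      finally have 3: "P *v (B *v (P *v (A *v (P *v w)))) = P *v w" .
      have "D1 *v (D2 *v (A *v (P *v w))) =
          E *v (B *v (E *v (A *v (P *v w)))) + P *v (B *v (P *v (A *v (P *v w))))"
        by (simp add: D1_def D2_def app EP PE EE PP)
      then show ?thesis
        by (simp add: 3 N_def app)
    qed
    have NE: "N *v (E *v w) = 0" for w
      by (simp add: N_def app PE)
    have "D1 *v (D2 *v (A *v w)) = w + N *v w" for w
    proof -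
      have "D1 *v (D2 *v (A *v (E *v w + P *v w))) = (E *v w + P *v w) + N *v (E *v w + P *v w)"
        unfolding vec.add 1 2 NE by (simp add: N_def app PP)
      then show ?thesis
        by (simp only: split)
    qed
    then show ?thesis
      by (simp add: matrix_eq app)
  qed
  then have "det A = det (mat 1 + N)"
    using d12 by (metis det_mul mult_1_left)
  moreover have "det (mat 1 + N) = 0 \<or> det (mat 1 + N) = 1"
    by (rule det_unipotent[OF split EE PE EP]) (simp add: N_def app PP EE)
  \<comment> \<open>Of 0 and 1, only 1 is the determinant of an orthogonal matrix.\<close>
  ultimately show ?thesis
    using det_orthogonal[OF assms(3)] by auto
qed

lemma det_uminus_odd:
  fixes A :: "'n::finite cmat"
  assumes "odd (CARD('n))"
  shows "det (- A) = - det A"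
proof -
  have "- A = (\<chi> i. (- 1) *s (A $ i))"
    by (simp add: vec_eq_iff)
  then have "det (- A) = (\<Prod>i\<in>(UNIV :: 'n set). - 1) * det (\<chi> i. A $ i)"
    using det_rows_mul[of "\<lambda>i. - 1" "\<lambda>i. A $ i"] by simp
  then show ?thesis
    using assms by (simp add: vec_lambda_eta)
qed

lemma uminus_matrix_apply: "(- A) *v u = - (A *v u)"
  for A :: "'n::finite cmat"
  by (simp add: vec_eq_iff matrix_vector_mult_def sum_negf)

section \<open>Maps between adapted bases\<close>

context maximal_flag
begin

lemma adapted_span:
  assumes "adapted_basis k V e f" "i \<in> {1..k}"
  shows "V i = vec.span (e ` slots i b)"
  using assms(1)[unfolded adapted_basis_def, THEN conjunct1] assms(2) by (rule bspec)

lemma card_slots: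
  assumes "adapted_basis k V e f"
  shows "card (slots k b) = l"
proof (cases "k = 0")
  case True
  then show ?thesis
    using maximal by (simp add: slots_def flag_dim_def)
next
  case False
  note ind = hyperbolic_independent[OF adapted_hyperbolic[OF assms]]
  have eq: "e ` slots k b = side e f ` (slots k b \<times> {True})"
  proof -
    have "slots k b \<times> {True} = (\<lambda>p. (p, True)) ` slots k b"
      by auto
    then show ?thesis
      by (simp only: image_image side_def fst_conv snd_conv if_True)
  qed
  have indep: "vec.independent (e ` slots k b)"
    unfolding eq by (rule vec.independent_mono[OF ind(2)]) (rule image_mono, auto)
  have "V k = vec.span (e ` slots k b)"
    by (rule adapted_span[OF assms]) (use False in simp)
  then have "vec.dim (V k) = vec.dim (e ` slots k b)"
    by (simp only: vec.dim_span)
  also have "\<dots> = card (e ` slots k b)"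
    by (rule vec.dim_eq_card_independent[OF indep])
  also have "\<dots> = card (slots k b)"
  proof -
    have "inj_on (side e f) (slots k b \<times> {True})"
      by (rule inj_on_subset[OF ind(1)]) auto
    then have "card (side e f ` (slots k b \<times> {True})) = card (slots k b \<times> {True})"
      by (rule card_image)
    then show ?thesis
      unfolding eq by (simp add: card_cartesian_product)
  qed
  finally show ?thesis
    using maximal False by (simp add: flag_dim_def)
qed

text \<open>The map depends on the two bases only, so a single \<open>A\<close> intertwines the
  blocks of every matching. It keeps coordinates fixed while exchanging the bases and their
  completing vectors.\<close>

lemma adapted_conjugate:
  assumes "adapted_basis k V e f" "adapted_basis k V e' f'"
  shows "\<exists>A\<in>flag_stabilizer k V. \<forall>N. matching (slots k b) N \<longrightarrow> A ** blocks e f N = blocks e' f' N ** A"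
proof -
  let ?I = "slots k b"
  note hyp = adapted_hyperbolic[OF assms(1)] and hyp' = adapted_hyperbolic[OF assms(2)]
  have n: "CARD('n) = 2 * card ?I \<or> CARD('n) = 2 * card ?I + 1"
    using card by (simp add: card_slots[OF assms(1)])
  obtain g where g: "\<forall>p\<in>?I. oform g (e p) = 0 \<and> oform g (f p) = 0"
    "\<And>w. w = expansion ?I e f g (\<lambda>p. oform w (f p)) (\<lambda>p. oform w (e p)) (oform w g)"
    "if CARD('n) = 2 * card ?I then g = 0 else oform g g = 1"
    by (rule completing_vector[OF hyp n]) blast
  obtain g' where g': "\<forall>p\<in>?I. oform g' (e' p) = 0 \<and> oform g' (f' p) = 0"
    "if CARD('n) = 2 * card ?I then g' = 0 else oform g' g' = 1"
    by (rule completing_vector[OF hyp' n]) blast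
  \<comment> \<open>Either both completing vectors are 0 or both have self-pairing 1; without this
    \<open>A\<close> would not be an isometry.\<close>
  have gg: "oform g g = oform g' g'"
    using g(3) g'(2) by (auto split: if_splits)
  let ?A = "\<lambda>w. expansion ?I e' f' g' (\<lambda>p. oform w (f p)) (\<lambda>p. oform w (e p)) (oform w g)"
  define A where "A = matrix ?A"
  have A: "A *v w = ?A w" for w
    unfolding A_def
    by (rule matrix_works) (unfold_locales, simp_all add: expansion_def oform_linear vec.scale_sum_right
        vec.scale_left_distrib vec.scale_right_distrib sum.distrib)
  have orth: "A \<in> orthogonal_group"
    unfolding orthogonal_group_iff
  proof (intro allI)
    fix u v
    have "oform (A *v u) (A *v v) = oform
        (expansion ?I e f g (\<lambda>p. oform u (f p)) (\<lambda>p. oform u (e p)) (oform u g))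
        (expansion ?I e f g (\<lambda>p. oform v (f p)) (\<lambda>p. oform v (e p)) (oform v g))"
      unfolding A oform_expansion(4)[OF hyp' g'(1)] oform_expansion(4)[OF hyp g(1)] gg ..
    then show "oform (A *v u) (A *v v) = oform u v"
      by (simp only: g(2)[symmetric])
  qed
  have Ae: "A *v e p = e' p" and Af: "A *v f p = f' p" if p: "p \<in> ?I" for p
  proof -
    have z: "oform (e p) g = 0" "oform (f p) g = 0"
      using g(1) p oform_commute by metis+
    have "(\<Sum>q\<in>?I. oform (e p) (f q) *s e' q + oform (e p) (e q) *s f' q) =
        (\<Sum>q\<in>?I. if q = p then e' p else 0)"
      by (intro sum.cong refl) (use hyperbolicD[OF hyp] p in auto)
    then show "A *v e p = e' p"
      using p finite_slots by (simp add: A expansion_def z)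
    have "(\<Sum>q\<in>?I. oform (f p) (f q) *s e' q + oform (f p) (e q) *s f' q) =
        (\<Sum>q\<in>?I. if q = p then f' p else 0)"
      by (intro sum.cong refl) (use hyperbolicD[OF hyp] p in auto)
    then show "A *v f p = f' p"
      using p finite_slots by (simp add: A expansion_def z)
  qed
  have stab: "(*v) A ` V i = V i" if i: "i \<in> {1..k}" for i
  proof -
    have sub: "slots i b \<subseteq> ?I"
      using i by (auto simp: slots_def)
    have "(*v) A ` V i = vec.span ((*v) A ` e ` slots i b)"
      unfolding adapted_span[OF assms(1) i] by (rule vec.span_image[symmetric])
    also have "(*v) A ` e ` slots i b = e' ` slots i b"
      unfolding image_image by (rule image_cong[OF refl]) (use Ae sub in blast)
    finally show ?thesis
      by (simp only: adapted_span[OF assms(2) i])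
  qed
  have conj: "A ** blocks e f N = blocks e' f' N ** A" if "matching ?I N" for N
    by (rule blocks_conjugate[OF orth that]) (simp_all add: Ae Af)
  show ?thesis
  proof (cases "det A = 1")
    case True
    then have "A \<in> flag_stabilizer k V"
      using orth stab by (simp add: flag_stabilizer_def special_orthogonal_def)
    then show ?thesis using conj by blast
  next
    case False
    \<comment> \<open>In even dimension \<open>A\<close> preserves the Lagrangian span of the
      \<open>e\<close>-vectors and has determinant 1. In odd dimension \<open>- A\<close> stabilizes
      the same subspaces and intertwines the same blocks.\<close>
    have "CARD('n) \<noteq> 2 * card ?I"
    proof
      assume even: "CARD('n) = 2 * card ?I"
      have "(*v) A ` vec.span (e ` ?I) = vec.span (e ` ?I)"
      proof (cases "k = 0")
        case True
        then show ?thesis by (simp add: slots_def)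
      next
        case False
        then have "k \<in> {1..k}"
          by simp
        then show ?thesis
          using stab[of k] adapted_span[OF assms(1), of k] by (simp only:)
      qed
      then show False
        using det_stabilizer_lagrangian[OF hyp even orth] \<open>det A \<noteq> 1\<close> by blast
    qed
    then have "odd (CARD('n))"
      using n by auto
    then have "det (- A) = 1"
      using det_uminus_odd[of A] det_orthogonal[OF orth] False by auto
    moreover have "- A \<in> orthogonal_group"
      using orth by (simp add: orthogonal_group_iff uminus_matrix_apply oform_linear)
    moreover have "(*v) (- A) ` V i = V i" if i: "i \<in> {1..k}" for i
    proof -
      have V: "vec.subspace (V i)"
        using flag i by (auto simp: isotropic_flag_def)
      have "(*v) (- A) ` V i = uminus ` (*v) A ` V i"
        by (auto simp: uminus_matrix_apply image_image)
      also have "\<dots> = uminus ` V i"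
        by (simp add: stab[OF i])
      also have "\<dots> = V i"
        using vec.subspace_neg[OF V] by (force simp: image_iff)
      finally show ?thesis .
    qed
    ultimately have "- A \<in> flag_stabilizer k V"
      by (simp add: flag_stabilizer_def special_orthogonal_def)
    moreover have "(- A) ** blocks e f N = blocks e' f' N ** (- A)" if "matching ?I N" for N
    proof -
      have "A *v (blocks e f N *v u) = blocks e' f' N *v (A *v u)" for u
        using conj[OF that] by (simp add: matrix_vector_mul_assoc)
      then show ?thesis
        by (simp add: matrix_eq matrix_vector_mul_assoc[symmetric] uminus_matrix_apply vec.neg)
    qed
    ultimately show ?thesis by blast
  qed
qed

end

section \<open>Realizing patterns\<close>

text \<open>Each link takes up one slot at its source and one at its target. An undotted loop has
  both at its vertex, which accounts for the factor 2 in the definition of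
  \<open>eoolps\<close>.\<close>

definition usage :: "link multiset \<Rightarrow> nat \<Rightarrow> nat" where
  "usage E i = size {#L \<in># E. source L = i#} + size {#L \<in># E. target L = i#}"

lemma usage_add_mset:
  "usage (add_mset L E) i = usage E i + (if source L = i then 1 else 0) + (if target L = i then 1 else 0)"
  by (simp add: usage_def)

lemma usage_eq: "num_sources E i + num_targets E i + 2 * num_loops E i = usage E i"
proof (induction E)
  case empty
  show ?case
    by (simp add: num_sources_def num_targets_def num_loops_def usage_def)
next
  case (add L E)
  then show ?case
    by (cases L) (simp_all add: num_sources_def num_targets_def num_loops_def usage_def)
qed

lemma eoolps_iff:
  "E \<in> eoolps k b \<longleftrightarrow> (\<forall>L\<in>#E. wf_link k L) \<and> (\<forall>i\<in>{1..k}. usage E i \<le> b i)"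
  by (simp add: eoolps_def usage_eq)

lemma drawingI:
  assumes "finite D" "image_mset fst (mset_set D) = E"
    "\<And>d. d \<in> D \<Longrightarrow> fst (snd d) \<in> slots k b \<and> snd (snd d) \<in> slots k b \<and>
      fst (fst (snd d)) = source (fst d) \<and> fst (snd (snd d)) = target (fst d) \<and> fst (snd d) \<noteq> snd (snd d)"
    "\<And>d d'. d \<in> D \<Longrightarrow> d' \<in> D \<Longrightarrow> d \<noteq> d' \<Longrightarrow>
      {fst (snd d), snd (snd d)} \<inter> {fst (snd d'), snd (snd d')} = {}"
  shows "drawing k b E D"
  unfolding drawing_def case_prod_unfold prod.collapse
  using assms(1,2) by (intro conjI ballI impI assms(4)) (simp_all add: assms(3))

lemma drawing_member:
  assumes "drawing k b E D" "d \<in> D"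
  shows "fst (snd d) \<in> slots k b" "snd (snd d) \<in> slots k b" "fst (fst (snd d)) = source (fst d)"
    "fst (snd (snd d)) = target (fst d)" "fst (snd d) \<noteq> snd (snd d)"
  by (fact drawingD[OF assms(1), of "fst d" "fst (snd d)" "snd (snd d)", unfolded prod.collapse,
        OF assms(2)])+

lemma drawing_count:
  assumes "drawing k b E D"
  shows "card {d \<in> D. Q (fst d)} = size {#L \<in># E. Q L#}"
proof -
  have "size (filter_mset Q (image_mset fst (mset_set D))) = card {d \<in> D. Q (fst d)}"
    using drawing_finite[OF assms] by (simp add: filter_mset_image_mset)
  then show ?thesis
    by (simp only: drawing_image[OF assms])
qed

section \<open>Slots occupied by a drawing\<close>

definition link_end :: "(link \<times> (nat \<times> nat) \<times> (nat \<times> nat)) \<times> bool \<Rightarrow> nat \<times> nat" where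
  "link_end u = (if snd u then fst (snd (fst u)) else snd (snd (fst u)))"

definition occupied :: "(link \<times> (nat \<times> nat) \<times> (nat \<times> nat)) set \<Rightarrow> (nat \<times> nat) set" where
  "occupied D = link_end ` (D \<times> UNIV)"

lemma link_end_inj:
  assumes "drawing k b E D"
  shows "inj_on link_end (D \<times> UNIV)"
proof (rule inj_onI)
  fix u v assume u: "u \<in> D \<times> UNIV" and v: "v \<in> D \<times> UNIV" and eq: "link_end u = link_end v"
  have D: "fst u \<in> D" "fst v \<in> D"
    using u v by (simp_all add: mem_Times_iff)
  have ends: "link_end w \<in> {fst (snd (fst w)), snd (snd (fst w))}" for w
    by (simp add: link_end_def)
  have "fst u = fst v"
  proof (rule ccontr)
    assume "fst u \<noteq> fst v"
    then have "{fst (snd (fst u)), snd (snd (fst u))} \<inter> {fst (snd (fst v)), snd (snd (fst v))} = {}"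
      by (rule drawing_disjoint[OF assms D])
    then show False
      using ends[of u] ends[of v] eq by (metis disjoint_iff)
  qed
  moreover have "snd u = snd v"
    using eq drawing_member(5)[OF assms D(1)] \<open>fst u = fst v\<close>
    by (cases "snd u"; cases "snd v") (simp_all add: link_end_def)
  ultimately show "u = v"
    by (rule prod_eqI)
qed

lemma fst_link_end:
  assumes "drawing k b E D" "d \<in> D"
  shows "fst (link_end (d, c)) = (if c then source (fst d) else target (fst d))"
  using drawing_member[OF assms] by (simp add: link_end_def)

lemma occupied_slots:
  assumes "drawing k b E D"
  shows "occupied D \<subseteq> slots k b"
  using drawing_member(1,2)[OF assms] by (auto simp: occupied_def link_end_def)

text \<open>\<open>link_end\<close> is injective, so slots over a vertex are counted by ends of
  links there. The number depends on \<open>E\<close> only: two drawings of \<open>E\<close> leave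
  equally many slots free over each vertex.\<close>

lemma card_occupied:
  assumes "drawing k b E D"
  shows "card {s \<in> occupied D. fst s = i} = usage E i"
proof -
  let ?S = "{d \<in> D. source (fst d) = i} \<times> {True}" and ?T = "{d \<in> D. target (fst d) = i} \<times> {False}"
  have sub: "?S \<union> ?T \<subseteq> D \<times> UNIV"
    by auto
  have "{s \<in> occupied D. fst s = i} = link_end ` (?S \<union> ?T)"
  proof
    show "{s \<in> occupied D. fst s = i} \<subseteq> link_end ` (?S \<union> ?T)"
    proof
      fix s assume "s \<in> {s \<in> occupied D. fst s = i}"
      then obtain d c where dc: "d \<in> D" "s = link_end (d, c)" "fst (link_end (d, c)) = i"
        by (auto simp: occupied_def)
      then have "(d, c) \<in> ?S \<union> ?T"
        using fst_link_end[OF assms dc(1), of c] by (cases c) simp_all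
      then show "s \<in> link_end ` (?S \<union> ?T)"
        unfolding dc(2) by (rule imageI)
    qed
    show "link_end ` (?S \<union> ?T) \<subseteq> {s \<in> occupied D. fst s = i}"
    proof
      fix s assume "s \<in> link_end ` (?S \<union> ?T)"
      then obtain u where u: "u \<in> ?S \<union> ?T" "s = link_end u"
        by (elim imageE)
      obtain d c where dc: "u = (d, c)"
        by (cases u)
      have d: "d \<in> D" "if c then source (fst d) = i else target (fst d) = i"
        using u(1) unfolding dc by (cases c; simp)+
      have "s \<in> occupied D"
        unfolding occupied_def u(2) dc using d(1) by (intro imageI) simp
      moreover have "fst s = i"
        unfolding u(2) dc fst_link_end[OF assms d(1)] using d(2) by (cases c) simp_all
      ultimately show "s \<in> {s \<in> occupied D. fst s = i}"
        by (intro CollectI conjI)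
    qed
  qed
  also have "card \<dots> = card (?S \<union> ?T)"
    by (rule card_image[OF inj_on_subset[OF link_end_inj[OF assms] sub]])
  also have "\<dots> = card ?S + card ?T"
    using drawing_finite[OF assms] by (intro card_Un_disjoint) auto
  also have "\<dots> = usage E i"
    using drawing_count[OF assms, of "\<lambda>L. source L = i"] drawing_count[OF assms, of "\<lambda>L. target L = i"]
    by (simp add: card_cartesian_product usage_def)
  finally show ?thesis .
qed

lemma drawing_usage:
  assumes "drawing k b E D" "i \<in> {1..k}"
  shows "usage E i \<le> b i"
proof -
  have "usage E i \<le> card {s \<in> slots k b. fst s = i}"
    unfolding card_occupied[OF assms(1), symmetric]
    using occupied_slots[OF assms(1)] finite_slots[of k b] by (intro card_mono) auto
  then show ?thesis
    using assms(2) by (simp add: card_slots_fiber)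
qed

lemma card_free_slots:
  assumes "drawing k b E D"
  shows "card {s \<in> slots k b - occupied D. fst s = i} = (if i \<in> {1..k} then b i else 0) - usage E i"
proof -
  have "{s \<in> slots k b - occupied D. fst s = i} = {s \<in> slots k b. fst s = i} - {s \<in> occupied D. fst s = i}"
    by auto
  moreover have "card ({s \<in> slots k b. fst s = i} - {s \<in> occupied D. fst s = i}) =
      card {s \<in> slots k b. fst s = i} - card {s \<in> occupied D. fst s = i}"
  proof (rule card_Diff_subset)
    show sub: "{s \<in> occupied D. fst s = i} \<subseteq> {s \<in> slots k b. fst s = i}"
      using occupied_slots[OF assms] by blast
    show "finite {s \<in> occupied D. fst s = i}"
      by (rule finite_subset[OF sub]) (simp add: finite_slots)
  qed
  ultimately show ?thesis
    by (simp only: card_slots_fiber card_occupied[OF assms])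
qed

lemma drawing_insert:
  assumes "drawing k b E D" "p \<in> slots k b - occupied D" "q \<in> slots k b - occupied D" "p \<noteq> q"
    "fst p = source L" "fst q = target L"
  shows "drawing k b (add_mset L E) (insert (L, p, q) D)"
proof -
  have occ: "fst (snd d) \<in> occupied D" "snd (snd d) \<in> occupied D" if "d \<in> D" for d
  proof -
    have "link_end (d, True) \<in> occupied D" "link_end (d, False) \<in> occupied D"
      using that by (simp_all add: occupied_def)
    then show "fst (snd d) \<in> occupied D" "snd (snd d) \<in> occupied D"
      by (simp_all add: link_end_def)
  qed
  have apart: "{p, q} \<inter> {fst (snd d), snd (snd d)} = {}" if "d \<in> D" for d
    using occ[OF that] assms(2,3) by auto
  have new: "(L, p, q) \<notin> D"
    using occ(1)[of "(L, p, q)"] assms(2) by auto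
  show ?thesis
  proof (rule drawingI)
    show "finite (insert (L, p, q) D)"
      using drawing_finite[OF assms(1)] by simp
    show "image_mset fst (mset_set (insert (L, p, q) D)) = add_mset L E"
      using new drawing_finite[OF assms(1)] drawing_image[OF assms(1)] by simp
  next
    fix d assume "d \<in> insert (L, p, q) D"
    then consider "d = (L, p, q)" | "d \<in> D"
      by blast
    then show "fst (snd d) \<in> slots k b \<and> snd (snd d) \<in> slots k b \<and>
      fst (fst (snd d)) = source (fst d) \<and> fst (snd (snd d)) = target (fst d) \<and> fst (snd d) \<noteq> snd (snd d)"
    proof cases
      case 1
      then show ?thesis using assms(2-6) by simp
    next
      case 2
      then show ?thesis using drawing_member[OF assms(1) 2] by simp
    qed
  next
    fix d d' assume d: "d \<in> insert (L, p, q) D" "d' \<in> insert (L, p, q) D" "d \<noteq> d'"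
    then consider "d = (L, p, q)" "d' \<in> D" | "d \<in> D" "d' = (L, p, q)" | "d \<in> D" "d' \<in> D"
      by blast
    then show "{fst (snd d), snd (snd d)} \<inter> {fst (snd d'), snd (snd d')} = {}"
    proof cases
      case 1
      then show ?thesis using apart[OF 1(2)] by simp
    next
      case 2
      then show ?thesis using apart[OF 2(1)] by (simp add: Int_commute)
    next
      case 3
      then show ?thesis using drawing_disjoint[OF assms(1) 3 d(3)] by simp
    qed
  qed
qed

lemma wf_link_ends: "wf_link k L \<Longrightarrow> source L \<in> {1..k} \<and> target L \<in> {1..k}"
  by (cases L) auto

lemma drawing_exists:
  assumes "\<forall>L\<in>#E. wf_link k L" "\<forall>i\<in>{1..k}. usage E i \<le> b i"
  shows "\<exists>D. drawing k b E D"
  using assms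
proof (induction E)
  case empty
  have "drawing k b {#} {}"
    by (simp add: drawing_def)
  then show ?case by blast
next
  case (add L E)
  have use: "usage E i + (if source L = i then 1 else 0) + (if target L = i then 1 else 0) \<le> b i"
    if "i \<in> {1..k}" for i
    using add.prems(2) that by (simp add: usage_add_mset)
  have "\<forall>i\<in>{1..k}. usage E i \<le> b i"
    using use by (metis add_leE)
  then obtain D where D: "drawing k b E D"
    using add.IH add.prems(1) by auto
  have ends: "source L \<in> {1..k}" "target L \<in> {1..k}"
    using wf_link_ends[of k L] add.prems(1) by auto
  define R where "R i = {s \<in> slots k b - occupied D. fst s = i}" for i
  have R: "card (R i) = b i - usage E i" if "i \<in> {1..k}" for i
    using card_free_slots[OF D, of i] that by (simp add: R_def)
  have "0 < card (R (source L))"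
    using R[OF ends(1)] use[OF ends(1)] by simp
  then obtain p where p: "p \<in> R (source L)"
    by (metis card.empty less_irrefl ex_in_conv)
  \<comment> \<open>If both ends are at the same vertex, the bound on \<open>usage\<close> leaves
    two free slots there, and \<open>p\<close> takes only one of them.\<close>
  have "0 < card (R (target L) - {p})"
  proof (cases "source L = target L")
    case True
    then have "2 \<le> card (R (target L))"
      using R[OF ends(2)] use[OF ends(2)] by simp
    then show ?thesis
      using card_Diff_singleton[of p "R (target L)"] p True by simp
  next
    case False
    then have "p \<notin> R (target L)"
      using p by (simp add: R_def)
    then show ?thesis
      using R[OF ends(2)] use[OF ends(2)] by simp
  qed
  then obtain q where q: "q \<in> R (target L)" "q \<noteq> p"
    by (metis card.empty less_irrefl ex_in_conv Diff_iff singletonI)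
  have "drawing k b (add_mset L E) (insert (L, p, q) D)"
    by (rule drawing_insert[OF D]) (use p q in \<open>simp_all add: R_def\<close>)
  then show ?case by blast
qed

text \<open>Equal links of the two drawings are matched and their ends carried along. Over each
  vertex equally many slots remain free, so the map extends to a permutation of all slots.\<close>

lemma drawings_isomorphic:
  assumes "drawing k b E D" "drawing k b E D'"
  obtains \<sigma> where "bij_betw \<sigma> (slots k b) (slots k b)" "\<And>s. s \<in> slots k b \<Longrightarrow> fst (\<sigma> s) = fst s"
    "bij_betw (\<lambda>(L, p, q). (L, \<sigma> p, \<sigma> q)) D D'"
proof -
  obtain h where h: "bij_betw h D D'" "\<And>d. d \<in> D \<Longrightarrow> fst (h d) = fst d"
  proof (rule fiberwise_bijection[of D D' fst fst])
    show "card {d \<in> D. fst d = L} = card {d \<in> D'. fst d = L}" for L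
      using drawing_count[OF assms(1), of "\<lambda>M. M = L"] drawing_count[OF assms(2), of "\<lambda>M. M = L"] by simp
  qed (use drawing_finite assms in auto)
  define \<tau> where "\<tau> = the_inv_into (D \<times> UNIV) link_end"
  \<comment> \<open>An occupied slot is read as an end of an entry of \<open>D\<close> and sent to
    the same end of the corresponding entry of \<open>D'\<close>.\<close>
  define \<sigma>1 where "\<sigma>1 = link_end \<circ> (map_prod h id \<circ> \<tau>)"
  have "bij_betw \<tau> (occupied D) (D \<times> UNIV)"
    unfolding \<tau>_def occupied_def
    by (rule bij_betw_the_inv_into) (simp add: bij_betw_def link_end_inj[OF assms(1)])
  moreover have "bij_betw (map_prod h id) (D \<times> (UNIV :: bool set)) (D' \<times> UNIV)"
    using h(1) unfolding bij_betw_def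
    by (intro conjI map_prod_inj_on map_prod_surj_on) simp_all
  moreover have "bij_betw link_end (D' \<times> UNIV) (occupied D')"
    by (simp add: bij_betw_def link_end_inj[OF assms(2)] occupied_def)
  ultimately have \<sigma>1: "bij_betw \<sigma>1 (occupied D) (occupied D')"
    unfolding \<sigma>1_def by (meson bij_betw_trans)
  have \<sigma>1_end: "\<sigma>1 (link_end (d, c)) = link_end (h d, c)" if "d \<in> D" for d c
    using that the_inv_into_f_f[OF link_end_inj[OF assms(1)], of "(d, c)"]
    by (simp add: \<sigma>1_def \<tau>_def)
  have hD: "h d \<in> D'" if "d \<in> D" for d
    using h(1) that by (rule bij_betw_apply)
  obtain \<sigma>2 where \<sigma>2: "bij_betw \<sigma>2 (slots k b - occupied D) (slots k b - occupied D')"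
    "\<And>s. s \<in> slots k b - occupied D \<Longrightarrow> fst (\<sigma>2 s) = fst s"
  proof (rule fiberwise_bijection[of "slots k b - occupied D" "slots k b - occupied D'" fst fst])
    show "card {s \<in> slots k b - occupied D. fst s = i} = card {s \<in> slots k b - occupied D'. fst s = i}" for i
      by (simp only: card_free_slots[OF assms(1)] card_free_slots[OF assms(2)])
  qed (auto simp: finite_slots)
  define \<sigma> where "\<sigma> s = (if s \<in> occupied D then \<sigma>1 s else \<sigma>2 s)" for s
  have "bij_betw \<sigma> (occupied D) (occupied D')"
    using \<sigma>1 by (rule bij_betw_cong[THEN iffD1, rotated]) (simp add: \<sigma>_def)
  moreover have "bij_betw \<sigma> (slots k b - occupied D) (slots k b - occupied D')"
    using \<sigma>2(1) by (rule bij_betw_cong[THEN iffD1, rotated]) (simp add: \<sigma>_def)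
  ultimately have "bij_betw \<sigma> (occupied D \<union> (slots k b - occupied D)) (occupied D' \<union> (slots k b - occupied D'))"
    by (rule bij_betw_combine) blast
  then have bij: "bij_betw \<sigma> (slots k b) (slots k b)"
    using occupied_slots[OF assms(1)] occupied_slots[OF assms(2)] by (simp add: Un_absorb1)
  have occ: "link_end (d, c) \<in> occupied D" if "d \<in> D" for d c
    unfolding occupied_def using that by (intro imageI) simp
  have \<sigma>_end: "\<sigma> (link_end (d, c)) = link_end (h d, c)" if "d \<in> D" for d c
    using occ[OF that] \<sigma>1_end[OF that] by (simp add: \<sigma>_def)
  have pres: "fst (\<sigma> s) = fst s" if s: "s \<in> slots k b" for s
  proof (cases "s \<in> occupied D")
    case True
    then obtain d c where dc: "d \<in> D" "s = link_end (d, c)"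
      unfolding occupied_def by blast
    show ?thesis
      unfolding dc(2) \<sigma>_end[OF dc(1)] fst_link_end[OF assms(2) hD[OF dc(1)]] fst_link_end[OF assms(1) dc(1)]
        h(2)[OF dc(1)] ..
  next
    case False
    then show ?thesis using \<sigma>2(2)[of s] s by (simp add: \<sigma>_def)
  qed
  have "h d = (\<lambda>(L, p, q). (L, \<sigma> p, \<sigma> q)) d" if d: "d \<in> D" for d
  proof -
    have "\<sigma> (fst (snd d)) = fst (snd (h d))" "\<sigma> (snd (snd d)) = snd (snd (h d))"
      using \<sigma>_end[OF d, of True] \<sigma>_end[OF d, of False] by (simp_all add: link_end_def)
    then show ?thesis
      by (simp add: case_prod_unfold prod_eq_iff h(2)[OF d])
  qed
  then have "bij_betw (\<lambda>(L, p, q). (L, \<sigma> p, \<sigma> q)) D D'"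
    using bij_betw_cong[of D h "\<lambda>(L, p, q). (L, \<sigma> p, \<sigma> q)" D'] h(1) by simp
  with bij pres that show thesis
    by blast
qed

section \<open>Patterns under conjugation\<close>

context maximal_flag
begin

lemma adaptedI:
  assumes "\<And>i. i \<in> {1..k} \<Longrightarrow> V i = vec.span (e ` slots i b)" "hyperbolic (slots k b) e f"
  shows "adapted_basis k V e f"
  using assms by (simp add: adapted_basis_def hyperbolic_def)

lemma slots_filter: "i \<le> k \<Longrightarrow> slots i b = {s \<in> slots k b. fst s \<le> i}"
  by (auto simp: slots_def)

text \<open>A permutation within the vertices maps each \<open>slots i b\<close> onto itself, so the
  spans forming the flag do not change.\<close>

lemma adapted_permute:
  assumes "adapted_basis k V e f" "bij_betw \<sigma> (slots k b) (slots k b)"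
    "\<And>s. s \<in> slots k b \<Longrightarrow> fst (\<sigma> s) = fst s"
  shows "adapted_basis k V (e \<circ> \<sigma>) (f \<circ> \<sigma>)"
proof (rule adaptedI)
  fix i assume i: "i \<in> {1..k}"
  have filter: "slots i b = {s \<in> slots k b. fst s \<le> i}"
    by (rule slots_filter) (use i in simp)
  have "\<sigma> ` slots i b = {s \<in> \<sigma> ` slots k b. fst s \<le> i}"
    unfolding filter using assms(3) by auto
  also have "\<sigma> ` slots k b = slots k b"
    by (rule bij_betw_imp_surj_on[OF assms(2)])
  finally have perm: "\<sigma> ` slots i b = slots i b"
    unfolding filter .
  show "V i = vec.span ((e \<circ> \<sigma>) ` slots i b)"
    by (simp only: image_comp[symmetric] perm adapted_span[OF assms(1) i])
next
  have "\<sigma> s \<in> slots k b" if "s \<in> slots k b" for s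
    using assms(2) that by (rule bij_betw_apply)
  moreover have "\<sigma> s = \<sigma> t \<longleftrightarrow> s = t" if "s \<in> slots k b" "t \<in> slots k b" for s t
    using bij_betw_imp_inj_on[OF assms(2)] that by (rule inj_on_eq_iff)
  ultimately show "hyperbolic (slots k b) (e \<circ> \<sigma>) (f \<circ> \<sigma>)"
    using adapted_hyperbolic[OF assms(1)] by (simp add: hyperbolic_def)
qed

lemma pattern_matching:
  assumes "has_pattern k V x E"
  obtains e f D where "adapted_basis k V e f" "drawing k b E D" "x = blocks e f (to_match ` D)"
proof -
  obtain e f D where ef: "adapted_basis k V e f" and D: "drawing k b E D"
    and x: "x = (\<Sum>(L, p, q)\<in>D. link_block e f L p q)"
    using assms unfolding has_pattern_def by blast
  show thesis
    by (rule that[OF ef D]) (simp only: x pattern_blocks[OF D])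
qed

lemma matching_pattern:
  assumes "adapted_basis k V e f" "drawing k b E D"
  shows "has_pattern k V (blocks e f (to_match ` D)) E"
  unfolding has_pattern_def
  using assms by (intro exI[of _ e] exI[of _ f] exI[of _ D] conjI pattern_blocks[symmetric])

text \<open>Renaming the slots of the second basis by \<open>\<sigma>\<close> expresses
  \<open>x\<close> and \<open>y\<close> through the same matching; the map between the two bases
  then conjugates one into the other.\<close>

lemma pattern_conjugate:
  assumes "has_pattern k V x E" "has_pattern k V y E"
  shows "\<exists>A\<in>flag_stabilizer k V. A ** x = y ** A"
proof -
  obtain e f D where 1: "adapted_basis k V e f" "drawing k b E D" "x = blocks e f (to_match ` D)"
    using assms(1) by (rule pattern_matching)
  obtain e' f' D' where 2: "adapted_basis k V e' f'" "drawing k b E D'"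
    "y = (\<Sum>(L, p, q)\<in>D'. link_block e' f' L p q)"
    using assms(2) unfolding has_pattern_def by blast
  obtain \<sigma> where \<sigma>: "bij_betw \<sigma> (slots k b) (slots k b)" "\<And>s. s \<in> slots k b \<Longrightarrow> fst (\<sigma> s) = fst s"
    "bij_betw (\<lambda>(L, p, q). (L, \<sigma> p, \<sigma> q)) D D'"
    using drawings_isomorphic[OF 1(2) 2(2)] by blast
  have "y = (\<Sum>d\<in>D. case (\<lambda>(L, p, q). (L, \<sigma> p, \<sigma> q)) d of (L, p, q) \<Rightarrow> link_block e' f' L p q)"
    unfolding 2(3) by (rule sum.reindex_bij_betw[OF \<sigma>(3), symmetric])
  also have "\<dots> = (\<Sum>(L, p, q)\<in>D. link_block (e' \<circ> \<sigma>) (f' \<circ> \<sigma>) L p q)"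
    by (rule sum.cong[OF refl]) (simp add: case_prod_unfold link_block_wedge side_def)
  also have "\<dots> = blocks (e' \<circ> \<sigma>) (f' \<circ> \<sigma>) (to_match ` D)"
    by (rule pattern_blocks[OF 1(2)])
  finally have y: "y = blocks (e' \<circ> \<sigma>) (f' \<circ> \<sigma>) (to_match ` D)" .
  show ?thesis
    using adapted_conjugate[OF 1(1) adapted_permute[OF 2(1) \<sigma>(1,2)]] drawing_matching[OF 1(2)]
    unfolding 1(3) y by blast
qed

lemma pattern_invariant:
  assumes "A \<in> flag_stabilizer k V" "A ** x = y ** A" "has_pattern k V x E"
  shows "has_pattern k V y E"
proof -
  obtain e f D where 1: "adapted_basis k V e f" "drawing k b E D" "x = blocks e f (to_match ` D)"
    using assms(3) by (rule pattern_matching)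
  have orth: "A \<in> orthogonal_group" and stab: "\<And>i. i \<in> {1..k} \<Longrightarrow> (*v) A ` V i = V i"
    using assms(1) by (simp_all add: flag_stabilizer_def special_orthogonal_def)
  have inv: "invertible A"
    using orth by (simp add: orthogonal_group_def)
  define e' where "e' = (\<lambda>p. A *v e p)"
  define f' where "f' = (\<lambda>p. A *v f p)"
  have "adapted_basis k V e' f'"
  proof (rule adaptedI)
    fix i assume i: "i \<in> {1..k}"
    have "V i = (*v) A ` vec.span (e ` slots i b)"
      using stab[OF i] adapted_span[OF 1(1) i] by simp
    also have "\<dots> = vec.span ((*v) A ` e ` slots i b)"
      by (rule vec.span_image[symmetric])
    finally show "V i = vec.span (e' ` slots i b)"
      by (simp only: image_image e'_def)
  next
    show "hyperbolic (slots k b) e' f'"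
      using adapted_hyperbolic[OF 1(1)] orth
      by (simp add: hyperbolic_def e'_def f'_def orthogonal_group_iff)
  qed
  note ef' = this
  have y: "y = blocks e' f' (to_match ` D)"
  proof -
    have "y ** A = blocks e' f' (to_match ` D) ** A"
      using assms(2) blocks_conjugate[OF orth drawing_matching[OF 1(2)], of e e' f f']
      by (simp add: 1(3) e'_def f'_def)
    then have "y ** A ** matrix_inv A = blocks e' f' (to_match ` D) ** A ** matrix_inv A"
      by (rule arg_cong)
    then show ?thesis
      by (simp only: matrix_mul_assoc[symmetric] matrix_inv_invertible[OF inv] matrix_mul_rid)
  qed
  show ?thesis
    unfolding y by (rule matching_pattern[OF ef' 1(2)])
qed

lemma pattern_eoolps:
  assumes "x \<in> nilpotent2"
  shows "\<exists>!E. E \<in> eoolps k b \<and> has_pattern k V x E"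
proof -
  obtain E where E: "has_pattern k V x E" "\<forall>L\<in>#E. wf_link k L"
    using pattern_exists[OF assms] by blast
  obtain D where D: "drawing k b E D"
    using E(1) unfolding has_pattern_def by blast
  have "E \<in> eoolps k b"
    unfolding eoolps_iff using E(2) drawing_usage[OF D] by blast
  moreover have "E' = E" if "E' \<in> eoolps k b" "has_pattern k V x E'" for E'
    using pattern_unique[OF that(2) E(1) _ E(2)] that(1) unfolding eoolps_iff by blast
  ultimately show ?thesis
    using E(1) by blast
qed

lemma pattern_realized:
  assumes "E \<in> eoolps k b"
  shows "\<exists>x\<in>nilpotent2. has_pattern k V x E"
proof -
  obtain D where D: "drawing k b E D"
    using assms drawing_exists unfolding eoolps_iff by blast
  obtain e f where ef: "adapted_basis k V e f"
    using adapted_basis_exists by blast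
  have "blocks e f (to_match ` D) \<in> nilpotent2"
    by (rule matching_nilpotent[OF adapted_hyperbolic[OF ef] drawing_matching[OF D]])
  moreover have "has_pattern k V (blocks e f (to_match ` D)) E"
    by (rule matching_pattern[OF ef D])
  ultimately show ?thesis
    by blast
qed

end

section \<open>Orbits and patterns\<close>

theorem theorem7p7:
  fixes l k :: nat
    and V :: "nat \<Rightarrow> 'n::{finite,linorder} cvec set"
    and P :: "'n cmat set"
  assumes "CARD('n) = 2 * l \<or> CARD('n) = 2 * l + 1"
    and "standard_parabolic P"
    and "isotropic_flag k V"
    and "P = flag_stabilizer k V"
    and maximal: "flag_dim V k = l"
  shows "\<exists>\<Phi>. bij_betw \<Phi> (orbits (SO\<lparr>carrier := P\<rparr>) nilpotent2 conjugation)
                 (eoolps k (block_vector V)) \<and>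
             (\<forall>\<O>\<in>orbits (SO\<lparr>carrier := P\<rparr>) nilpotent2 conjugation.
                \<forall>x\<in>\<O>. has_pattern k V x (\<Phi> \<O>))"
proof -
  interpret maximal_flag l k V
    using assms by unfold_locales auto
  have P: "subgroup P SO"
    using assms(2) by (simp add: standard_parabolic_def)
  have one: "mat 1 \<in> P"
    using subgroup.one_closed[OF P] by (simp add: SO_def)
  have mult: "A ** B \<in> P" if "A \<in> P" "B \<in> P" for A B
    using subgroup.m_closed[OF P that] by (simp add: SO_def)
  have inv: "invertible A" if "A \<in> P" for A
    using that by (simp add: assms(4) flag_stabilizer_def special_orthogonal_def orthogonal_group_def)
  \<comment> \<open>Conjugacy is restated as an intertwining relation, so that no inverses have to
    be carried along.\<close>
  define orb where "orb x = {y. \<exists>A\<in>P. A ** x = y ** A}" for x :: "'n cmat"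
  have orbit: "orbit (SO\<lparr>carrier := P\<rparr>) conjugation x = orb x" for x
  proof -
    have "orbit (SO\<lparr>carrier := P\<rparr>) conjugation x = {y. \<exists>A\<in>P. conjugation A x = y}"
      by (auto simp: orbit_def)
    also have "\<dots> = orb x"
      unfolding orb_def by (intro Collect_cong bex_cong refl conjugation_iff inv)
    finally show ?thesis .
  qed
  have orbits: "orbits (SO\<lparr>carrier := P\<rparr>) nilpotent2 conjugation = orb ` nilpotent2"
    by (auto simp: orbits_def orbit)
  have self: "x \<in> orb x" for x
    unfolding orb_def using one by (intro CollectI bexI[of _ "mat 1"]) simp_all
  have trans: "z \<in> orb x" if yx: "y \<in> orb x" and zy: "z \<in> orb y" for x y z
  proof -
    obtain A where A: "A \<in> P" "A ** x = y ** A"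
      using yx unfolding orb_def by blast
    obtain B where B: "B \<in> P" "B ** y = z ** B"
      using zy unfolding orb_def by blast
    have "B ** A ** x = B ** (A ** x)"
      by (simp only: matrix_mul_assoc)
    also have "\<dots> = B ** y ** A"
      by (simp only: A(2) matrix_mul_assoc)
    also have "\<dots> = z ** (B ** A)"
      by (simp only: B(2) matrix_mul_assoc)
    finally show ?thesis
      unfolding orb_def using mult[OF B(1) A(1)] by blast
  qed
  define pattern where "pattern x = (THE E. E \<in> eoolps k b \<and> has_pattern k V x E)" for x
  have pattern: "pattern x \<in> eoolps k b" "has_pattern k V x (pattern x)" if "x \<in> nilpotent2" for x
    using theI'[OF pattern_eoolps[OF that]] by (simp_all add: pattern_def)
  have pattern_eq: "pattern x = E" if "x \<in> nilpotent2" "E \<in> eoolps k b" "has_pattern k V x E" for x E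
    unfolding pattern_def by (rule the1_equality[OF pattern_eoolps[OF that(1)] conjI[OF that(2,3)]])
  \<comment> \<open>The pattern of a chosen representative; by \<open>on_orbit\<close> and
    uniqueness, every other one has the same pattern.\<close>
  define \<Phi> where "\<Phi> \<O> = pattern (SOME x. x \<in> nilpotent2 \<and> \<O> = orb x)" for \<O>
  have on_orbit: "has_pattern k V y E" if "has_pattern k V x E" "y \<in> orb x" for x y E
  proof -
    have "\<exists>A\<in>P. A ** x = y ** A"
      using that(2) by (simp only: orb_def mem_Collect_eq)
    then obtain A where A: "A \<in> P" "A ** x = y ** A"
      by (elim bexE)
    show ?thesis
      by (rule pattern_invariant[OF A(1)[unfolded assms(4)] A(2) that(1)])
  qed
  have \<Phi>: "\<Phi> (orb x) = pattern x" if x: "x \<in> nilpotent2" for x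
  proof -
    define y where "y = (SOME y. y \<in> nilpotent2 \<and> orb x = orb y)"
    have y: "y \<in> nilpotent2 \<and> orb x = orb y"
      unfolding y_def by (rule someI[of _ x]) (use x in blast)
    have "x \<in> orb y"
      using self[of x] y by simp
    then have "has_pattern k V x (pattern y)"
      by (rule on_orbit[OF pattern(2)[OF conjunct1[OF y]]])
    then have "pattern x = pattern y"
      by (rule pattern_eq[OF x pattern(1)[OF conjunct1[OF y]]])
    then show ?thesis
      unfolding \<Phi>_def y_def[symmetric] by (rule sym)
  qed
  have same: "orb x = orb y" if "x \<in> nilpotent2" "y \<in> nilpotent2" "pattern x = pattern y" for x y
  proof -
    have px: "has_pattern k V x (pattern x)" and py: "has_pattern k V y (pattern x)"
      using pattern(2)[OF that(1)] pattern(2)[OF that(2)] that(3) by simp_all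
    have y: "y \<in> orb x" and x: "x \<in> orb y"
      using pattern_conjugate[OF px py] pattern_conjugate[OF py px] by (simp_all add: orb_def assms(4))
    show ?thesis
    proof (intro equalityI subsetI)
      show "z \<in> orb y" if "z \<in> orb x" for z
        by (rule trans[OF x that])
      show "z \<in> orb x" if "z \<in> orb y" for z
        by (rule trans[OF y that])
    qed
  qed
  have bij: "bij_betw \<Phi> (orb ` nilpotent2) (eoolps k b)"
  proof (rule bij_betw_imageI)
    show "inj_on \<Phi> (orb ` nilpotent2)"
    proof (rule inj_onI)
      fix X Y assume X: "X \<in> orb ` nilpotent2" and Y: "Y \<in> orb ` nilpotent2" and eq: "\<Phi> X = \<Phi> Y"
      obtain x where x: "X = orb x" "x \<in> nilpotent2"
        using X by (rule imageE)
      obtain y where y: "Y = orb y" "y \<in> nilpotent2"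
        using Y by (rule imageE)
      have "pattern x = pattern y"
        using eq by (simp only: x(1) y(1) \<Phi>[OF x(2)] \<Phi>[OF y(2)])
      then show "X = Y"
        unfolding x(1) y(1) by (rule same[OF x(2) y(2)])
    qed
    show "\<Phi> ` orb ` nilpotent2 = eoolps k b"
    proof
      show "\<Phi> ` orb ` nilpotent2 \<subseteq> eoolps k b"
      proof (rule image_subsetI)
        fix X assume "X \<in> orb ` nilpotent2"
        then obtain x where x: "X = orb x" "x \<in> nilpotent2"
          by (rule imageE)
        show "\<Phi> X \<in> eoolps k b"
          unfolding x(1) \<Phi>[OF x(2)] by (rule pattern(1)[OF x(2)])
      qed
      show "eoolps k b \<subseteq> \<Phi> ` orb ` nilpotent2"
      proof
        fix E assume E: "E \<in> eoolps k b"
        obtain x where x: "x \<in> nilpotent2" "has_pattern k V x E"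
          using pattern_realized[OF E] by (elim bexE)
        have eq: "E = \<Phi> (orb x)"
          using pattern_eq[OF x(1) E x(2)] by (simp only: \<Phi>[OF x(1)])
        show "E \<in> \<Phi> ` orb ` nilpotent2"
          unfolding eq by (intro imageI x(1))
      qed
    qed
  qed
  have pat: "has_pattern k V y (\<Phi> \<O>)" if \<O>: "\<O> \<in> orb ` nilpotent2" and y: "y \<in> \<O>" for \<O> y
  proof -
    obtain x where x: "\<O> = orb x" "x \<in> nilpotent2"
      using \<O> by (rule imageE)
    show ?thesis
      unfolding x(1) \<Phi>[OF x(2)] by (rule on_orbit[OF pattern(2)[OF x(2)] y[unfolded x(1)]])
  qed
  show ?thesis
    unfolding orbits
  proof (intro exI conjI ballI)
    show "bij_betw \<Phi> (orb ` nilpotent2) (eoolps k b)"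
      by (rule bij)
    show "has_pattern k V y (\<Phi> \<O>)" if "\<O> \<in> orb ` nilpotent2" "y \<in> \<O>" for \<O> y
      by (rule pat[OF that])
  qed
qed

end
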